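(* Let $V$ be a weak quantum vertex algebra, let $\phi(x,z)$ be an associate of $F_{\mathrm{add}}(x,y)=x+y$, and let $f(x)\in x\mathbb{C}[[x]]$ with $f'(0)\neq 0$. Set $\phi_f(x,z)=f^{-1}(\phi(f(x),z))$. Then the category of $\phi$-coordinated $V$-modules is canonically isomorphic to the category of $\phi_f$-coordinated $V$-modules (the isomorphism sending $(W,Y_W)$ to $(W,Y_W^f)$, where $Y_W^f(v,x)=Y_W(v,f(x))$ for $v\in V$, and being the identity on underlying linear maps of homomorphisms).
   Context: All vector spaces are over $\mathbb{C}$. For a vector space $U$: $U((x))$ is the space of formal Laurent series with finitely many negative powers; $U((x_1,x_2))=U[[x_1,x_2]][x_1^{-1},x_2^{-1}]$. Let $\delta(x)=\sum_{n\in\mathbb{Z}}x^n$; powers $(x_1\pm x_2)^n$ are expanded in nonnegative powers of the second variable $x_2$, and similarly for series in $x_1\pm x_2$. **Associate.** An associate of $F_{\mathrm{add}}(x,y)=x+y$ is a series $\phi(x,z)\in\mathbb{C}((x))[[z]]$ with $\phi(x,0)=x$ and $\phi(\phi(x,y),z)=\phi(x,y+z)$. For $f(x)\in x\mathbb{C}[[x]]$ with $f'(0)\ne0$, $f^{-1}(x)\in x\mathbb{C}[[x]]$ denotes the compositional inverse. The series $\phi_f(x,z)$ is again an associate. **Weak quantum vertex algebra.** A vector space $V$ with a linear map $Y(\cdot,x):V\to(\mathrm{End}\,V)[[x,x^{-1}]]$, $v\mapsto Y(v,x)=\sum_{n\in\mathbb{Z}}v_nx^{-n-1}$, and a vector $\mathbf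 1\in V$ such that $Y(u,x)v\in V((x))$ for $u,v\in V$; $Y(\mathbf 1,x)v=v$, $Y(u,x)\mathbf 1\in V[[x]]$, $\lim_{x\to0}Y(u,x)\mathbf 1=u$; and for any $u,v\in V$ there exist finitely many $u^{(i)},v^{(i)}\in V$, $f_i(x)\in\mathbb{C}((x))$ ($1\le i\le r$) such that $$x_0^{-1}\delta\left(\tfrac{x_1-x_2}{x_0}\right)Y(u,x_1)Y(v,x_2)-x_0^{-1}\delta\left(\tfrac{x_2-x_1}{-x_0}\right)\sum_{i=1}^r f_i(x_2-x_1)Y(v^{(i)},x_2)Y(u^{(i)},x_1)=x_2^{-1}\delta\left(\tfrac{x_1-x_0}{x_2}\right)Y(Y(u,x_0)v,x_2).$$ **$\phi$-coordinated module.** For an associate $\phi$, a $\phi$-coordinated $V$-module is a vector space $W$ with a linear map $Y_W(\cdot,x):V\to(\mathrm{End}\,W)[[x,x^{-1}]]$ such that $Y_W(v,x)w\in W((x))$ for $v\in V,w\in W$; $Y_W(\mathbf 1,x)=1_W$; and for any $u,v\in V$ there is $k\in\mathbb{N}$ (nonnegative integer) with $(x_1-x_2)^kY_W(u,x_1)Y_W(v,x_2)\in\mathrm{Hom}(W,W((x_1,x_2)))$ and $$\left((x_1-x_2)^kY_W(u,x_1)Y_W(v,x_2)\right)|_{x_1=\phi(x_2,z)}=(\phi(x_2,z)-x_2)^kY_W(Y(u,z)v,x_2).$$ Here, for $A(x_1,x_2)\in\mathrm{Hom}(W,W((x_1,x_2)))$, the substitution $A(\phi(x_2,z),x_2)$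 is an element of $(\mathrm{Hom}(W,W((x_2))))[[z]]$ (note $\phi(x,z)$ is invertible in $\mathbb{C}((x))[[z]]$). A homomorphism $(W_1,Y_{W_1})\to(W_2,Y_{W_2})$ is a linear map $\theta$ with $\theta Y_{W_1}(v,x)w=Y_{W_2}(v,x)\theta(w)$ for all $v\in V$, $w\in W_1$. *)

theory Defs
  imports
    "HOL-Algebra.Module"
    "HOL-Computational_Algebra.Formal_Laurent_Series"
    "HOL-Library.Groups_Big_Fun"
    "HOL-Library.Product_Plus"
    HOL.Complex
begin

unbundle fps_syntax

section \<open>Complex vector spaces and formal series\<close>

definition complex_ring :: "complex ring" where
  "complex_ring = \<lparr>carrier = UNIV, monoid.mult = (*), one = 1, zero = 0, add = (+)\<rparr>"

text \<open>The fields \<open>mult\<close> and \<open>one\<close> that the module record inherits from rings play no role.\<close>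

abbreviation complex_space :: "(complex, 'w, 'm) module_scheme \<Rightarrow> bool" where
  "complex_space W \<equiv> Module.module complex_ring W"

definition linear_maps ::
    "(complex, 'u, 'm) module_scheme \<Rightarrow> (complex, 'w, 'n) module_scheme \<Rightarrow> ('u \<Rightarrow> 'w) set" where
  "linear_maps U W = {h \<in> carrier U \<rightarrow>\<^sub>E carrier W.
     (\<forall>x\<in>carrier U. \<forall>y\<in>carrier U. h (x \<oplus>\<^bsub>U\<^esub> y) = h x \<oplus>\<^bsub>W\<^esub> h y) \<and>
     (\<forall>c. \<forall>x\<in>carrier U. h (c \<odot>\<^bsub>U\<^esub> x) = c \<odot>\<^bsub>W\<^esub> h x)}"

text \<open>
  A formal series with coefficients in \<open>W\<close> is its coefficient function; the index (an integer,
  or a tuple of integers for several variables) is the exponent. The infinite sums below are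
  pointwise finite: each is the sum over the support, which is finite wherever the sum
  is meaningful.
\<close>

definition support_sum :: "(complex, 'w, 'm) module_scheme \<Rightarrow> ('i \<Rightarrow> 'w) \<Rightarrow> 'w" where
  "support_sum W g = finsum W g {i. g i \<noteq> \<zero>\<^bsub>W\<^esub>}"

definition series_mult ::
    "(complex, 'w, 'm) module_scheme \<Rightarrow> ('i::ab_group_add \<Rightarrow> complex) \<Rightarrow> ('i \<Rightarrow> 'w) \<Rightarrow> 'i \<Rightarrow> 'w" where
  "series_mult W c a n = support_sum W (\<lambda>i. c i \<odot>\<^bsub>W\<^esub> a (n - i))"

text \<open>\<open>W((x))\<close>\<close>

definition laurent :: "(complex, 'w, 'm) module_scheme \<Rightarrow> (int \<Rightarrow> 'w) set" where
  "laurent W = {a. range a \<subseteq> carrier W \<and> (\<exists>N. \<forall>n<N. a n = \<zero>\<^bsub>W\<^esub>)}"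

text \<open>\<open>W((x\<^sub>1, x\<^sub>2)) = W[[x\<^sub>1, x\<^sub>2]][x\<^sub>1\<^sup>-\<^sup>1, x\<^sub>2\<^sup>-\<^sup>1]\<close>\<close>

definition laurent2 :: "(complex, 'w, 'm) module_scheme \<Rightarrow> (int \<times> int \<Rightarrow> 'w) set" where
  "laurent2 W = {a. range a \<subseteq> carrier W \<and>
     (\<exists>N. \<forall>i j. i < N \<or> j < N \<longrightarrow> a (i, j) = \<zero>\<^bsub>W\<^esub>)}"

text \<open>
  \<open>diff_pow n i j\<close> is the coefficient of \<open>x\<^sup>i y\<^sup>j\<close> in \<open>(x - y)\<^sup>n\<close>, expanded in nonnegative powers
  of the second variable \<open>y\<close>.
\<close>

definition diff_pow :: "int \<Rightarrow> int \<Rightarrow> int \<Rightarrow> complex" where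
  "diff_pow n i j =
     (if 0 \<le> j \<and> i + j = n then (- 1) ^ nat j * (of_int n gchoose nat j) else 0)"

section \<open>Associates of the additive formal group\<close>

text \<open>
  An element \<open>P(x, z)\<close> of \<open>\<complex>((x))[[z]]\<close> has type \<^typ>\<open>complex fls fps\<close>. The series
  \<open>fls_subst g P\<close> is \<open>g(P(x, z)) = \<Sum>\<^sub>m g\<^sub>m P(x, z)\<^sup>m\<close>; it is meaningful when \<open>P(x, 0)\<close> is a nonzero
  element of \<open>x\<complex>[[x]]\<close>, since then the coefficient of each \<open>z\<^sup>j x\<^sup>n\<close> receives finitely many
  contributions.
\<close>

definition fls_subst :: "complex fls \<Rightarrow> complex fls fps \<Rightarrow> complex fls fps" where
  "fls_subst g P =
     Abs_fps (\<lambda>j. Abs_fls (\<lambda>n. Sum_any (\<lambda>m. g $$ m * ((P powi m) $ j $$ n))))"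

text \<open>
  The second condition is \<open>\<phi>(\<phi>(x, y), z) = \<phi>(x, y + z)\<close>, compared at \<open>y\<^sup>i z\<^sup>j\<close>.
\<close>

definition associate :: "complex fls fps \<Rightarrow> bool" where
  "associate \<phi> \<longleftrightarrow> \<phi> $ 0 = fls_X \<and>
     (\<forall>i j. fls_subst (\<phi> $ j) \<phi> $ i = of_nat ((i + j) choose i) * \<phi> $ (i + j))"

text \<open>\<open>\<phi>\<^sub>f(x, z) = f\<^sup>-\<^sup>1(\<phi>(f(x), z))\<close>\<close>

definition twisted_associate :: "complex fps \<Rightarrow> complex fls fps \<Rightarrow> complex fls fps" where
  "twisted_associate f \<phi> =
     fls_subst (fps_to_fls (fps_inv f)) (Abs_fps (\<lambda>n. fls_compose_fps (\<phi> $ n) f))"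

section \<open>Weak quantum vertex algebras\<close>

text \<open>
  A map \<open>Y\<close> from \<open>V\<close> to \<open>(End W)[[x, x\<^sup>-\<^sup>1]]\<close>: the operator \<open>Y v n\<close> is the coefficient of \<open>x\<^sup>n\<close> in
  \<open>Y(v, x)\<close>, that is, the mode \<open>v\<^sub>m\<close> with \<open>m = - n - 1\<close>. Outside the carriers \<open>Y\<close> is normalised to
  \<^term>\<open>undefined\<close>, so that equality of such maps is equality of functions.
\<close>

definition operator_map ::
    "(complex, 'v, 'm) module_scheme \<Rightarrow> (complex, 'w, 'n) module_scheme \<Rightarrow>
     ('v \<Rightarrow> int \<Rightarrow> 'w \<Rightarrow> 'w) \<Rightarrow> bool" where
  "operator_map V W Y \<longleftrightarrow>
     Y \<in> extensional (carrier V) \<and>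
     (\<forall>v\<in>carrier V. \<forall>n. Y v n \<in> linear_maps W W) \<and>
     (\<forall>u\<in>carrier V. \<forall>v\<in>carrier V. \<forall>n. \<forall>w\<in>carrier W.
        Y (u \<oplus>\<^bsub>V\<^esub> v) n w = Y u n w \<oplus>\<^bsub>W\<^esub> Y v n w) \<and>
     (\<forall>c. \<forall>v\<in>carrier V. \<forall>n. \<forall>w\<in>carrier W. Y (c \<odot>\<^bsub>V\<^esub> v) n w = c \<odot>\<^bsub>W\<^esub> Y v n w)"

record 'v vertex_structure = "(complex, 'v) module" +
  vop :: "'v \<Rightarrow> int \<Rightarrow> 'v \<Rightarrow> 'v"
  vac :: 'v

text \<open>
  The scalar factors of the Jacobi identity, as coefficient functions in the exponents
  \<open>(k\<^sub>0, k\<^sub>1, k\<^sub>2)\<close> of \<open>x\<^sub>0, x\<^sub>1, x\<^sub>2\<close>: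
  \<^item> \<open>x\<^sub>0\<^sup>-\<^sup>1 \<delta>((x\<^sub>1 - x\<^sub>2)/x\<^sub>0) = \<Sum>\<^sub>n x\<^sub>0\<^sup>-\<^sup>n\<^sup>-\<^sup>1 (x\<^sub>1 - x\<^sub>2)\<^sup>n\<close>
  \<^item> \<open>x\<^sub>0\<^sup>-\<^sup>1 \<delta>((x\<^sub>2 - x\<^sub>1)/(-x\<^sub>0)) = \<Sum>\<^sub>n (-1)\<^sup>n x\<^sub>0\<^sup>-\<^sup>n\<^sup>-\<^sup>1 (x\<^sub>2 - x\<^sub>1)\<^sup>n\<close>
  \<^item> \<open>x\<^sub>2\<^sup>-\<^sup>1 \<delta>((x\<^sub>1 - x\<^sub>0)/x\<^sub>2) = \<Sum>\<^sub>n x\<^sub>2\<^sup>-\<^sup>n\<^sup>-\<^sup>1 (x\<^sub>1 - x\<^sub>0)\<^sup>n\<close>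
  \<^item> \<open>g(x\<^sub>2 - x\<^sub>1) = \<Sum>\<^sub>m g\<^sub>m (x\<^sub>2 - x\<^sub>1)\<^sup>m\<close>
\<close>

definition delta_12 :: "int \<times> int \<times> int \<Rightarrow> complex" where
  "delta_12 = (\<lambda>(k0, k1, k2). diff_pow (- k0 - 1) k1 k2)"

definition delta_21 :: "int \<times> int \<times> int \<Rightarrow> complex" where
  "delta_21 = (\<lambda>(k0, k1, k2). (- 1) powi (- k0 - 1) * diff_pow (- k0 - 1) k2 k1)"

definition delta_10 :: "int \<times> int \<times> int \<Rightarrow> complex" where
  "delta_10 = (\<lambda>(k0, k1, k2). diff_pow (- k2 - 1) k1 k0)"

definition at_diff_21 :: "complex fls \<Rightarrow> int \<times> int \<times> int \<Rightarrow> complex" where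
  "at_diff_21 g =
     (\<lambda>(k0, k1, k2). if k0 = 0 then g $$ (k1 + k2) * diff_pow (k1 + k2) k2 k1 else 0)"

definition jacobi_identity ::
    "('v, 'm) vertex_structure_scheme \<Rightarrow> 'v \<Rightarrow> 'v \<Rightarrow>
     nat \<Rightarrow> (nat \<Rightarrow> 'v) \<Rightarrow> (nat \<Rightarrow> 'v) \<Rightarrow> (nat \<Rightarrow> complex fls) \<Rightarrow> bool" where
  "jacobi_identity V u v r us vs fs \<longleftrightarrow>
     (\<forall>w\<in>carrier V. \<forall>k.
        series_mult V delta_12
          (\<lambda>(k0, k1, k2). if k0 = 0 then vop V u k1 (vop V v k2 w) else \<zero>\<^bsub>V\<^esub>) k
        \<ominus>\<^bsub>V\<^esub>
        series_mult V delta_21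
          (\<lambda>l. finsum V (\<lambda>i. series_mult V (at_diff_21 (fs i))
             (\<lambda>(k0, k1, k2). if k0 = 0 then vop V (vs i) k2 (vop V (us i) k1 w) else \<zero>\<^bsub>V\<^esub>) l)
           {1..r}) k
        = series_mult V delta_10
            (\<lambda>(k0, k1, k2). if k1 = 0 then vop V (vop V u k0 v) k2 w else \<zero>\<^bsub>V\<^esub>) k)"

definition weak_quantum_vertex_algebra :: "('v, 'm) vertex_structure_scheme \<Rightarrow> bool" where
  "weak_quantum_vertex_algebra V \<longleftrightarrow>
     complex_space V \<and>
     vac V \<in> carrier V \<and>
     operator_map V V (vop V) \<and>
     (\<forall>u\<in>carrier V. \<forall>v\<in>carrier V. (\<lambda>n. vop V u n v) \<in> laurent V) \<and>
     (\<forall>v\<in>carrier V. \<forall>n. vop V (vac V) n v = (if n = 0 then v else \<zero>\<^bsub>V\<^esub>)) \<and>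
     (\<forall>u\<in>carrier V. (\<forall>n<0. vop V u n (vac V) = \<zero>\<^bsub>V\<^esub>) \<and> vop V u 0 (vac V) = u) \<and>
     (\<forall>u\<in>carrier V. \<forall>v\<in>carrier V. \<exists>r us vs fs.
        us ` {1..r} \<subseteq> carrier V \<and> vs ` {1..r} \<subseteq> carrier V \<and>
        jacobi_identity V u v r us vs fs)"

section \<open>Coordinated modules\<close>

record ('v, 'w) coordinated_structure = "(complex, 'w) module" +
  mop :: "'v \<Rightarrow> int \<Rightarrow> 'w \<Rightarrow> 'w"

text \<open>
  The coefficient at \<open>x\<^sup>n z\<^sup>m\<close>, for exponents \<open>(n, m)\<close> ranging over all pairs of integers.
\<close>

definition coeff2 :: "complex fls fps \<Rightarrow> int \<times> int \<Rightarrow> complex" where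
  "coeff2 P = (\<lambda>(n, m). if m < 0 then 0 else P $ nat m $$ n)"

text \<open>
  \<open>A(\<phi>(x\<^sub>2, z), x\<^sub>2) = \<Sum>\<^bsub>i,j\<^esub> a\<^bsub>i,j\<^esub> \<phi>(x\<^sub>2, z)\<^sup>i x\<^sub>2\<^sup>j\<close> for \<open>A(x\<^sub>1, x\<^sub>2) = \<Sum>\<^bsub>i,j\<^esub> a\<^bsub>i,j\<^esub> x\<^sub>1\<^sup>i x\<^sub>2\<^sup>j\<close> in
  \<open>W((x\<^sub>1, x\<^sub>2))\<close>, as coefficients at \<open>x\<^sub>2\<^sup>n z\<^sup>m\<close>.
\<close>

definition subst_first ::
    "(complex, 'w, 'm) module_scheme \<Rightarrow> complex fls fps \<Rightarrow> (int \<times> int \<Rightarrow> 'w) \<Rightarrow> int \<times> int \<Rightarrow> 'w" where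
  "subst_first W \<phi> a =
     (\<lambda>(n, m). support_sum W (\<lambda>(i, j). coeff2 (\<phi> powi i) (n - j, m) \<odot>\<^bsub>W\<^esub> a (i, j)))"

text \<open>\<open>(x\<^sub>1 - x\<^sub>2)\<^sup>k Y\<^sub>W(u, x\<^sub>1) Y\<^sub>W(v, x\<^sub>2) w\<close>\<close>

definition cleared_product ::
    "('v, 'w, 'm) coordinated_structure_scheme \<Rightarrow> nat \<Rightarrow> 'v \<Rightarrow> 'v \<Rightarrow> 'w \<Rightarrow> int \<times> int \<Rightarrow> 'w" where
  "cleared_product W k u v w =
     series_mult W (\<lambda>(i, j). diff_pow (int k) i j) (\<lambda>(i, j). mop W u i (mop W v j w))"

definition coordinated_module ::
    "('v, 'm) vertex_structure_scheme \<Rightarrow> complex fls fps \<Rightarrow>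
     ('v, 'w, 'n) coordinated_structure_scheme \<Rightarrow> bool" where
  "coordinated_module V \<phi> W \<longleftrightarrow>
     complex_space W \<and>
     operator_map V W (mop W) \<and>
     (\<forall>v\<in>carrier V. \<forall>w\<in>carrier W. (\<lambda>n. mop W v n w) \<in> laurent W) \<and>
     (\<forall>w\<in>carrier W. \<forall>n. mop W (vac V) n w = (if n = 0 then w else \<zero>\<^bsub>W\<^esub>)) \<and>
     (\<forall>u\<in>carrier V. \<forall>v\<in>carrier V. \<exists>k.
        (\<forall>w\<in>carrier W. cleared_product W k u v w \<in> laurent2 W) \<and>
        (\<forall>w\<in>carrier W. subst_first W \<phi> (cleared_product W k u v w) =
           series_mult W (coeff2 ((\<phi> - fps_const fls_X) ^ k))
             (\<lambda>(n, m). mop W (vop V u m v) n w)))"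

definition module_homs ::
    "('v, 'm) vertex_structure_scheme \<Rightarrow> ('v, 'w, 'n) coordinated_structure_scheme \<Rightarrow>
     ('v, 'w, 'n) coordinated_structure_scheme \<Rightarrow> ('w \<Rightarrow> 'w) set" where
  "module_homs V W1 W2 = {\<theta> \<in> linear_maps W1 W2.
     \<forall>v\<in>carrier V. \<forall>n. \<forall>w\<in>carrier W1. \<theta> (mop W1 v n w) = mop W2 v n (\<theta> w)}"

text \<open>\<open>Y\<^sub>W\<^sup>f(v, x) = Y\<^sub>W(v, f(x))\<close>\<close>

definition twisted_module ::
    "('v, 'm) vertex_structure_scheme \<Rightarrow> complex fps \<Rightarrow>
     ('v, 'w) coordinated_structure \<Rightarrow> ('v, 'w) coordinated_structure" where
  "twisted_module V f W = W\<lparr>mop := (\<lambda>v\<in>carrier V. \<lambda>n. \<lambda>w\<in>carrier W.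
     support_sum W (\<lambda>i. ((fps_to_fls f powi i) $$ n) \<odot>\<^bsub>W\<^esub> mop W v i w))\<rparr>"

section \<open>Categories\<close>

text \<open>
  \<open>Hom C A B\<close> are the morphisms from \<open>A\<close> to \<open>B\<close>, and \<open>Comp C A B D g h\<close> is the composite of
  \<open>h\<close> from \<open>A\<close> to \<open>B\<close> with \<open>g\<close> from \<open>B\<close> to \<open>D\<close>.
\<close>

record ('o, 'm) category_structure =
  Obj :: "'o set"
  Hom :: "'o \<Rightarrow> 'o \<Rightarrow> 'm set"
  Ident :: "'o \<Rightarrow> 'm"
  Comp :: "'o \<Rightarrow> 'o \<Rightarrow> 'o \<Rightarrow> 'm \<Rightarrow> 'm \<Rightarrow> 'm"

definition category :: "('o, 'm) category_structure \<Rightarrow> bool" where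
  "category C \<longleftrightarrow>
     (\<forall>A\<in>Obj C. Ident C A \<in> Hom C A A) \<and>
     (\<forall>A\<in>Obj C. \<forall>B\<in>Obj C. \<forall>D\<in>Obj C. \<forall>h\<in>Hom C A B. \<forall>g\<in>Hom C B D.
        Comp C A B D g h \<in> Hom C A D) \<and>
     (\<forall>A\<in>Obj C. \<forall>B\<in>Obj C. \<forall>h\<in>Hom C A B.
        Comp C A A B h (Ident C A) = h \<and> Comp C A B B (Ident C B) h = h) \<and>
     (\<forall>A\<in>Obj C. \<forall>B\<in>Obj C. \<forall>D\<in>Obj C. \<forall>E\<in>Obj C.
        \<forall>h\<in>Hom C A B. \<forall>g\<in>Hom C B D. \<forall>k\<in>Hom C D E.
          Comp C A D E k (Comp C A B D g h) = Comp C A B E (Comp C B D E k g) h)"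

definition is_functor ::
    "('o, 'm) category_structure \<Rightarrow> ('p, 'n) category_structure \<Rightarrow>
     ('o \<Rightarrow> 'p) \<Rightarrow> ('o \<Rightarrow> 'o \<Rightarrow> 'm \<Rightarrow> 'n) \<Rightarrow> bool" where
  "is_functor C D F FH \<longleftrightarrow>
     category C \<and> category D \<and>
     (\<forall>A\<in>Obj C. F A \<in> Obj D) \<and>
     (\<forall>A\<in>Obj C. \<forall>B\<in>Obj C. \<forall>h\<in>Hom C A B. FH A B h \<in> Hom D (F A) (F B)) \<and>
     (\<forall>A\<in>Obj C. FH A A (Ident C A) = Ident D (F A)) \<and>
     (\<forall>A\<in>Obj C. \<forall>B\<in>Obj C. \<forall>E\<in>Obj C. \<forall>h\<in>Hom C A B. \<forall>g\<in>Hom C B E.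
        FH A E (Comp C A B E g h) = Comp D (F A) (F B) (F E) (FH B E g) (FH A B h))"

definition category_isomorphism ::
    "('o, 'm) category_structure \<Rightarrow> ('p, 'n) category_structure \<Rightarrow>
     ('o \<Rightarrow> 'p) \<Rightarrow> ('o \<Rightarrow> 'o \<Rightarrow> 'm \<Rightarrow> 'n) \<Rightarrow> bool" where
  "category_isomorphism C D F FH \<longleftrightarrow>
     is_functor C D F FH \<and>
     (\<exists>G GH. is_functor D C G GH \<and>
        (\<forall>A\<in>Obj C. G (F A) = A) \<and>
        (\<forall>A\<in>Obj D. F (G A) = A) \<and>
        (\<forall>A\<in>Obj C. \<forall>B\<in>Obj C. \<forall>h\<in>Hom C A B. GH (F A) (F B) (FH A B h) = h) \<and>
        (\<forall>A\<in>Obj D. \<forall>B\<in>Obj D. \<forall>h\<in>Hom D A B. FH (G A) (G B) (GH A B h) = h))"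

text \<open>
  The objects are the coordinated modules whose underlying set is a subset of the type \<open>'w\<close>,
  with any vector space structure on it.
\<close>

definition coordinated_modules ::
    "('v, 'm) vertex_structure_scheme \<Rightarrow> complex fls fps \<Rightarrow>
     (('v, 'w) coordinated_structure, 'w \<Rightarrow> 'w) category_structure" where
  "coordinated_modules V \<phi> =
     \<lparr>Obj = {W. coordinated_module V \<phi> W},
      Hom = module_homs V,
      Ident = (\<lambda>W. \<lambda>w\<in>carrier W. w),
      Comp = (\<lambda>W1 W2 W3 g h. compose (carrier W1) g h)\<rparr>"

end

theory Submission
  imports Defs
begin

text \<open>
  Let \<open>g\<close> be the compositional inverse of \<open>f\<close> and write \<open>g(x\<^sub>1) - g(x\<^sub>2) = (x\<^sub>1 - x\<^sub>2) H(x\<^sub>1, x\<^sub>2)\<close> with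
  \<open>H \<in> \<complex>[[x\<^sub>1, x\<^sub>2]]\<close>. If \<open>A(x\<^sub>1, x\<^sub>2) = (x\<^sub>1 - x\<^sub>2)\<^sup>k Y\<^sub>W(u, x\<^sub>1) Y\<^sub>W(v, x\<^sub>2) w\<close> lies in \<open>W((x\<^sub>1, x\<^sub>2))\<close>, then
  \<open>(x\<^sub>1 - x\<^sub>2)\<^sup>k Y\<^sub>W(u, f(x\<^sub>1)) Y\<^sub>W(v, f(x\<^sub>2)) w\<close> is \<open>H\<^sup>k A\<close> evaluated at \<open>(f(x\<^sub>1), f(x\<^sub>2))\<close>, so the same
  \<open>k\<close> works. Since \<open>f(\<phi>\<^sub>f(x, z)) = \<phi>(f(x), z)\<close>, substituting \<open>x\<^sub>1 = \<phi>\<^sub>f(x\<^sub>2, z)\<close> amounts to substituting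
  \<open>\<phi>(y, z)\<close> for the first variable of \<open>H\<^sup>k A\<close> and then \<open>y = f(x\<^sub>2)\<close>, and \<open>H(\<phi>(y, z), y)\<^sup>k\<close> turns the factor
  \<open>(\<phi>(y, z) - y)\<^sup>k\<close> into \<open>(g(\<phi>(y, z)) - g(y))\<^sup>k\<close>, which becomes \<open>(\<phi>\<^sub>f(x\<^sub>2, z) - x\<^sub>2)\<^sup>k\<close> at \<open>y = f(x\<^sub>2)\<close>.
  The inverse functor is the twist by \<open>g\<close>, because \<open>(\<phi>\<^sub>f)\<^sub>g = \<phi>\<close>.

  Linear functionals separate the points of a vector space, so these identities are checked after
  applying a functional, that is, for series with complex coefficients.
\<close>

text \<open>Before clearing, Y_W(u, x1) Y_W(v, x2) w lies only in W((x1))((x2)): the lower bound on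
  the powers of x1 may depend on the power of x2. Replacing x1, x2 by f(x1), f(x2) makes sense
  there, since f^i has order exactly i, whereas replacing x1 by \<phi>(x2, z) is meant for W((x1,
  x2)). So \<open>twist2\<close> has to be multiplicative on all iterated Laurent series,
  \<open>subst2\<close> only on series with a common bound, and (x1 - x2)^k must be carried through
  the twist before anything is substituted. Multiplying by H^k before the twist does this without
  any division, because the twist turns g(x1) - g(x2) into x1 - x2. The other obstacle is
  convergence: the coefficients of \<phi>(x, z) at powers of z may have poles in x of growing order.
  The main laws of substitution are rearrangements of infinite sums, each proved by exhibiting one
  double family, finite modulo every neighbourhood of zero, whose iterated sums are the two
  sides.\<close>

section \<open>Summable families in \<open>\<complex>((x))[[z]]\<close>\<close>

text \<open>Any lower bounds of the two supports may replace the subdegrees, so one interval can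
  serve a whole family of products, zero factors included.\<close>

lemma fls_times_nth_interval:
  fixes F G :: "'a::comm_ring_1 fls"
  assumes F: "\<And>i. i < a \<Longrightarrow> F $$ i = 0" and G: "\<And>i. i < b \<Longrightarrow> G $$ i = 0" and c: "n - b \<le> c"
  shows "(F * G) $$ n = (\<Sum>i=a..c. F $$ i * G $$ (n - i))"
proof (cases "F = 0 \<or> G = 0")
  case False
  then have "a \<le> fls_subdegree F" "b \<le> fls_subdegree G"
    using F G by (auto intro: fls_subdegree_geI)
  then have sub: "{fls_subdegree F..n - fls_subdegree G} \<subseteq> {a..c}"
    using c by auto
  have "F $$ i * G $$ (n - i) = 0" if "i \<in> {a..c} - {fls_subdegree F..n - fls_subdegree G}" for i
    using that by (cases "i < fls_subdegree F") auto
  then show ?thesis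
    unfolding fls_times_nth(2) by (intro sum.mono_neutral_left sub) auto
qed auto

lemma fls_times_nth_below:
  fixes F G :: "'a::comm_ring_1 fls"
  assumes "\<And>i. i < a \<Longrightarrow> F $$ i = 0" and "\<And>i. i < b \<Longrightarrow> G $$ i = 0" and "n < a + b"
  shows "(F * G) $$ n = 0"
  using fls_times_nth_interval[of a F b G n "n - b"] assms by simp

lemma fls_sum_nth: "(\<Sum>i\<in>I. F i) $$ n = (\<Sum>i\<in>I. F i $$ n)"
  by (induction I rule: infinite_finite_induct) auto

text \<open>
  The sets \<open>small m n\<close> are a basis of neighbourhoods of zero for the topology in which
  \<open>F fsums Q\<close> expresses the unconditional convergence of \<open>\<Sum>\<^sub>i F\<^sub>i\<close> to \<open>Q\<close>. The bound \<open>n\<close> on the exponent of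
  \<open>x\<close> may depend on the exponent of \<open>z\<close>; neither the \<open>x\<close>-adic nor the \<open>z\<close>-adic topology would do.
\<close>

definition small :: "nat \<Rightarrow> int \<Rightarrow> complex fls fps set" where
  "small m n = {Q. \<forall>i\<le>m. \<forall>j<n. Q $ i $$ j = 0}"

lemma smallD: "Q \<in> small m n \<Longrightarrow> i \<le> m \<Longrightarrow> j < n \<Longrightarrow> Q $ i $$ j = 0"
  by (auto simp: small_def)

lemma small_zero [simp]: "0 \<in> small m n"
  by (simp add: small_def)

lemma small_add: "P \<in> small m n \<Longrightarrow> Q \<in> small m n \<Longrightarrow> P + Q \<in> small m n"
  by (auto simp: small_def)

lemma small_diff: "P \<in> small m n \<Longrightarrow> Q \<in> small m n \<Longrightarrow> P - Q \<in> small m n"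
  by (auto simp: small_def)

lemma small_sum: "(\<And>i. i \<in> I \<Longrightarrow> F i \<in> small m n) \<Longrightarrow> sum F I \<in> small m n"
  by (induction I rule: infinite_finite_induct) (auto intro: small_add)

lemma small_mono: "Q \<in> small m n \<Longrightarrow> m' \<le> m \<Longrightarrow> n' \<le> n \<Longrightarrow> Q \<in> small m' n'"
  by (auto simp: small_def)

text \<open>The coefficient of z^i in a product involves only exponents of z up to i, so the same
  \<open>m\<close> serves both factors while the orders in x add.\<close>

lemma small_mult:
  assumes "P \<in> small m a" "Q \<in> small m b"
  shows "P * Q \<in> small m (a + b)"
proof -
  have "(P * Q) $ i $$ j = 0" if "i \<le> m" "j < a + b" for i j
    using that assms
    by (auto simp: fps_mult_nth fls_sum_nth small_def intro!: sum.neutral fls_times_nth_below[of a _ b])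
  then show ?thesis by (simp add: small_def)
qed

text \<open>Up to z^m only finitely many coefficients are concerned, so they have a least order in
  x; in general no \<open>n\<close> serves all \<open>m\<close>.\<close>

lemma small_ex: "\<exists>n. Q \<in> small m n"
proof -
  define n where "n = (MIN i\<in>{..m}. fls_subdegree (Q $ i))"
  have "n \<le> fls_subdegree (Q $ i)" if "i \<le> m" for i
    unfolding n_def using that by (intro Min_le) auto
  then have "Q \<in> small m n"
    by (force simp: small_def)
  then show ?thesis ..
qed

lemma small_eq_zero:
  assumes "\<And>m n. Q \<in> small m n"
  shows "Q = 0"
proof (intro fps_ext fls_eqI)
  show "Q $ m $$ n = 0 $ m $$ n" for m n
    using smallD[OF assms, of m m n "n + 1"] by simp
qed

definition const2 :: "complex \<Rightarrow> complex fls fps" where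
  "const2 c = fps_const (fls_const c)"

lemma const2_0 [simp]: "const2 0 = 0" and const2_1 [simp]: "const2 1 = 1"
  and const2_mult: "const2 (c * d) = const2 c * const2 d"
  and const2_add: "const2 (c + d) = const2 c + const2 d"
  by (simp_all add: const2_def fls_const_mult_const fls_plus_const)

lemma const2_nth [simp]: "(const2 c * Q) $ m $$ n = c * Q $ m $$ n"
  by (simp add: const2_def)

lemma const2_sum: "const2 (sum g I) = (\<Sum>i\<in>I. const2 (g i))"
  by (induction I rule: infinite_finite_induct) (simp_all add: const2_add)

lemma small_const2: "Q \<in> small m n \<Longrightarrow> const2 c * Q \<in> small m n"
  by (auto simp: small_def)

text \<open>A relation between a family and its sum: two series agree as soon as one family sums to
  both (\<open>fsums_unique\<close>), which is how the substitution laws are proved.\<close>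

definition fsums :: "('i \<Rightarrow> complex fls fps) \<Rightarrow> complex fls fps \<Rightarrow> bool" (infix \<open>fsums\<close> 50) where
  "F fsums Q \<longleftrightarrow> (\<forall>m n. finite {i. F i \<notin> small m n} \<and> Q - (\<Sum>i | F i \<notin> small m n. F i) \<in> small m n)"

definition null_family :: "('i \<Rightarrow> complex fls fps) \<Rightarrow> bool" where
  "null_family F \<longleftrightarrow> (\<forall>m n. finite {i. F i \<notin> small m n})"

lemma fsums_null: "F fsums Q \<Longrightarrow> null_family F"
  by (simp add: fsums_def null_family_def)

lemma null_familyD: "null_family F \<Longrightarrow> finite {i. F i \<notin> small m n}"
  by (simp add: null_family_def)

lemma fsums_sum_diff_small:
  assumes "F fsums Q" "finite I" "\<And>i. i \<notin> I \<Longrightarrow> F i \<in> small m n"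
  shows "Q - sum F I \<in> small m n"
proof -
  let ?J = "{i. F i \<notin> small m n}"
  have J: "finite ?J" "Q - sum F ?J \<in> small m n"
    using assms(1) by (auto simp: fsums_def)
  have sub: "?J \<subseteq> I" using assms(3) by auto
  have "Q - sum F I = (Q - sum F ?J) - sum F (I - ?J)"
    using sum.subset_diff[OF sub assms(2), of F] by simp
  moreover have "sum F (I - ?J) \<in> small m n"
    by (intro small_sum) auto
  ultimately show ?thesis using J(2) by (metis small_diff)
qed

lemma fsumsI:
  assumes "\<And>m n. \<exists>I. finite I \<and> (\<forall>i. i \<notin> I \<longrightarrow> F i \<in> small m n) \<and> Q - sum F I \<in> small m n"
  shows "F fsums Q"
  unfolding fsums_def
proof (intro allI conjI)
  fix m n
  let ?J = "{i. F i \<notin> small m n}"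
  obtain I where I: "finite I" "\<forall>i. i \<notin> I \<longrightarrow> F i \<in> small m n" "Q - sum F I \<in> small m n"
    using assms by blast
  have sub: "?J \<subseteq> I" using I(2) by auto
  show "finite ?J" using I(1) sub finite_subset by blast
  have "Q - sum F ?J = (Q - sum F I) + sum F (I - ?J)"
    using sum.subset_diff[OF sub I(1), of F] by simp
  moreover have "sum F (I - ?J) \<in> small m n"
    by (intro small_sum) auto
  ultimately show "Q - sum F ?J \<in> small m n" using I(3) by (metis small_add)
qed

lemma fsums_unique:
  assumes "F fsums P" "F fsums Q"
  shows "P = Q"
proof -
  have "P - Q \<in> small m n" for m n
  proof -
    let ?S = "\<Sum>i | F i \<notin> small m n. F i"
    have "P - ?S \<in> small m n" "Q - ?S \<in> small m n"
      using assms by (auto simp: fsums_def)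
    then have "(P - ?S) - (Q - ?S) \<in> small m n" by (rule small_diff)
    then show ?thesis by simp
  qed
  then show ?thesis using small_eq_zero[of "P - Q"] by simp
qed

lemma fsums_finite:
  assumes "finite I" "\<And>i. i \<notin> I \<Longrightarrow> F i = 0"
  shows "F fsums sum F I"
  by (rule fsumsI, rule exI[of _ I]) (use assms in auto)

lemma fsums_single: "(\<And>i. i \<noteq> j \<Longrightarrow> F i = 0) \<Longrightarrow> F fsums F j"
  using fsums_finite[of "{j}" F] by simp

lemma fsums_add:
  assumes "F fsums P" "G fsums Q"
  shows "(\<lambda>i. F i + G i) fsums (P + Q)"
proof (rule fsumsI)
  fix m n
  let ?I = "{i. F i \<notin> small m n} \<union> {i. G i \<notin> small m n}"
  have fin: "finite ?I" using assms by (auto simp: fsums_def)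
  have "P - sum F ?I \<in> small m n" "Q - sum G ?I \<in> small m n"
    using assms fin by (auto intro!: fsums_sum_diff_small)
  from small_add[OF this] have "P + Q - (\<Sum>i\<in>?I. F i + G i) \<in> small m n"
    by (simp add: sum.distrib algebra_simps)
  then show "\<exists>I. finite I \<and> (\<forall>i. i \<notin> I \<longrightarrow> F i + G i \<in> small m n) \<and> P + Q - (\<Sum>i\<in>I. F i + G i) \<in> small m n"
    using fin by (intro exI[of _ ?I]) (auto intro: small_add)
qed

text \<open>Preserving every \<open>small m n\<close> is a form of continuity, so the additive map
  \<open>T\<close> commutes with infinite sums.\<close>

lemma fsums_additive_image:
  assumes F: "F fsums Q"
    and T: "\<And>P Q. T (P + Q) = T P + T Q" "\<And>m n Q. Q \<in> small m n \<Longrightarrow> T Q \<in> small m n"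
  shows "(\<lambda>i. T (F i)) fsums T Q"
proof (rule fsumsI)
  fix m n
  let ?I = "{i. F i \<notin> small m n}"
  have T0: "T 0 = 0" using T(1)[of 0 0] by simp
  have Tsum: "T (sum F I) = (\<Sum>i\<in>I. T (F i))" for I
    by (induction I rule: infinite_finite_induct) (simp_all add: T0 T(1))
  have Tdiff: "T (P - Q) = T P - T Q" for P Q
    using T(1)[of "P - Q" Q] by simp
  have "T (Q - sum F ?I) \<in> small m n"
    using F by (intro T) (auto simp: fsums_def)
  then show "\<exists>I. finite I \<and> (\<forall>i. i \<notin> I \<longrightarrow> T (F i) \<in> small m n) \<and> T Q - (\<Sum>i\<in>I. T (F i)) \<in> small m n"
    using F by (intro exI[of _ ?I]) (auto simp: fsums_def Tdiff Tsum intro: T)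
qed

lemma null_family_bound:
  assumes "null_family F"
  shows "\<exists>b. \<forall>i. F i \<in> small m b"
proof -
  let ?I = "{i. F i \<notin> small m 0}"
  have fin: "finite ?I" using assms by (rule null_familyD)
  obtain g where g: "F i \<in> small m (g i)" for i
    using choice[of "\<lambda>i n. F i \<in> small m n"] small_ex by blast
  define b where "b = Min (insert 0 (g ` ?I))"
  have "F i \<in> small m b" for i
  proof (cases "i \<in> ?I")
    case True
    then have "b \<le> g i" unfolding b_def using fin by (intro Min_le) auto
    then show ?thesis using g small_mono by blast
  next
    case False
    have "b \<le> 0" unfolding b_def using fin by (intro Min_le) auto
    then show ?thesis using False small_mono by blast
  qed
  then show ?thesis by blast
qed

text \<open>With partial sums S and T, P Q - S T = (P - S) Q + S (Q - T); each term is small once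
  its other factor is bounded from below.\<close>

lemma fsums_mult:
  assumes F: "F fsums P" and G: "G fsums Q"
  shows "(\<lambda>(i, j). F i * G j) fsums (P * Q)"
proof (rule fsumsI)
  fix m n
  obtain a where a: "\<And>i. F i \<in> small m a" using null_family_bound[OF fsums_null[OF F]] by blast
  obtain b where b: "\<And>j. G j \<in> small m b" using null_family_bound[OF fsums_null[OF G]] by blast
  obtain a' where a': "P \<in> small m a'" using small_ex by blast
  obtain b' where b': "Q \<in> small m b'" using small_ex by blast
  \<comment> \<open>\<open>b\<close> bounds every \<open>G j\<close> and \<open>b'\<close> bounds
    the limit \<open>Q\<close>; \<open>p\<close> has to absorb both. All partial sums of
    \<open>F\<close> are bounded by \<open>a\<close>, which \<open>q\<close> absorbs.\<close>
  define p where "p = max (n - b) (n - b')"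
  define q where "q = n - a"
  let ?I = "{i. F i \<notin> small m p}" and ?J = "{j. G j \<notin> small m q}"
  have fin: "finite ?I" "finite ?J" using F G by (auto simp: fsums_def)
  have dP: "P - sum F ?I \<in> small m p" and dQ: "Q - sum G ?J \<in> small m q"
    using F G by (auto simp: fsums_def)
  have out: "F i * G j \<in> small m n" if "i \<notin> ?I \<or> j \<notin> ?J" for i j
    using that
  proof
    assume "i \<notin> ?I"
    then have "F i * G j \<in> small m (p + b)" using b by (auto intro: small_mult)
    then show ?thesis by (rule small_mono) (auto simp: p_def)
  next
    assume "j \<notin> ?J"
    then have "F i * G j \<in> small m (a + q)" using a by (auto intro: small_mult)
    then show ?thesis by (rule small_mono) (auto simp: q_def)
  qed
  have "(\<Sum>(i, j)\<in>?I \<times> ?J. F i * G j) = sum F ?I * sum G ?J"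
    by (simp only: sum.cartesian_product sum_product)
  then have "P * Q - (\<Sum>(i, j)\<in>?I \<times> ?J. F i * G j) = (P - sum F ?I) * Q + sum F ?I * (Q - sum G ?J)"
    by (simp only:) (simp only: left_diff_distrib right_diff_distrib, simp)
  moreover have "(P - sum F ?I) * Q \<in> small m n"
    using small_mult[OF dP b'] by (rule small_mono) (auto simp: p_def)
  moreover have "sum F ?I * (Q - sum G ?J) \<in> small m n"
    using small_mult[OF small_sum dQ, of ?I F a] a by (auto simp: q_def)
  ultimately have "P * Q - (\<Sum>(i, j)\<in>?I \<times> ?J. F i * G j) \<in> small m n"
    by (metis small_add)
  then show "\<exists>I. finite I \<and> (\<forall>i. i \<notin> I \<longrightarrow> (case i of (i, j) \<Rightarrow> F i * G j) \<in> small m n) \<and>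
      P * Q - (\<Sum>i\<in>I. case i of (i, j) \<Rightarrow> F i * G j) \<in> small m n"
    using fin out by (intro exI[of _ "?I \<times> ?J"]) auto
qed

text \<open>Fubini. From left to right it obtains the double sum from the row sums; from right to
  left, mostly after a swap of the indices, it regroups a known double sum. That the double family
  is null does not follow from convergence of the rows: infinitely many rows may contain large terms
  that cancel.\<close>

lemma fsums_Sigma:
  assumes null: "null_family F" and F: "\<And>i. (\<lambda>j. F (i, j)) fsums G i"
  shows "G fsums Q \<longleftrightarrow> F fsums Q"
proof -
  have main: "\<exists>I J. finite I \<and> finite J \<and> (\<forall>i. i \<notin> I \<longrightarrow> G i \<in> small m n) \<and>
      (\<forall>p. p \<notin> I \<times> J \<longrightarrow> F p \<in> small m n) \<and> sum G I - sum F (I \<times> J) \<in> small m n" for m n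
  proof -
    let ?K = "{p. F p \<notin> small m n}"
    \<comment> \<open>Everything outside the rectangle spanned by the finitely many large terms is
      small.\<close>
    define I J where "I = fst ` ?K" and "J = snd ` ?K"
    have fin: "finite I" "finite J" unfolding I_def J_def using null_familyD[OF null] by auto
    have out: "F p \<in> small m n" if "p \<notin> I \<times> J" for p
      using that image_eqI[of "fst p" fst p ?K] image_eqI[of "snd p" snd p ?K]
      unfolding I_def J_def mem_Times_iff by blast
    have G: "G i - (\<Sum>j\<in>J. F (i, j)) \<in> small m n" for i
      by (rule fsums_sum_diff_small[OF F fin(2)]) (use out in blast)
    have "G i \<in> small m n" if "i \<notin> I" for i
    proof -
      have "(\<Sum>j\<in>J. F (i, j)) \<in> small m n" by (rule small_sum) (use out that in blast)
      from small_add[OF G[of i] this] show ?thesis by simp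
    qed
    moreover have "sum G I - sum F (I \<times> J) = (\<Sum>i\<in>I. G i - (\<Sum>j\<in>J. F (i, j)))"
      by (simp only: sum_subtractf sum.cartesian_product split_def prod.collapse)
    then have "sum G I - sum F (I \<times> J) \<in> small m n"
      using G by (simp only:) (rule small_sum)
    ultimately show ?thesis using fin out by (intro exI[of _ I] exI[of _ J]) blast
  qed
  show ?thesis
  proof
    assume GQ: "G fsums Q"
    show "F fsums Q"
    proof (rule fsumsI)
      fix m n
      obtain I J where *: "finite I" "finite J" "\<forall>i. i \<notin> I \<longrightarrow> G i \<in> small m n"
        "\<forall>p. p \<notin> I \<times> J \<longrightarrow> F p \<in> small m n" "sum G I - sum F (I \<times> J) \<in> small m n"
        using main[of m n] by (elim exE conjE) (rule that)
      have "Q - sum G I \<in> small m n" by (rule fsums_sum_diff_small[OF GQ *(1)]) (use *(3) in blast)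
      from small_add[OF this *(5)] have "Q - sum F (I \<times> J) \<in> small m n" by simp
      then show "\<exists>I. finite I \<and> (\<forall>i. i \<notin> I \<longrightarrow> F i \<in> small m n) \<and> Q - sum F I \<in> small m n"
        using * by (intro exI[of _ "I \<times> J"]) auto
    qed
  next
    assume FQ: "F fsums Q"
    show "G fsums Q"
    proof (rule fsumsI)
      fix m n
      obtain I J where *: "finite I" "finite J" "\<forall>i. i \<notin> I \<longrightarrow> G i \<in> small m n"
        "\<forall>p. p \<notin> I \<times> J \<longrightarrow> F p \<in> small m n" "sum G I - sum F (I \<times> J) \<in> small m n"
        using main[of m n] by (elim exE conjE) (rule that)
      have "Q - sum F (I \<times> J) \<in> small m n"
        by (rule fsums_sum_diff_small[OF FQ finite_cartesian_product[OF *(1,2)]]) (use *(4) in blast)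
      from small_diff[OF this *(5)] have "Q - sum G I \<in> small m n" by simp
      then show "\<exists>I. finite I \<and> (\<forall>i. i \<notin> I \<longrightarrow> G i \<in> small m n) \<and> Q - sum G I \<in> small m n"
        using * by (intro exI[of _ I]) auto
    qed
  qed
qed

lemma fsums_comp_bij:
  assumes "F fsums Q" "bij h"
  shows "(\<lambda>i. F (h i)) fsums Q"
proof (rule fsumsI)
  fix m n
  let ?I = "{i. F i \<notin> small m n}"
  have I: "finite ?I" "Q - sum F ?I \<in> small m n" using assms by (auto simp: fsums_def)
  have "finite (h -` ?I)" using I(1) assms(2) by (intro finite_vimageI) (auto simp: bij_def)
  moreover have "(\<Sum>i\<in>h -` ?I. F (h i)) = sum F ?I"
    using assms(2) by (intro sum.reindex_cong[symmetric, of h]) (auto simp: bij_def inj_on_def surj_def)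
  ultimately show "\<exists>I. finite I \<and> (\<forall>i. i \<notin> I \<longrightarrow> F (h i) \<in> small m n) \<and> Q - (\<Sum>i\<in>I. F (h i)) \<in> small m n"
    using I(2) by (intro exI[of _ "h -` ?I"]) auto
qed

lemma fsums_reindex:
  assumes h: "bij h"
  shows "(\<lambda>i. F (h i)) fsums Q \<longleftrightarrow> F fsums Q"
proof
  assume "(\<lambda>i. F (h i)) fsums Q"
  from fsums_comp_bij[OF this bij_imp_bij_inv[OF h]] show "F fsums Q"
    using h by (simp add: bij_is_surj surj_f_inv_f)
qed (rule fsums_comp_bij[OF _ h])

lemma fsums_nth:
  assumes "F fsums Q"
  shows "Q $ m $$ n = Sum_any (\<lambda>i. F i $ m $$ n)"
proof -
  \<comment> \<open>\<open>small m n\<close> constrains exponents strictly below \<open>n\<close>,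
    so reading the coefficient at \<open>n\<close> takes the bound \<open>n + 1\<close>.\<close>
  let ?I = "{i. F i \<notin> small m (n + 1)}"
  have I: "finite ?I" "Q - sum F ?I \<in> small m (n + 1)"
    using assms by (auto simp: fsums_def)
  have "Q $ m $$ n = (sum F ?I) $ m $$ n"
    using smallD[OF I(2), of m n] by simp
  also have "\<dots> = (\<Sum>i\<in>?I. F i $ m $$ n)"
    by (simp add: fps_sum_nth fls_sum_nth)
  also have "\<dots> = Sum_any (\<lambda>i. F i $ m $$ n)"
    using I(1) by (intro Sum_any.expand_superset[symmetric]) (auto simp: small_def)
  finally show ?thesis .
qed

text \<open>Completeness of C((x))[[z]]. The limit has the very shape of the bodies of
  \<open>fls_subst\<close> and \<open>subst2\<close>, so that both become convergent sums.\<close>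

lemma null_family_fsums:
  assumes "null_family F"
  shows "F fsums Abs_fps (\<lambda>m. Abs_fls (\<lambda>n. Sum_any (\<lambda>i. F i $ m $$ n)))" (is "F fsums ?Q")
proof (rule fsumsI)
  fix m n
  let ?I = "{i. F i \<notin> small m n}"
  have fin: "finite ?I" using assms by (rule null_familyD)
  have nth: "?Q $ i $$ j = Sum_any (\<lambda>k. F k $ i $$ j)" for i j
  proof -
    obtain b where "\<And>k. F k \<in> small i b" using null_family_bound[OF assms] by blast
    then have "\<forall>j<b. Sum_any (\<lambda>k. F k $ i $$ j) = 0"
      using smallD[of _ i b i] by simp
    then have "Abs_fls (\<lambda>j. Sum_any (\<lambda>k. F k $ i $$ j)) $$ j = Sum_any (\<lambda>k. F k $ i $$ j)"
      by (rule nth_Abs_fls_lower_bound)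
    then show ?thesis by simp
  qed
  have "(?Q - sum F ?I) $ i $$ j = 0" if "i \<le> m" "j < n" for i j
  proof -
    have "{k. F k $ i $$ j \<noteq> 0} \<subseteq> ?I" using that by (auto simp: small_def)
    then have "Sum_any (\<lambda>k. F k $ i $$ j) = (\<Sum>k\<in>?I. F k $ i $$ j)"
      using fin by (intro Sum_any.expand_superset)
    then show ?thesis
      by (simp only: fps_sub_nth fls_minus_nth nth fps_sum_nth fls_sum_nth diff_self)
  qed
  then have "?Q - sum F ?I \<in> small m n" by (simp add: small_def)
  then show "\<exists>I. finite I \<and> (\<forall>i. i \<notin> I \<longrightarrow> F i \<in> small m n) \<and> ?Q - sum F I \<in> small m n"
    using fin by (intro exI[of _ ?I]) auto
qed

section \<open>Substitution\<close>

lemma fps_to_fls_power_int: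
  fixes P :: "'a::field fps"
  assumes "P $ 0 \<noteq> 0"
  shows "fps_to_fls (P powi i) = fps_to_fls P powi i"
  using assms by (simp add: power_int_def fps_to_fls_power fls_inverse_fps_to_fls subdegree_eq_0_iff)

text \<open>Power series do not form a field; a unit is therefore moved into the field of Laurent
  series, where the law of integer exponents holds.\<close>

lemma fps_power_int_add:
  fixes P :: "'a::field fps"
  assumes "P $ 0 \<noteq> 0"
  shows "P powi (i + j) = P powi i * P powi j"
proof -
  have "fps_to_fls P \<noteq> 0" using assms by auto
  then have "fps_to_fls (P powi (i + j)) = fps_to_fls (P powi i * P powi j)"
    using assms by (simp add: fps_to_fls_power_int fls_times_fps_to_fls power_int_add)
  then show ?thesis by (simp only: fps_to_fls_eq_iff)
qed

lemma fps_power_int_nth_0: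
  fixes P :: "'a::field fps"
  shows "(P powi i) $ 0 = (P $ 0) powi i"
  by (simp add: power_int_def fps_power_zeroth)

text \<open>The condition on \<open>P(x, 0)\<close> under which \<^const>\<open>fls_subst\<close> is meaningful.\<close>

definition positive_order :: "complex fls fps \<Rightarrow> bool" where
  "positive_order P \<longleftrightarrow> P $ 0 \<noteq> 0 \<and> (\<forall>n\<le>0. P $ 0 $$ n = 0)"

text \<open>Modulo z^(m+1), at most m factors of a product of copies of P can contribute a positive
  power of z. Each of these lowers the order in x by a bounded amount and every other factor raises
  it by at least one, so the order of P^i grows like i up to a constant.\<close>

lemma positive_order_power_int_small:
  assumes P: "positive_order P"
  shows "\<exists>C. \<forall>i\<ge>N. P powi i \<in> small m (i - C)"
proof -
  obtain n0 where n0: "P \<in> small m n0" using small_ex by blast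
  \<comment> \<open>\<open>c\<close> is the loss of order per power of z: for 1 \<le> j \<le> m the
    coefficient of z^j has order at least n0 \<ge> 1 - c \<ge> 1 - c j.\<close>
  define c where "c = max 0 (1 - n0)"
  have base: "P $ j $$ n = 0" if "j \<le> m" "n < 1 - c * int j" for j n
  proof (cases "j = 0")
    case False
    then have "c * 1 \<le> c * int j" unfolding c_def by (intro mult_left_mono) auto
    then have "n < n0" using that(2) by (auto simp: c_def)
    then show ?thesis using n0 that(1) by (auto intro: smallD)
  qed (use P that in \<open>auto simp: positive_order_def\<close>)
  have pow: "(P ^ k) $ j $$ n = 0" if "j \<le> m" "n < int k - c * int j" for k j n
    using that
  proof (induction k arbitrary: j n)
    case 0
    have "0 \<le> c * int j" by (simp add: c_def)
    with 0 show ?case by (cases "j = 0") auto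
  next
    case (Suc k)
    have "(P $ a * P ^ k $ (j - a)) $$ n = 0" if "a \<le> j" for a
    proof (rule fls_times_nth_below[of "1 - c * int a" _ "int k - c * int (j - a)"])
      show "n < 1 - c * int a + (int k - c * int (j - a))"
        using Suc.prems that by (simp add: of_nat_diff algebra_simps)
    qed (use Suc that base in auto)
    then show ?case by (simp add: fps_mult_nth fls_sum_nth)
  qed
  \<comment> \<open>\<open>N\<close> may be negative; P^i = P^N P^(i - N) reduces to natural powers,
    and \<open>C\<close> collects the order of P^N and the total loss c m.\<close>
  obtain b where b: "P powi N \<in> small m b" using small_ex by blast
  define C where "C = N + c * int m - b"
  have "P powi i \<in> small m (i - C)" if "i \<ge> N" for i
  proof -
    have "P ^ nat (i - N) \<in> small m (i - N - c * int m)"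
      unfolding small_def
    proof (intro CollectI allI impI pow)
      fix a n assume "a \<le> m" "n < i - N - c * int m"
      moreover from this(1) have "c * int a \<le> c * int m" by (intro mult_left_mono) (auto simp: c_def)
      ultimately show "n < int (nat (i - N)) - c * int a" using that by simp
    qed
    from small_mult[OF b this] have "P powi N * P ^ nat (i - N) \<in> small m (i - C)"
      by (simp add: C_def algebra_simps)
    moreover have "P powi i = P powi N * P powi int (nat (i - N))"
      using fps_power_int_add[of P N "i - N"] P that by (simp add: positive_order_def)
    ultimately show ?thesis by (simp only: power_int_of_nat)
  qed
  then show ?thesis by blast
qed

lemma finite_int_interval: "S \<subseteq> {a..b::int} \<Longrightarrow> finite S"
  using finite_subset by blast

lemma fls_nth_zero_below: "\<exists>N. \<forall>n<N. (F::'a::zero fls) $$ n = 0"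
  by (intro exI[of _ "fls_subdegree F"]) simp

lemma fls_subst_fsums:
  assumes P: "positive_order P"
  shows "(\<lambda>i. const2 (G $$ i) * P powi i) fsums fls_subst G P"
proof -
  obtain N where N: "\<forall>n<N. G $$ n = 0" using fls_nth_zero_below by blast
  have "null_family (\<lambda>i. const2 (G $$ i) * P powi i)"
    unfolding null_family_def
  proof (intro allI)
    fix m n
    obtain C where C: "\<forall>i\<ge>N. P powi i \<in> small m (i - C)"
      using positive_order_power_int_small[OF P] by blast
    have "const2 (G $$ i) * P powi i \<in> small m n" if "i \<notin> {N..n + C}" for i
    proof (cases "i < N")
      case False
      then have "P powi i \<in> small m n"
        using C that by (intro small_mono[of _ m "i - C" m n]) auto
      then show ?thesis by (rule small_const2)
    qed (use N in simp)
    then show "finite {i. const2 (G $$ i) * P powi i \<notin> small m n}"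
      by (intro finite_int_interval[of _ N "n + C"]) blast
  qed
  from null_family_fsums[OF this] show ?thesis
    by (simp add: fls_subst_def)
qed

section \<open>Substitution for the first of two variables\<close>

text \<open>
  A series in \<open>\<complex>((x\<^sub>1))((x\<^sub>2))\<close> has type \<^typ>\<open>complex fls fls\<close>, the outer variable being \<open>x\<^sub>2\<close>: the
  coefficient of \<open>x\<^sub>1\<^sup>i x\<^sub>2\<^sup>j\<close> in \<open>A\<close> is \<open>A $$ j $$ i\<close>. \<open>subst2 P A\<close> is \<open>A(P(x, z), x)\<close>, meaningful for
  \<open>A\<close> in \<open>\<complex>((x\<^sub>1, x\<^sub>2))\<close>.
\<close>

definition mono2 :: "complex fls fps \<Rightarrow> int \<times> int \<Rightarrow> complex fls fps" where
  "mono2 P = (\<lambda>(i, j). P powi i * fps_const (fls_X_intpow j))"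

definition coeff_at :: "complex fls fls \<Rightarrow> int \<times> int \<Rightarrow> complex" where
  "coeff_at A = (\<lambda>(i, j). A $$ j $$ i)"

text \<open>Membership in (x1 x2)^N C[[x1, x2]]. The explicit \<open>N\<close> makes bounds additive
  under products.\<close>

definition bounded2 :: "int \<Rightarrow> complex fls fls \<Rightarrow> bool" where
  "bounded2 N A \<longleftrightarrow> (\<forall>i j. i < N \<or> j < N \<longrightarrow> A $$ j $$ i = 0)"

definition subst2 :: "complex fls fps \<Rightarrow> complex fls fls \<Rightarrow> complex fls fps" where
  "subst2 P A = Abs_fps (\<lambda>m. Abs_fls (\<lambda>n. Sum_any (\<lambda>p. (const2 (coeff_at A p) * mono2 P p) $ m $$ n)))"

lemma mono2_add:
  assumes "positive_order P"
  shows "mono2 P (p + q) = mono2 P p * mono2 P q"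
proof -
  have "fps_const (fls_X_intpow (i + j) :: complex fls) = fps_const (fls_X_intpow i) * fps_const (fls_X_intpow j)"
    for i j :: int
    unfolding fps_const_mult fls_X_intpow_times_fls_X_intpow ..
  then show ?thesis
    using assms by (simp add: mono2_def positive_order_def fps_power_int_add mult_ac split_def)
qed

lemma small_fps_const: "(\<And>j. j < n \<Longrightarrow> F $$ j = 0) \<Longrightarrow> fps_const F \<in> small m n"
  by (auto simp: small_def fps_const_def)

lemma mono2_small:
  assumes P: "positive_order P"
  shows "\<exists>C. \<forall>i\<ge>N. \<forall>j. mono2 P (i, j) \<in> small m (i + j - C)"
proof -
  obtain C where C: "\<forall>i\<ge>N. P powi i \<in> small m (i - C)"
    using positive_order_power_int_small[OF P] by blast
  have "mono2 P (i, j) \<in> small m (i + j - C)" if "i \<ge> N" for i j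
  proof -
    have "fps_const (fls_X_intpow j) \<in> small m j"
      by (rule small_fps_const) simp
    from small_mult[OF _ this, of "P powi i" "i - C"] show ?thesis
      using C that by (simp add: mono2_def algebra_simps)
  qed
  then show ?thesis by blast
qed

lemma bounded2_null_family:
  assumes P: "positive_order P" and A: "\<And>i j. i < N \<or> j < N \<Longrightarrow> c (i, j) = 0"
  shows "null_family (\<lambda>p. const2 (c p) * mono2 P p)"
  unfolding null_family_def
proof (intro allI)
  fix m n
  obtain C where C: "\<forall>i\<ge>N. \<forall>j. mono2 P (i, j) \<in> small m (i + j - C)"
    using mono2_small[OF P] by blast
  \<comment> \<open>If i, j \<ge> N and i + j < n + C, then neither exponent exceeds n + C - N, so a
    finite square contains all large terms.\<close>
  have "const2 (c (i, j)) * mono2 P (i, j) \<in> small m n" if "(i, j) \<notin> {N..n + C - N} \<times> {N..n + C - N}" for i j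
  proof (cases "i < N \<or> j < N")
    case False
    then have "mono2 P (i, j) \<in> small m n"
      using C that by (intro small_mono[of _ m "i + j - C" m n]) auto
    then show ?thesis by (rule small_const2)
  qed (simp add: A)
  then have "{p. const2 (c p) * mono2 P p \<notin> small m n} \<subseteq> {N..n + C - N} \<times> {N..n + C - N}" by force
  then show "finite {p. const2 (c p) * mono2 P p \<notin> small m n}"
    by (rule finite_subset) simp
qed

lemma subst2_fsums:
  assumes "positive_order P" and "bounded2 N A"
  shows "(\<lambda>p. const2 (coeff_at A p) * mono2 P p) fsums subst2 P A"
  unfolding subst2_def using assms
  by (intro null_family_fsums bounded2_null_family[of P N]) (auto simp: bounded2_def coeff_at_def)

lemma fls_fls_times_nth:
  assumes A: "bounded2 N A" and B: "bounded2 M B"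
  shows "(A * B) $$ j $$ i = (\<Sum>(i', j')\<in>{M..i - N} \<times> {M..j - N}. A $$ (j - j') $$ (i - i') * B $$ j' $$ i')"
proof -
  have z: "A $$ k = 0" if "k < N" for k
    using A that by (intro fls_eqI) (auto simp: bounded2_def)
  have z': "B $$ k = 0" if "k < M" for k
    using B that by (intro fls_eqI) (auto simp: bounded2_def)
  have "(A * B) $$ j = (\<Sum>j'=M..j - N. B $$ j' * A $$ (j - j'))"
    by (subst mult.commute, rule fls_times_nth_interval) (use z z' in auto)
  also have "\<dots> $$ i = (\<Sum>j'=M..j - N. \<Sum>i'=M..i - N. B $$ j' $$ i' * A $$ (j - j') $$ (i - i'))"
    unfolding fls_sum_nth
    by (intro sum.cong refl fls_times_nth_interval) (use A B in \<open>auto simp: bounded2_def\<close>)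
  also have "\<dots> = (\<Sum>i'=M..i - N. \<Sum>j'=M..j - N. A $$ (j - j') $$ (i - i') * B $$ j' $$ i')"
    by (subst sum.swap) (simp only: mult.commute)
  finally show ?thesis by (simp only: sum.cartesian_product)
qed

lemma bounded2_mult:
  assumes A: "bounded2 N A" and B: "bounded2 M B"
  shows "bounded2 (N + M) (A * B)"
  unfolding bounded2_def
  by (auto simp: fls_fls_times_nth[OF A B] intro!: sum.neutral)

lemma bounded2_add: "bounded2 N A \<Longrightarrow> bounded2 N B \<Longrightarrow> bounded2 N (A + B)"
  and bounded2_diff: "bounded2 N A \<Longrightarrow> bounded2 N B \<Longrightarrow> bounded2 N (A - B)"
  by (auto simp: bounded2_def)

lemma subst2_add:
  assumes "positive_order P" "bounded2 N A" "bounded2 N B"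
  shows "subst2 P (A + B) = subst2 P A + subst2 P B"
proof (rule fsums_unique)
  show "(\<lambda>p. const2 (coeff_at (A + B) p) * mono2 P p) fsums subst2 P (A + B)"
    using assms by (intro subst2_fsums bounded2_add)
  have "(\<lambda>p. const2 (coeff_at A p) * mono2 P p + const2 (coeff_at B p) * mono2 P p) fsums
      (subst2 P A + subst2 P B)"
    using assms by (intro fsums_add subst2_fsums)
  then show "(\<lambda>p. const2 (coeff_at (A + B) p) * mono2 P p) fsums (subst2 P A + subst2 P B)"
    by (simp add: coeff_at_def split_def const2_add distrib_right)
qed

lemma subst2_diff:
  assumes "positive_order P" "bounded2 N A" "bounded2 N B"
  shows "subst2 P (A - B) = subst2 P A - subst2 P B"
  using subst2_add[OF assms(1) bounded2_diff[OF assms(2,3)] assms(3)] by simp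

lemma subst2_mult:
  assumes P: "positive_order P" and A: "bounded2 N A" and B: "bounded2 M B"
  shows "subst2 P (A * B) = subst2 P A * subst2 P B"
proof (rule fsums_unique)
  show "(\<lambda>p. const2 (coeff_at (A * B) p) * mono2 P p) fsums subst2 P (A * B)"
    by (rule subst2_fsums[OF P bounded2_mult[OF A B]])
  define F where "F = (\<lambda>(p, q). (const2 (coeff_at A p) * mono2 P p) * (const2 (coeff_at B q) * mono2 P q))"
  have F: "F fsums (subst2 P A * subst2 P B)"
    unfolding F_def using assms by (intro fsums_mult subst2_fsums)
  \<comment> \<open>Reindexing by the total exponent s = p + q turns the inner sum over
    \<open>q\<close> into the coefficient of \<open>A * B\<close> at s.\<close>
  define h where "h = (\<lambda>(s, q). (s - q, q) :: (int \<times> int) \<times> (int \<times> int))"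
  have "bij h" by (rule bij_betw_byWitness[where f' = "\<lambda>(p, q). (p + q, q)"]) (auto simp: h_def)
  then have Fh: "(\<lambda>x. F (h x)) fsums (subst2 P A * subst2 P B)"
    using F by (simp add: fsums_reindex)
  have Fsq: "F (h (s, q)) = const2 (coeff_at A (s - q) * coeff_at B q) * mono2 P s" for s q
    using mono2_add[OF P, of "s - q" q] by (simp add: F_def h_def const2_mult mult_ac)
  have "(\<lambda>q. F (h (s, q))) fsums (const2 (coeff_at (A * B) s) * mono2 P s)" for s
  proof -
    obtain i j where s: "s = (i, j)" by fastforce
    let ?I = "{M..i - N} \<times> {M..j - N}"
    have "(\<lambda>q. F (h (s, q))) fsums (\<Sum>q\<in>?I. F (h (s, q)))"
    proof (rule fsums_finite)
      fix q assume "q \<notin> ?I"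
      then have "coeff_at A (s - q) * coeff_at B q = 0"
        using A B by (cases q) (auto simp: s coeff_at_def bounded2_def)
      then show "F (h (s, q)) = 0" by (simp only: Fsq const2_0 mult_zero_left)
    qed simp
    also have "(\<Sum>q\<in>?I. F (h (s, q))) = const2 (coeff_at (A * B) s) * mono2 P s"
      by (simp add: Fsq sum_distrib_right[symmetric] const2_sum[symmetric])
        (simp add: s coeff_at_def fls_fls_times_nth[OF A B] split_def)
    finally show ?thesis .
  qed
  with Fh show "(\<lambda>p. const2 (coeff_at (A * B) p) * mono2 P p) fsums (subst2 P A * subst2 P B)"
    by (rule iffD2[OF fsums_Sigma[OF fsums_null[OF Fh]], rotated])
qed

definition fls_map :: "('a::zero \<Rightarrow> 'b::zero) \<Rightarrow> 'a fls \<Rightarrow> 'b fls" where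
  "fls_map h F = Abs_fls (\<lambda>n. h (F $$ n))"

lemma fls_map_nth: "h 0 = 0 \<Longrightarrow> fls_map h F $$ n = h (F $$ n)"
  unfolding fls_map_def by (rule nth_Abs_fls_lower_bound[of "fls_subdegree F"]) simp

text \<open>As x2 is the outer variable, \<open>fls_const G\<close> is the series G(x1).\<close>

lemma subst2_const:
  assumes P: "positive_order P"
  shows "subst2 P (fls_const G) = fls_subst G P"
proof (rule fsums_unique)
  obtain N where N: "\<forall>n<N. G $$ n = 0" using fls_nth_zero_below by blast
  have b: "bounded2 (min N 0) (fls_const G)" using N by (auto simp: bounded2_def)
  show f: "(\<lambda>p. const2 (coeff_at (fls_const G) p) * mono2 P p) fsums subst2 P (fls_const G)"
    using P b by (rule subst2_fsums)
  have "(\<lambda>j. const2 (coeff_at (fls_const G) (i, j)) * mono2 P (i, j)) fsums (const2 (G $$ i) * P powi i)" for i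
    using fsums_single[of 0 "\<lambda>j. const2 (coeff_at (fls_const G) (i, j)) * mono2 P (i, j)"]
    by (simp add: coeff_at_def mono2_def)
  then show "(\<lambda>p. const2 (coeff_at (fls_const G) p) * mono2 P p) fsums fls_subst G P"
    using fls_subst_fsums[OF P] by (rule iffD1[OF fsums_Sigma[OF fsums_null[OF f]]])
qed

lemma fps_const_fsums: "(\<lambda>j. const2 (G $$ j) * fps_const (fls_X_intpow j)) fsums fps_const G"
proof (rule fsumsI)
  fix m n
  obtain N where N: "\<forall>n<N. G $$ n = 0" using fls_nth_zero_below by blast
  have 1: "const2 (G $$ j) * fps_const (fls_X_intpow j) \<in> small m n" if "j \<notin> {N..n}" for j
  proof (cases "j < N")
    case False
    then show ?thesis using that by (intro small_const2 small_fps_const) auto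
  qed (use N in auto)
  have "(\<Sum>j=N..n. const2 (G $$ j) * fps_const (fls_X_intpow j)) =
      fps_const (\<Sum>j=N..n. fls_const (G $$ j) * fls_X_intpow j)"
    by (intro fps_ext) (simp add: const2_def fps_sum_nth)
  moreover have "fps_const G - fps_const (\<Sum>j=N..n. fls_const (G $$ j) * fls_X_intpow j) \<in> small m n"
    unfolding fps_const_sub
  proof (rule small_fps_const)
    fix k assume "k < n"
    then show "(G - (\<Sum>j=N..n. fls_const (G $$ j) * fls_X_intpow j)) $$ k = 0"
      using N by (simp add: fls_sum_nth if_distrib sum.delta cong: if_cong)
  qed
  ultimately show "\<exists>I. finite I \<and> (\<forall>j. j \<notin> I \<longrightarrow> const2 (G $$ j) * fps_const (fls_X_intpow j) \<in> small m n) \<and>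
      fps_const G - (\<Sum>j\<in>I. const2 (G $$ j) * fps_const (fls_X_intpow j)) \<in> small m n"
    using 1 by (intro exI[of _ "{N..n}"]) auto
qed

text \<open>\<open>fls_map fls_const G\<close> is G(x2), which a substitution for x1 leaves
  alone.\<close>

lemma subst2_map_const:
  assumes P: "positive_order P"
  shows "subst2 P (fls_map fls_const G) = fps_const G"
proof (rule fsums_unique)
  obtain N where N: "\<forall>n<N. G $$ n = 0" using fls_nth_zero_below by blast
  have c: "coeff_at (fls_map fls_const G) (i, j) = (if i = 0 then G $$ j else 0)" for i j
    by (simp add: coeff_at_def fls_map_nth)
  have b: "bounded2 (min N 0) (fls_map fls_const G)" using N by (auto simp: bounded2_def fls_map_nth)
  have f: "(\<lambda>p. const2 (coeff_at (fls_map fls_const G) p) * mono2 P p) fsums subst2 P (fls_map fls_const G)"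
    using P b by (rule subst2_fsums)
  \<comment> \<open>\<open>fsums_Sigma\<close> sums over the second index first. Here the first
    index, the exponent of x1, must be the inner one, because only 0 survives there.\<close>
  have "bij (prod.swap :: int \<times> int \<Rightarrow> _)" by (rule bij_swap)
  from fsums_comp_bij[OF f this]
  show f': "(\<lambda>p. const2 (coeff_at (fls_map fls_const G) (prod.swap p)) * mono2 P (prod.swap p))
      fsums subst2 P (fls_map fls_const G)" .
  have "(\<lambda>i. const2 (coeff_at (fls_map fls_const G) (i, j)) * mono2 P (i, j)) fsums
      (const2 (G $$ j) * fps_const (fls_X_intpow j))" for j
    using fsums_single[of 0 "\<lambda>i. const2 (coeff_at (fls_map fls_const G) (i, j)) * mono2 P (i, j)"]
    by (simp add: c mono2_def)
  then show "(\<lambda>p. const2 (coeff_at (fls_map fls_const G) (prod.swap p)) * mono2 P (prod.swap p))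
      fsums fps_const G"
    by (intro iffD1[OF fsums_Sigma[OF fsums_null[OF f']] fps_const_fsums]) simp
qed

text \<open>The one-variable law is the case of \<open>subst2_mult\<close> for series free of
  x2.\<close>

lemma fls_subst_mult:
  assumes "positive_order P"
  shows "fls_subst (F * G) P = fls_subst F P * fls_subst G P"
proof -
  have b: "bounded2 (min (fls_subdegree F) 0) (fls_const F)" for F
    by (auto simp: bounded2_def)
  show ?thesis
    using subst2_mult[OF assms b b, of F G] assms by (simp add: subst2_const fls_const_mult_const)
qed

lemma fls_subst_X_power_int:
  assumes "positive_order P"
  shows "fls_subst (fls_X_intpow i) P = P powi i"
  using fsums_unique[OF fls_subst_fsums[OF assms]]
    fsums_single[of i "\<lambda>j. const2 (fls_X_intpow i $$ j) * P powi j"] by fastforce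

lemma fls_subst_1: "positive_order P \<Longrightarrow> fls_subst 1 P = 1"
  using fls_subst_X_power_int[of P 0] by simp

lemma fls_subst_inverse:
  assumes "positive_order P" "G \<noteq> 0"
  shows "fls_subst (inverse G) P = inverse (fls_subst G P)"
  using fls_subst_mult[OF assms(1), of G "inverse G"] assms fls_subst_1
  by (intro fps_inverse_unique[symmetric]) simp

lemma fls_subst_power_int:
  assumes P: "positive_order P" and G: "G \<noteq> 0"
  shows "fls_subst (G powi i) P = fls_subst G P powi i"
proof -
  have pow: "fls_subst (H ^ n) P = fls_subst H P ^ n" for H n
    by (induction n) (simp_all add: fls_subst_1[OF P] fls_subst_mult[OF P])
  show ?thesis by (simp add: power_int_def pow fls_subst_inverse[OF P G])
qed

section \<open>Change of the coordinate\<close>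

text \<open>g^i has order exactly i, for negative i too. This triangularity makes each coefficient
  after a change of coordinate a finite sum.\<close>

lemma fps_to_fls_power_int_nth_below:
  fixes g :: "'a::field fps"
  assumes "subdegree g = 1" "n < i"
  shows "(fps_to_fls g powi i) $$ n = 0"
  using assms by (intro fls_eq0_below_subdegree) (simp add: fls_subdegree_fls_to_fps)

lemma subdegree_eq_1D:
  assumes "subdegree g = 1"
  shows "g \<noteq> 0" "g $ 0 = 0" "g $ 1 \<noteq> 0"
proof -
  show "g \<noteq> 0" using assms by auto
  then show "g $ 1 \<noteq> 0" using assms nth_subdegree_nonzero by metis
  show "g $ 0 = 0" using assms by (intro nth_less_subdegree_zero) simp
qed

lemma fls_compose_fps_sum:
  fixes g :: "'a::field fps"
  assumes "g \<noteq> 0" "g $ 0 = 0"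
  shows "fls_compose_fps (sum F I) g = (\<Sum>i\<in>I. fls_compose_fps (F i) g)"
  by (induction I rule: infinite_finite_induct) (simp_all add: fls_compose_fps_add assms)

text \<open>Composition with a series of order one preserves orders, so cutting F off above degree n
  does not affect the coefficient at n; for the remaining Laurent polynomial, composition is a
  finite sum of powers of g.\<close>

lemma fls_compose_fps_nth:
  fixes F :: "'a::field fls" and g :: "'a fps"
  assumes g: "subdegree g = 1" and F: "\<And>i. i < N \<Longrightarrow> F $$ i = 0"
  shows "fls_compose_fps F g $$ n = (\<Sum>i=N..n. F $$ i * (fps_to_fls g powi i) $$ n)"
proof -
  note g0 = subdegree_eq_1D(1,2)[OF g]
  define S where "S = (\<Sum>i=N..n. fls_const (F $$ i) * fls_X powi i)"
  have "(F - S) $$ k = 0" if "k < n + 1" for k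
    using F that by (simp add: S_def fls_sum_nth if_distrib sum.delta cong: if_cong)
  then have "n < fls_subdegree (F - S)" if "F \<noteq> S"
    using fls_subdegree_geI[of "F - S" "n + 1"] that by simp
  then have "n < fls_subdegree (fls_compose_fps (F - S) g)" if "F \<noteq> S"
    using that g0 g by simp
  then have "fls_compose_fps (F - S) g $$ n = 0"
    by (cases "F = S") auto
  then have "fls_compose_fps F g $$ n = fls_compose_fps S g $$ n"
    using g0 by (simp add: fls_compose_fps_diff)
  also have "fls_compose_fps S g = (\<Sum>i=N..n. fls_const (F $$ i) * fps_to_fls g powi i)"
    using g0 unfolding S_def
    by (simp add: fls_compose_fps_sum fls_compose_fps_mult fls_compose_fps_powi del: fls_X_power_int)
  finally show ?thesis by (simp add: fls_sum_nth)
qed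

lemma fls_compose_fps_nth_below:
  fixes F :: "'a::field fls" and g :: "'a fps"
  assumes "subdegree g = 1" and "\<And>i. i < N \<Longrightarrow> F $$ i = 0" and "n < N"
  shows "fls_compose_fps F g $$ n = 0"
  using fls_compose_fps_nth[of g N F n] assms by simp

text \<open>The series Q(f(x), z).\<close>

definition compose_coeffs :: "complex fps \<Rightarrow> complex fls fps \<Rightarrow> complex fls fps" where
  "compose_coeffs f Q = Abs_fps (\<lambda>n. fls_compose_fps (Q $ n) f)"

context
  fixes f :: "complex fps"
  assumes f: "subdegree f = 1"
begin

lemma compose_coeffs_add: "compose_coeffs f (P + Q) = compose_coeffs f P + compose_coeffs f Q"
  by (intro fps_ext) (simp add: compose_coeffs_def fls_compose_fps_add subdegree_eq_1D[OF f])

lemma compose_coeffs_diff: "compose_coeffs f (P - Q) = compose_coeffs f P - compose_coeffs f Q"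
  by (intro fps_ext) (simp add: compose_coeffs_def fls_compose_fps_diff subdegree_eq_1D[OF f])

lemma compose_coeffs_mult: "compose_coeffs f (P * Q) = compose_coeffs f P * compose_coeffs f Q"
  by (intro fps_ext)
    (simp add: compose_coeffs_def fps_mult_nth fls_compose_fps_sum fls_compose_fps_mult subdegree_eq_1D[OF f])

lemma compose_coeffs_fps_const: "compose_coeffs f (fps_const F) = fps_const (fls_compose_fps F f)"
  by (intro fps_ext) (simp add: compose_coeffs_def fps_const_def)

lemma compose_coeffs_const2 [simp]: "compose_coeffs f (const2 c) = const2 c"
  by (simp add: const2_def compose_coeffs_fps_const)

lemma compose_coeffs_1 [simp]: "compose_coeffs f 1 = 1"
  using compose_coeffs_const2[of 1] by simp

lemma compose_coeffs_X [simp]: "compose_coeffs f fps_X = fps_X"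
  by (intro fps_ext) (simp add: compose_coeffs_def fps_X_def)

lemma compose_coeffs_power: "compose_coeffs f (P ^ n) = compose_coeffs f P ^ n"
  by (induction n) (simp_all add: compose_coeffs_mult)

lemma compose_coeffs_power_int:
  assumes "P $ 0 \<noteq> 0"
  shows "compose_coeffs f (P powi i) = compose_coeffs f P powi i"
proof -
  have "compose_coeffs f P * compose_coeffs f (inverse P) = 1"
    using assms by (simp add: compose_coeffs_mult[symmetric] inverse_mult_eq_1')
  then show ?thesis
    by (simp add: power_int_def compose_coeffs_power fps_inverse_unique)
qed

lemma compose_coeffs_small: "Q \<in> small m n \<Longrightarrow> compose_coeffs f Q \<in> small m n"
  unfolding small_def compose_coeffs_def
  by (auto intro!: fls_compose_fps_nth_below[OF f])

lemma compose_coeffs_fsums: "F fsums Q \<Longrightarrow> (\<lambda>i. compose_coeffs f (F i)) fsums compose_coeffs f Q"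
  by (rule fsums_additive_image[OF _ compose_coeffs_add compose_coeffs_small])

lemma positive_order_compose_coeffs:
  assumes "positive_order P"
  shows "positive_order (compose_coeffs f P)"
  using assms subdegree_eq_1D[OF f] fls_compose_fps_nth_below[OF f, of 1 "P $ 0"]
  by (auto simp: positive_order_def compose_coeffs_def fls_compose_fps_eq_0_iff)

lemma compose_coeffs_fls_subst:
  assumes P: "positive_order P"
  shows "compose_coeffs f (fls_subst G P) = fls_subst G (compose_coeffs f P)"
proof (rule fsums_unique)
  show "(\<lambda>i. const2 (G $$ i) * compose_coeffs f P powi i) fsums fls_subst G (compose_coeffs f P)"
    by (rule fls_subst_fsums[OF positive_order_compose_coeffs[OF P]])
  show "(\<lambda>i. const2 (G $$ i) * compose_coeffs f P powi i) fsums compose_coeffs f (fls_subst G P)"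
    using compose_coeffs_fsums[OF fls_subst_fsums[OF P, of G]] P
    by (simp add: compose_coeffs_mult compose_coeffs_power_int positive_order_def)
qed

lemma positive_order_fls_subst:
  assumes P: "positive_order P"
  shows "positive_order (fls_subst (fps_to_fls f) P)"
  unfolding positive_order_def
proof (intro conjI allI impI)
  let ?Q = "fls_subst (fps_to_fls f) P"
  \<comment> \<open>f is a unit of C((x)), hence f(P) is a unit of C((x))[[z]] and its constant term
    in z cannot vanish.\<close>
  have "?Q * fls_subst (inverse (fps_to_fls f)) P = 1"
    using fls_subst_mult[OF P, of "fps_to_fls f" "inverse (fps_to_fls f)"] subdegree_eq_1D(1)[OF f] fls_subst_1[OF P]
    by simp
  then show "?Q $ 0 \<noteq> 0"
    by (metis fps_mult_nth_0 fps_one_nth mult_zero_left zero_neq_one)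
  fix n :: int assume n: "n \<le> 0"
  \<comment> \<open>For i \<le> 0 the coefficient of f vanishes; for i > 0 the power P(x, 0)^i has
    positive order.\<close>
  have z: "fps_to_fls f $$ i * (P powi i) $ 0 $$ n = 0" for i
  proof (cases "i \<le> 0")
    case True
    then show ?thesis using subdegree_eq_1D[OF f] by (cases "i = 0") auto
  next
    case False
    have "1 \<le> fls_subdegree (P $ 0)"
      using P by (intro fls_subdegree_geI) (auto simp: positive_order_def)
    then have "0 < i * fls_subdegree (P $ 0)"
      using False by (intro mult_pos_pos) auto
    then have "n < fls_subdegree ((P $ 0) powi i)"
      using n P by (simp add: positive_order_def)
    then show ?thesis by (simp add: fps_power_int_nth_0)
  qed
  show "?Q $ 0 $$ n = 0"
    unfolding fsums_nth[OF fls_subst_fsums[OF P]] const2_nth z by simp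
qed

lemma fls_subst_fls_subst:
  assumes P: "positive_order P"
  shows "fls_subst F (fls_subst (fps_to_fls f) P) = fls_subst (fls_compose_fps F f) P"
proof (rule fsums_unique)
  let ?G = "fps_to_fls f"
  show "(\<lambda>s. const2 (fls_compose_fps F f $$ s) * P powi s) fsums fls_subst (fls_compose_fps F f) P"
    by (rule fls_subst_fsums[OF P])
  \<comment> \<open>Both sides are iterated sums of the double family \<open>K\<close>.\<close>
  define K where "K = (\<lambda>(i, s). const2 (F $$ i * (?G powi i) $$ s) * P powi s)"
  obtain N where N: "\<And>n. n < N \<Longrightarrow> F $$ n = 0" using fls_nth_zero_below by blast
  have null: "null_family K"
    unfolding null_family_def
  proof (intro allI)
    fix m n
    obtain C where C: "\<forall>i\<ge>N. P powi i \<in> small m (i - C)"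
      using positive_order_power_int_small[OF P] by blast
    \<comment> \<open>A nonzero coefficient forces N \<le> i \<le> s, and P^s has order at least s -
      C, so a large term also has s \<le> n + C.\<close>
    have "K (i, s) \<in> small m n" if "(i, s) \<notin> {N..n + C} \<times> {N..n + C}" for i s
    proof (cases "i < N \<or> s < i")
      case True
      then have "F $$ i * (?G powi i) $$ s = 0"
        using N fps_to_fls_power_int_nth_below[OF f] by auto
      then show ?thesis by (simp only: K_def prod.case const2_0 mult_zero_left small_zero)
    next
      case False
      then have "P powi s \<in> small m n"
        using C that by (intro small_mono[of _ m "s - C" m n]) auto
      then show ?thesis unfolding K_def prod.case by (rule small_const2)
    qed
    then have "{p. K p \<notin> small m n} \<subseteq> {N..n + C} \<times> {N..n + C}" by force
    then show "finite {p. K p \<notin> small m n}" by (rule finite_subset) simp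
  qed
  have "(\<lambda>s. K (i, s)) fsums (const2 (F $$ i) * fls_subst ?G P powi i)" for i
  proof -
    have "(\<lambda>s. const2 (F $$ i) * (const2 ((?G powi i) $$ s) * P powi s)) fsums
        (const2 (F $$ i) * fls_subst (?G powi i) P)"
      by (rule fsums_additive_image[OF fls_subst_fsums[OF P]]) (auto simp: distrib_left intro: small_const2)
    then show ?thesis
      using P subdegree_eq_1D[OF f] by (simp add: K_def const2_mult mult.assoc fls_subst_power_int)
  qed
  then have K: "K fsums fls_subst F (fls_subst ?G P)"
    by (rule iffD1[OF fsums_Sigma[OF null] fls_subst_fsums[OF positive_order_fls_subst[OF P]]])
  from fsums_comp_bij[OF this bij_swap]
  have K': "(\<lambda>p. K (prod.swap p)) fsums fls_subst F (fls_subst ?G P)" .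
  have "(\<lambda>i. K (i, s)) fsums (const2 (fls_compose_fps F f $$ s) * P powi s)" for s
  proof -
    have "(\<lambda>i. K (i, s)) fsums (\<Sum>i=N..s. K (i, s))"
    proof (rule fsums_finite)
      fix i assume "i \<notin> {N..s}"
      then have "F $$ i * (?G powi i) $$ s = 0"
        using N fps_to_fls_power_int_nth_below[OF f] by auto
      then show "K (i, s) = 0" by (simp only: K_def prod.case const2_0 mult_zero_left)
    qed simp
    also have "(\<Sum>i=N..s. K (i, s)) = const2 (fls_compose_fps F f $$ s) * P powi s"
      by (simp add: K_def fls_compose_fps_nth[OF f N] const2_sum sum_distrib_right)
    finally show ?thesis .
  qed
  then show "(\<lambda>s. const2 (fls_compose_fps F f $$ s) * P powi s) fsums fls_subst F (fls_subst ?G P)"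
    by (intro iffD2[OF fsums_Sigma[OF fsums_null[OF K']] K']) simp
qed

end

section \<open>Change of the coordinate in both variables\<close>

lemma fls_map_mult:
  fixes h :: "'a::comm_ring_1 \<Rightarrow> 'b::comm_ring_1"
  assumes add: "\<And>x y. h (x + y) = h x + h y" and mult: "\<And>x y. h (x * y) = h x * h y" and "h 0 = 0"
  shows "fls_map h (F * G) = fls_map h F * fls_map h G"
proof (rule fls_eqI)
  fix n
  have h_sum: "h (sum g I) = (\<Sum>i\<in>I. h (g i))" for g :: "int \<Rightarrow> 'a" and I
    by (induction I rule: infinite_finite_induct) (simp_all add: assms)
  have "(fls_map h F * fls_map h G) $$ n =
      (\<Sum>i=fls_subdegree F..n - fls_subdegree G. fls_map h F $$ i * fls_map h G $$ (n - i))"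
    by (rule fls_times_nth_interval[of _ _ "fls_subdegree G"]) (simp_all add: fls_map_nth assms)
  then show "fls_map h (F * G) $$ n = (fls_map h F * fls_map h G) $$ n"
    by (simp add: fls_map_nth assms h_sum fls_times_nth(2))
qed

lemma fls_map_const_power_int:
  fixes F :: "'a::field fls"
  shows "fls_map fls_const (F powi i) = fls_map fls_const F powi i"
proof (cases "F = 0")
  case True
  have "fls_map fls_const (0 :: 'a fls) = 0" "fls_map fls_const (1 :: 'a fls) = 1"
    by (auto intro!: fls_eqI simp: fls_map_nth)
  with True show ?thesis by (simp add: power_int_0_left_if)
next
  case False
  have one: "fls_map fls_const (1 :: 'a fls) = 1"
    by (auto intro!: fls_eqI simp: fls_map_nth)
  have mult: "fls_map fls_const (F * G) = fls_map fls_const F * fls_map fls_const G" for F G :: "'a fls"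
    by (rule fls_map_mult) (simp_all add: fls_plus_const fls_const_mult_const)
  have pow: "fls_map fls_const (G ^ n) = fls_map fls_const G ^ n" for G :: "'a fls" and n
    by (induction n) (simp_all add: one mult)
  have "fls_map fls_const F * fls_map fls_const (inverse F) = 1"
    using False by (simp add: mult[symmetric] one)
  then have "fls_map fls_const (inverse F) = inverse (fls_map fls_const F)"
    by (rule inverse_unique[symmetric])
  then show ?thesis by (simp add: power_int_def pow)
qed

text \<open>\<open>twist2 f A\<close> is \<open>A(f(x\<^sub>1), f(x\<^sub>2))\<close>.\<close>

definition twist2 :: "complex fps \<Rightarrow> complex fls fls \<Rightarrow> complex fls fls" where
  "twist2 f A = fls_compose_fps (fls_map (\<lambda>F. fls_compose_fps F f) A) (Abs_fps (\<lambda>j. fls_const (f $ j)))"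

context
  fixes f :: "complex fps"
  assumes f: "subdegree f = 1"
begin

lemma lift_subdegree: "subdegree (Abs_fps (\<lambda>j. fls_const (f $ j))) = 1"
  using subdegree_eq_1D[OF f] by (intro subdegreeI) auto

text \<open>Each of the two stages of \<open>twist2\<close> is a ring homomorphism on its field of
  Laurent series, so the law covers all of C((x1))((x2)), where uncleared products of operators
  live.\<close>

lemma twist2_mult: "twist2 f (A * B) = twist2 f A * twist2 f B"
  unfolding twist2_def
  by (subst fls_map_mult)
    (simp_all only: fls_compose_fps_0 fls_compose_fps_add[OF subdegree_eq_1D(1,2)[OF f]]
      fls_compose_fps_mult[OF subdegree_eq_1D(1,2)[OF f]]
      fls_compose_fps_mult[OF subdegree_eq_1D(1,2)[OF lift_subdegree]])

lemma twist2_power: "twist2 f (A ^ n) = twist2 f A ^ n"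
proof (induction n)
  case 0
  have "fls_map (\<lambda>F. fls_compose_fps F f) 1 = 1"
    by (auto intro!: fls_eqI simp: fls_map_nth)
  then show ?case by (simp add: twist2_def)
qed (simp add: twist2_mult)

text \<open>The coefficient at x2^n uses only powers x2^j with j \<le> n, so a lower bound
  \<open>M\<close> for the powers of x1 valid for those j is enough; an iterated series may have no
  bound for all j.\<close>

lemma twist2_nth:
  assumes "\<And>j i. j < N \<Longrightarrow> A $$ j $$ i = 0" and M: "\<And>j i. j \<le> n \<Longrightarrow> i < M \<Longrightarrow> A $$ j $$ i = 0"
  shows "twist2 f A $$ n $$ k =
    (\<Sum>j=N..n. \<Sum>i=M..k. A $$ j $$ i * (fps_to_fls f powi i) $$ k * (fps_to_fls f powi j) $$ n)"
proof -
  let ?L = "Abs_fps (\<lambda>j. fls_const (f $ j))"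
  have z: "A $$ j = 0" if "j < N" for j
    using assms(1) that by (intro fls_eqI) auto
  \<comment> \<open>The lifted series is f(x2), with coefficients constant in x1; its powers are the
    lifted powers of f.\<close>
  have L: "fps_to_fls ?L = fls_map fls_const (fps_to_fls f)"
    by (intro fls_eqI) (simp add: fls_map_nth)
  have "twist2 f A $$ n = (\<Sum>j=N..n. fls_map (\<lambda>F. fls_compose_fps F f) A $$ j * (fps_to_fls ?L powi j) $$ n)"
    unfolding twist2_def by (rule fls_compose_fps_nth[OF lift_subdegree]) (simp add: fls_map_nth z)
  then have "twist2 f A $$ n $$ k =
      (\<Sum>j=N..n. fls_compose_fps (A $$ j) f $$ k * (fps_to_fls f powi j) $$ n)"
    by (simp add: L fls_map_const_power_int[symmetric] fls_map_nth fls_sum_nth)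
  also have "\<dots> = (\<Sum>j=N..n. (\<Sum>i=M..k. A $$ j $$ i * (fps_to_fls f powi i) $$ k) * (fps_to_fls f powi j) $$ n)"
    using M by (intro sum.cong refl arg_cong2[where f = "(*)"] fls_compose_fps_nth[OF f]) auto
  finally show ?thesis by (simp add: sum_distrib_right)
qed

lemma twist2_nth_bounded2:
  assumes "bounded2 N A"
  shows "twist2 f A $$ n $$ k =
    (\<Sum>j=N..n. \<Sum>i=N..k. A $$ j $$ i * (fps_to_fls f powi i) $$ k * (fps_to_fls f powi j) $$ n)"
  using assms by (intro twist2_nth) (auto simp: bounded2_def)

lemma bounded2_twist2:
  assumes "bounded2 N A"
  shows "bounded2 N (twist2 f A)"
  unfolding bounded2_def by (auto simp: twist2_nth_bounded2[OF assms])

text \<open>\<open>PQ\<close> reads f(Q(x, z)) = P(f(x), z), so both sides are A(f(Q(x, z)), f(x)).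
  The work lies in expanding each monomial of \<open>A\<close> and exchanging the sums.\<close>

lemma subst2_twist2:
  assumes P: "positive_order P" and Q: "positive_order Q" and A: "bounded2 N A"
    and PQ: "fls_subst (fps_to_fls f) Q = compose_coeffs f P"
  shows "subst2 Q (twist2 f A) = compose_coeffs f (subst2 P A)"
proof (rule fsums_unique)
  let ?F = "fps_to_fls f"
  show "(\<lambda>q. const2 (coeff_at (twist2 f A) q) * mono2 Q q) fsums subst2 Q (twist2 f A)"
    by (rule subst2_fsums[OF Q bounded2_twist2[OF A]])
  \<comment> \<open>\<open>c p q\<close> is the contribution of the monomial of \<open>A\<close>
    with exponents \<open>p\<close> to the monomial of A(f(x1), f(x2)) with exponents
    \<open>q\<close>.\<close>
  define c where "c = (\<lambda>p q. coeff_at A p * ((?F powi fst p) $$ fst q * (?F powi snd p) $$ snd q))"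
  define K where "K = (\<lambda>(p, q). const2 (c p q) * mono2 Q q)"
  have c0: "c (i, j) (k, l) = 0" if "i < N \<or> j < N \<or> k < i \<or> l < j" for i j k l
    using that A fps_to_fls_power_int_nth_below[OF f] by (auto simp: c_def coeff_at_def bounded2_def)
  have null: "null_family K"
    unfolding null_family_def
  proof (intro allI)
    fix m n
    obtain C where C: "\<forall>i\<ge>N. \<forall>j. mono2 Q (i, j) \<in> small m (i + j - C)"
      using mono2_small[OF Q] by blast
    let ?I = "{N..n + C - N}"
    \<comment> \<open>Nonzero terms have N \<le> i \<le> k and N \<le> j \<le> l, and large ones
      also k + l < n + C; this bounds all four exponents.\<close>
    have "K ((i, j), (k, l)) \<in> small m n" if "\<not> (i \<in> ?I \<and> j \<in> ?I \<and> k \<in> ?I \<and> l \<in> ?I)" for i j k l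
    proof (cases "i < N \<or> j < N \<or> k < i \<or> l < j")
      case False
      then have "mono2 Q (k, l) \<in> small m n"
        using C that by (intro small_mono[of _ m "k + l - C" m n]) auto
      then show ?thesis unfolding K_def prod.case by (rule small_const2)
    qed (simp add: K_def c0)
    then have "{p. K p \<notin> small m n} \<subseteq> (?I \<times> ?I) \<times> (?I \<times> ?I)" by force
    then show "finite {p. K p \<notin> small m n}" by (rule finite_subset) simp
  qed
  have "(\<lambda>q. K (p, q)) fsums compose_coeffs f (const2 (coeff_at A p) * mono2 P p)" for p
  proof -
    obtain i j where p: "p = (i, j)" by fastforce
    have "compose_coeffs f (const2 (coeff_at A p) * mono2 P p) =
        const2 (coeff_at A p) * (fls_subst (?F powi i) Q * fps_const (?F powi j))"
      using P Q subdegree_eq_1D[OF f]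
      by (simp add: p mono2_def compose_coeffs_mult[OF f] compose_coeffs_power_int[OF f] positive_order_def
          compose_coeffs_const2[OF f] compose_coeffs_fps_const[OF f] fls_subst_power_int PQ
          fls_compose_fps_powi flip: fls_X_power_int)
    moreover have "(\<lambda>(k, l). (const2 ((?F powi i) $$ k) * Q powi k) *
        (const2 ((?F powi j) $$ l) * fps_const (fls_X_intpow l))) fsums
        (fls_subst (?F powi i) Q * fps_const (?F powi j))"
      by (intro fsums_mult fls_subst_fsums Q fps_const_fsums)
    then have "(\<lambda>q. const2 (coeff_at A p) * (case q of (k, l) \<Rightarrow> (const2 ((?F powi i) $$ k) * Q powi k) *
        (const2 ((?F powi j) $$ l) * fps_const (fls_X_intpow l)))) fsums
        (const2 (coeff_at A p) * (fls_subst (?F powi i) Q * fps_const (?F powi j)))"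
      by (rule fsums_additive_image) (auto simp: distrib_left intro: small_const2)
    moreover have "(\<lambda>q. const2 (coeff_at A p) * (case q of (k, l) \<Rightarrow> (const2 ((?F powi i) $$ k) * Q powi k) *
        (const2 ((?F powi j) $$ l) * fps_const (fls_X_intpow l)))) = (\<lambda>q. K (p, q))"
      by (auto simp: K_def c_def p mono2_def const2_mult mult_ac fun_eq_iff)
    ultimately show ?thesis by simp
  qed
  then have K: "K fsums compose_coeffs f (subst2 P A)"
    by (rule iffD1[OF fsums_Sigma[OF null] compose_coeffs_fsums[OF f subst2_fsums[OF P A]]])
  from fsums_comp_bij[OF this bij_swap]
  have K': "(\<lambda>p. K (prod.swap p)) fsums compose_coeffs f (subst2 P A)" .
  have "(\<lambda>p. K (p, q)) fsums (const2 (coeff_at (twist2 f A) q) * mono2 Q q)" for q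
  proof -
    obtain k l where q: "q = (k, l)" by fastforce
    let ?I = "{N..k} \<times> {N..l}"
    have "(\<lambda>p. K (p, q)) fsums (\<Sum>p\<in>?I. K (p, q))"
    proof (rule fsums_finite)
      fix p assume "p \<notin> ?I"
      then have "c p q = 0" unfolding q by (cases p) (auto intro!: c0)
      then show "K (p, q) = 0" by (simp add: K_def)
    qed simp
    also have "(\<Sum>p\<in>?I. K (p, q)) = const2 (\<Sum>p\<in>?I. c p q) * mono2 Q q"
      by (simp add: K_def const2_sum sum_distrib_right)
    also have "(\<Sum>p\<in>?I. c p q) = (\<Sum>i=N..k. \<Sum>j=N..l. A $$ j $$ i * (?F powi i) $$ k * (?F powi j) $$ l)"
      unfolding sum.cartesian_product by (simp add: c_def q coeff_at_def split_def mult_ac)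
    also have "\<dots> = coeff_at (twist2 f A) q"
      by (subst sum.swap) (simp add: q coeff_at_def twist2_nth_bounded2[OF A])
    finally show ?thesis .
  qed
  then show "(\<lambda>q. const2 (coeff_at (twist2 f A) q) * mono2 Q q) fsums compose_coeffs f (subst2 P A)"
    by (intro iffD2[OF fsums_Sigma[OF fsums_null[OF K']] K']) simp
qed

lemma twist2_const: "twist2 f (fls_const G) = fls_const (fls_compose_fps G f)"
proof -
  have "fls_map (\<lambda>F. fls_compose_fps F f) (fls_const G) = fls_const (fls_compose_fps G f)"
    by (intro fls_eqI) (simp add: fls_map_nth)
  then show ?thesis by (simp add: twist2_def)
qed

lemma twist2_map_const: "twist2 f (fls_map fls_const G) = fls_map fls_const (fls_compose_fps G f)"
proof (intro fls_eqI)
  fix n k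
  obtain N where N: "\<And>n. n < N \<Longrightarrow> G $$ n = 0" using fls_nth_zero_below by blast
  have "twist2 f (fls_map fls_const G) $$ n $$ k =
      (\<Sum>j=N..n. \<Sum>i=0..k. fls_map fls_const G $$ j $$ i * (fps_to_fls f powi i) $$ k * (fps_to_fls f powi j) $$ n)"
    by (rule twist2_nth) (auto simp: fls_map_nth N)
  also have "\<dots> = (\<Sum>j=N..n. (if k = 0 then G $$ j else 0) * (fps_to_fls f powi j) $$ n)"
  proof (rule sum.cong[OF refl])
    fix j
    show "(\<Sum>i=0..k. fls_map fls_const G $$ j $$ i * (fps_to_fls f powi i) $$ k * (fps_to_fls f powi j) $$ n) =
        (if k = 0 then G $$ j else 0) * (fps_to_fls f powi j) $$ n"
    proof (cases "0 \<le> k")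
      case True
      have "(\<Sum>i=0..k. fls_map fls_const G $$ j $$ i * (fps_to_fls f powi i) $$ k * (fps_to_fls f powi j) $$ n) =
          (\<Sum>i\<in>{0}. fls_map fls_const G $$ j $$ i * (fps_to_fls f powi i) $$ k * (fps_to_fls f powi j) $$ n)"
        using True by (intro sum.mono_neutral_right) (auto simp: fls_map_nth)
      then show ?thesis by (simp add: fls_map_nth)
    qed auto
  qed
  also have "\<dots> = fls_map fls_const (fls_compose_fps G f) $$ n $$ k"
    by (simp add: fls_map_nth fls_compose_fps_nth[OF f N])
  finally show "twist2 f (fls_map fls_const G) $$ n $$ k = fls_map fls_const (fls_compose_fps G f) $$ n $$ k" .
qed

lemma twist2_diff: "twist2 f (A - B) = twist2 f A - twist2 f B"
proof -
  have "fls_map (\<lambda>F. fls_compose_fps F f) (A - B) =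
      fls_map (\<lambda>F. fls_compose_fps F f) A - fls_map (\<lambda>F. fls_compose_fps F f) B"
    by (intro fls_eqI) (simp add: fls_map_nth fls_compose_fps_diff subdegree_eq_1D[OF f])
  then show ?thesis 
    by (simp only: twist2_def fls_compose_fps_diff[OF subdegree_eq_1D(1,2)[OF lift_subdegree]])
qed

end

section \<open>The difference quotient\<close>

lemma fls_compose_fps_inverse_pair:
  fixes f g :: "complex fps"
  assumes "subdegree g = 1" and "f oo g = fps_X"
  shows "fls_compose_fps (fps_to_fls f) g = fls_X"
  using assms(2) subdegree_eq_1D(1,2)[OF assms(1)] by (simp add: fps_X_to_fls)

text \<open>\<open>fls_const fls_X\<close> is x1, and the outer \<open>fls_X\<close> is x2.\<close>

definition x1_minus_x2 :: "complex fls fls" where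
  "x1_minus_x2 = fls_const fls_X - fls_X"

text \<open>\<open>(g(x\<^sub>1) - g(x\<^sub>2)) / (x\<^sub>1 - x\<^sub>2)\<close>\<close>

definition difference_quotient :: "complex fps \<Rightarrow> complex fls fls" where
  "difference_quotient g =
     Abs_fls (\<lambda>j. Abs_fls (\<lambda>i. if 0 \<le> i \<and> 0 \<le> j then g $ Suc (nat (i + j)) else 0))"

lemma difference_quotient_nth:
  "difference_quotient g $$ j $$ i = (if 0 \<le> i \<and> 0 \<le> j then g $ Suc (nat (i + j)) else 0)"
proof -
  have 1: "Abs_fls (\<lambda>i. if 0 \<le> i \<and> 0 \<le> j then g $ Suc (nat (i + j)) else 0) $$ i =
      (if 0 \<le> i \<and> 0 \<le> j then g $ Suc (nat (i + j)) else 0)" for i j :: int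
    by (rule nth_Abs_fls_lower_bound[of 0]) simp
  have "difference_quotient g $$ j = Abs_fls (\<lambda>i. if 0 \<le> i \<and> 0 \<le> j then g $ Suc (nat (i + j)) else 0)"
    unfolding difference_quotient_def
    by (rule nth_Abs_fls_lower_bound[of 0]) (auto intro: fls_eqI simp: 1)
  then show ?thesis by (simp add: 1)
qed

lemma bounded2_difference_quotient: "bounded2 0 (difference_quotient g)"
  by (auto simp: bounded2_def difference_quotient_nth)

lemma x1_minus_x2_mult_nth:
  "(x1_minus_x2 * A) $$ j $$ i = A $$ j $$ (i - 1) - A $$ (j - 1) $$ i"
  by (simp add: x1_minus_x2_def left_diff_distrib fls_X_times_conv_shift)

text \<open>Multiplication by x1 - x2 yields at x1^i x2^j a difference of two copies of the
  coefficient of g at i + j, which cancel when i and j are both positive; the two axes give g(x1)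
  and -g(x2).\<close>

lemma x1_minus_x2_times_difference_quotient:
  assumes "g $ 0 = 0"
  shows "x1_minus_x2 * difference_quotient g = fls_const (fps_to_fls g) - fls_map fls_const (fps_to_fls g)"
proof (intro fls_eqI)
  fix j i
  have "Suc (nat (n - 1)) = nat n" if "0 < n" for n
    using that by simp
  then show "(x1_minus_x2 * difference_quotient g) $$ j $$ i =
      (fls_const (fps_to_fls g) - fls_map fls_const (fps_to_fls g)) $$ j $$ i"
    unfolding x1_minus_x2_mult_nth difference_quotient_nth
    using assms by (auto simp: fls_map_nth add_diff_eq diff_add_eq)
qed

lemma bounded2_1: "bounded2 0 1"
  by (auto simp: bounded2_def)

lemma bounded2_power: "bounded2 0 A \<Longrightarrow> bounded2 0 (A ^ k)"
proof (induction k)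
  case (Suc k)
  then show ?case using bounded2_mult[of 0 A 0 "A ^ k"] by simp
qed (simp add: bounded2_1)

lemma bounded2_x1_minus_x2: "bounded2 0 x1_minus_x2"
  by (auto simp: bounded2_def x1_minus_x2_def)

lemma subst2_1: "positive_order P \<Longrightarrow> subst2 P 1 = 1"
  using subst2_const[of P 1] fls_subst_1[of P] by simp

lemma subst2_power:
  assumes "positive_order P" "bounded2 0 A"
  shows "subst2 P (A ^ k) = subst2 P A ^ k"
proof (induction k)
  case (Suc k)
  then show ?case using subst2_mult[OF assms(1,2) bounded2_power[OF assms(2)], of k] by simp
qed (simp add: subst2_1 assms)

lemma fls_subst_X: "positive_order P \<Longrightarrow> fls_subst fls_X P = P"
  using fls_subst_X_power_int[of P 1] by (simp add: fls_X_conv_shift_1)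

lemma fls_compose_fps_fps_X: "fls_compose_fps (F :: complex fls) fps_X = F"
  using fls_nth_fls_compose_fps_linear[of 1 F] by (intro fls_eqI) simp

lemma fls_map_const_X: "fls_map fls_const (fls_X :: complex fls) = fls_X"
  by (intro fls_eqI) (simp add: fls_map_nth)

lemma subst2_x1_minus_x2:
  assumes P: "positive_order P"
  shows "subst2 P x1_minus_x2 = P - fps_const fls_X"
proof -
  have "subst2 P x1_minus_x2 = subst2 P (fls_const fls_X) - subst2 P (fls_map fls_const fls_X)"
    unfolding x1_minus_x2_def fls_map_const_X
    by (rule subst2_diff[OF P, of 0]) (auto simp: bounded2_def)
  also have "\<dots> = P - fps_const fls_X"
    by (simp add: subst2_const[OF P] subst2_map_const[OF P] fls_subst_X[OF P])
  finally show ?thesis .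
qed

context
  fixes f g :: "complex fps"
  assumes f: "subdegree f = 1" and g: "subdegree g = 1"
    and fg: "f oo g = fps_X" and gf: "g oo f = fps_X"
begin

text \<open>The twist by f turns (x1 - x2) H = g(x1) - g(x2) into x1 - x2. This lets the clearing
  factor cross the twist even when \<open>A\<close> itself is only an iterated Laurent
  series.\<close>

lemma twist2_minus_power:
  "x1_minus_x2 ^ k * twist2 f A = twist2 f (difference_quotient g ^ k * (x1_minus_x2 ^ k * A))"
proof -
  have "twist2 f (x1_minus_x2 * difference_quotient g) = x1_minus_x2"
    by (simp add: x1_minus_x2_times_difference_quotient subdegree_eq_1D[OF g] twist2_diff[OF f]
        twist2_const[OF f] twist2_map_const[OF f] fls_compose_fps_inverse_pair[OF f gf]
        del: fls_compose_fps_to_fls)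
      (simp add: x1_minus_x2_def fls_map_const_X)
  then have "x1_minus_x2 ^ k * twist2 f A = twist2 f ((x1_minus_x2 * difference_quotient g) ^ k * A)"
    by (simp add: twist2_mult[OF f] twist2_power[OF f])
  then show ?thesis by (simp add: power_mult_distrib mult_ac)
qed

lemma bounded2_quotient_power_mult:
  assumes "bounded2 N A"
  shows "bounded2 N (difference_quotient g ^ k * A)"
  using bounded2_mult[OF bounded2_power[OF bounded2_difference_quotient] assms] by simp

lemma bounded2_twisted:
  assumes "bounded2 N (x1_minus_x2 ^ k * A)"
  shows "bounded2 N (x1_minus_x2 ^ k * twist2 f A)"
  unfolding twist2_minus_power by (intro bounded2_twist2 f bounded2_quotient_power_mult assms)

lemma fls_subst_twisted:
  assumes "positive_order P"
  shows "fls_subst (fps_to_fls f) (fls_subst (fps_to_fls g) P) = P"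
  using fls_subst_fls_subst[OF g assms, of "fps_to_fls f"] fls_subst_X[OF assms]
  by (simp add: fls_compose_fps_inverse_pair[OF g fg] del: fls_compose_fps_to_fls)

text \<open>
  The factor \<open>z\<^sup>s\<close> clears the negative powers of \<open>z\<close> in \<open>Y\<^sub>W(Y(u, z)v, x)w\<close>, so that the identity lives in
  \<open>\<complex>((x))[[z]]\<close>.
\<close>

lemma subst2_twisted:
  assumes P: "positive_order P" and A: "bounded2 N (x1_minus_x2 ^ k * A)"
    and eq: "fps_X ^ s * subst2 P (x1_minus_x2 ^ k * A) = (P - fps_const fls_X) ^ k * B"
  defines "Q \<equiv> fls_subst (fps_to_fls g) (compose_coeffs f P)"
  shows "fps_X ^ s * subst2 Q (x1_minus_x2 ^ k * twist2 f A) =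
    (Q - fps_const fls_X) ^ k * compose_coeffs f B"
proof -
  let ?H = "difference_quotient g"
  note b = bounded2_difference_quotient[of g]
  have Pf: "positive_order (compose_coeffs f P)" by (rule positive_order_compose_coeffs[OF f P])
  have Q: "positive_order Q"
    unfolding Q_def by (rule positive_order_fls_subst[OF g Pf])
  have "subst2 P ?H * (P - fps_const fls_X) = subst2 P (x1_minus_x2 * ?H)"
    by (simp add: subst2_mult[OF P bounded2_x1_minus_x2 b] subst2_x1_minus_x2[OF P])
  also have "\<dots> = fls_subst (fps_to_fls g) P - fps_const (fps_to_fls g)"
    unfolding x1_minus_x2_times_difference_quotient[OF subdegree_eq_1D(2)[OF g]]
    by (subst subst2_diff[OF P, of 0])
      (auto simp: bounded2_def fls_map_nth subst2_const[OF P] subst2_map_const[OF P])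
  \<comment> \<open>At f(x) in place of x, the series g(P(x, z)) becomes Q and g(x) becomes
    x.\<close>
  finally have "compose_coeffs f (subst2 P ?H * (P - fps_const fls_X)) = Q - fps_const fls_X"
    by (simp add: compose_coeffs_diff[OF f] compose_coeffs_fls_subst[OF f P] Q_def
        compose_coeffs_fps_const[OF f] fls_compose_fps_inverse_pair[OF f gf] del: fls_compose_fps_to_fls)
  then have Qk: "compose_coeffs f (subst2 P ?H ^ k * (P - fps_const fls_X) ^ k) = (Q - fps_const fls_X) ^ k"
    by (simp add: compose_coeffs_power[OF f] flip: power_mult_distrib)
  \<comment> \<open>The compatibility f(Q(x, z)) = P(f(x), z) that \<open>subst2_twist2\<close> asks
    for holds because Q is g applied to the right-hand side.\<close>
  have "subst2 Q (x1_minus_x2 ^ k * twist2 f A) = compose_coeffs f (subst2 P (?H ^ k * (x1_minus_x2 ^ k * A)))"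
    unfolding twist2_minus_power
    by (rule subst2_twist2[OF f P Q bounded2_quotient_power_mult[OF A]])
      (simp only: Q_def fls_subst_twisted[OF Pf])
  also have "subst2 P (?H ^ k * (x1_minus_x2 ^ k * A)) = subst2 P ?H ^ k * subst2 P (x1_minus_x2 ^ k * A)"
    by (simp only: subst2_mult[OF P bounded2_power[OF b] A] subst2_power[OF P b])
  finally have "fps_X ^ s * subst2 Q (x1_minus_x2 ^ k * twist2 f A) =
      compose_coeffs f (subst2 P ?H ^ k * (fps_X ^ s * subst2 P (x1_minus_x2 ^ k * A)))"
    by (simp add: compose_coeffs_mult[OF f] compose_coeffs_power[OF f] compose_coeffs_X[OF f] mult_ac)
  also have "\<dots> = compose_coeffs f (subst2 P ?H ^ k * (P - fps_const fls_X) ^ k * B)"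
    by (simp only: eq mult.assoc)
  also have "\<dots> = (Q - fps_const fls_X) ^ k * compose_coeffs f B"
    by (simp only: compose_coeffs_mult[OF f, of "_ * _"] Qk)
  finally show ?thesis .
qed

text \<open>A coordinate change acts on x and an outer substitution on the value of the series, so
  the two commute; f(g(x)) = x then removes both pairs.\<close>

lemma fls_subst_twisted_twisted:
  assumes P: "positive_order P"
  shows "fls_subst (fps_to_fls f) (compose_coeffs g (fls_subst (fps_to_fls g) (compose_coeffs f P))) = P"
proof -
  have Pf: "positive_order (compose_coeffs f P)" by (rule positive_order_compose_coeffs[OF f P])
  have "compose_coeffs g (compose_coeffs f P) = P"
    using fls_compose_fps_assoc[of f g] subdegree_eq_1D(1,2)[OF f] subdegree_eq_1D(1,2)[OF g] fg
    by (intro fps_ext) (simp add: compose_coeffs_def fls_compose_fps_fps_X)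
  then show ?thesis
    by (simp add: compose_coeffs_fls_subst[OF g Pf] fls_subst_twisted[OF P])
qed

end

lemma subdegree_fps_inv:
  fixes f :: "complex fps"
  assumes "subdegree f = 1"
  shows "subdegree (fps_inv f) = 1" and "f oo fps_inv f = fps_X" and "fps_inv f oo f = fps_X"
    and "fps_inv (fps_inv f) = f"
proof -
  note f = subdegree_eq_1D[OF assms]
  show "f oo fps_inv f = fps_X" "fps_inv f oo f = fps_X" "fps_inv (fps_inv f) = f"
    using f by (simp_all add: fps_inv fps_inv_right fps_inv_idempotent)
  have "fps_inv f $ 0 = 0" "fps_inv f $ 1 \<noteq> 0"
    using f by (simp_all add: fps_inv_def)
  then show "subdegree (fps_inv f) = 1" by (intro subdegreeI) auto
qed

lemma twisted_associate_eq:
  "twisted_associate f \<phi> = fls_subst (fps_to_fls (fps_inv f)) (compose_coeffs f \<phi>)"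
  by (simp add: twisted_associate_def compose_coeffs_def)

lemma associate_positive_order: "associate \<phi> \<Longrightarrow> positive_order \<phi>"
  by (auto simp: associate_def positive_order_def)

section \<open>Linear functionals\<close>

lemma complex_ring_simps [simp]:
  "carrier complex_ring = UNIV" "\<zero>\<^bsub>complex_ring\<^esub> = 0" "\<one>\<^bsub>complex_ring\<^esub> = 1"
  "x \<oplus>\<^bsub>complex_ring\<^esub> y = x + y" "x \<otimes>\<^bsub>complex_ring\<^esub> y = x * y"
  by (simp_all add: complex_ring_def)

locale complex_module = Module.module complex_ring W for W (structure)
begin

lemmas scale_closed [simp, intro] = smult_closed[simplified]
  and scale_add_left = smult_l_distr[simplified]
  and scale_add_right = smult_r_distr[simplified]
  and scale_scale = smult_assoc1[simplified]
  and scale_one [simp] = smult_one[simplified]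
  and scale_zero_left [simp] = smult_l_null[simplified]
  and scale_zero_right [simp] = smult_r_null[simplified]

text \<open>Values off the carrier are left free, so the composite of a functional with a linear map
  is a functional without being restricted to the carrier.\<close>

definition functionals :: "('a \<Rightarrow> complex) set" where
  "functionals = {h. (\<forall>x\<in>carrier W. \<forall>y\<in>carrier W. h (x \<oplus> y) = h x + h y) \<and>
     (\<forall>c. \<forall>x\<in>carrier W. h (c \<odot> x) = c * h x)}"

lemma functional_add: "h \<in> functionals \<Longrightarrow> x \<in> carrier W \<Longrightarrow> y \<in> carrier W \<Longrightarrow> h (x \<oplus> y) = h x + h y"
  and functional_scale: "h \<in> functionals \<Longrightarrow> x \<in> carrier W \<Longrightarrow> h (c \<odot> x) = c * h x"
  by (auto simp: functionals_def)

lemma functional_zero: "h \<in> functionals \<Longrightarrow> h \<zero> = 0"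
  using functional_scale[of h \<zero> 0] by simp

definition subspaces :: "'a set set" where
  "subspaces = {S. S \<subseteq> carrier W \<and> \<zero> \<in> S \<and> (\<forall>x\<in>S. \<forall>y\<in>S. x \<oplus> y \<in> S) \<and> (\<forall>c. \<forall>x\<in>S. c \<odot> x \<in> S)}"

text \<open>Zorn's lemma supplies the hyperplane complementary to the line of \<open>x\<close>
  directly, so no basis has to be chosen.\<close>

lemma exists_maximal_subspace_avoiding:
  assumes "x \<noteq> \<zero>"
  obtains M where "M \<in> subspaces" "x \<notin> M" "\<And>S. S \<in> subspaces \<Longrightarrow> M \<subseteq> S \<Longrightarrow> x \<notin> S \<Longrightarrow> S = M"
proof -
  let ?A = "{S \<in> subspaces. x \<notin> S}"
  have "{\<zero>} \<in> ?A" using assms by (auto simp: subspaces_def)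
  then have "?A \<noteq> {}" by blast
  moreover have "\<Union>C \<in> ?A" if C: "C \<noteq> {}" "subset.chain ?A C" for C
  proof -
    have "C \<subseteq> ?A" using C(2) by (auto simp: subset.chain_def)
    have "a \<oplus> b \<in> \<Union>C" if ab: "a \<in> S" "S \<in> C" "b \<in> T" "T \<in> C" for a b S T
    proof -
      have "S \<subseteq> T \<or> T \<subseteq> S" using C(2) ab by (auto simp: subset.chain_def)
      then obtain U where "U \<in> C" "a \<in> U" "b \<in> U" using ab by blast
      moreover have "U \<in> subspaces" using \<open>C \<subseteq> ?A\<close> \<open>U \<in> C\<close> by blast
      ultimately have "a \<oplus> b \<in> U" by (simp add: subspaces_def)
      then show ?thesis using \<open>U \<in> C\<close> by (rule UnionI[rotated])
    qed
    then have add: "\<forall>a\<in>\<Union>C. \<forall>b\<in>\<Union>C. a \<oplus> b \<in> \<Union>C" by blast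
    have "S \<subseteq> carrier W \<and> \<zero> \<in> S \<and> (\<forall>c. \<forall>a\<in>S. c \<odot> a \<in> S) \<and> x \<notin> S" if "S \<in> C" for S
      using \<open>C \<subseteq> ?A\<close> that by (auto simp: subspaces_def)
    with add C(1) show ?thesis unfolding subspaces_def by (intro CollectI conjI) blast+
  qed
  ultimately have "\<exists>M\<in>?A. \<forall>S\<in>?A. M \<subseteq> S \<longrightarrow> S = M"
    by (rule subset_Zorn_nonempty)
  then obtain M where "M \<in> ?A" "\<And>S. S \<in> ?A \<Longrightarrow> M \<subseteq> S \<Longrightarrow> S = M" by blast
  then show thesis by (intro that[of M]) auto
qed

text \<open>The maximal \<open>M\<close> avoiding \<open>x\<close> satisfies W = M + C x as a direct
  sum; the functional reads off the coefficient of \<open>x\<close>.\<close>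

lemma functionals_separate:
  assumes x: "x \<in> carrier W" "x \<noteq> \<zero>"
  shows "\<exists>h\<in>functionals. h x \<noteq> 0"
proof -
  obtain M where M: "M \<in> subspaces" "x \<notin> M"
    and max: "\<And>S. S \<in> subspaces \<Longrightarrow> M \<subseteq> S \<Longrightarrow> x \<notin> S \<Longrightarrow> S = M"
    using exists_maximal_subspace_avoiding[OF x(2)] by blast
  have MW: "s \<in> carrier W" if "s \<in> M" for s using M(1) that by (auto simp: subspaces_def)
  have M0: "\<zero> \<in> M" and Madd: "s \<in> M \<Longrightarrow> t \<in> M \<Longrightarrow> s \<oplus> t \<in> M" and Mscale: "s \<in> M \<Longrightarrow> c \<odot> s \<in> M" for s t c
    using M(1) by (auto simp: subspaces_def)
  have decomp: "\<exists>s\<in>M. \<exists>c. y = s \<oplus> c \<odot> x" if y: "y \<in> carrier W" for y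
  proof (cases "y \<in> M")
    case True
    then show ?thesis using x MW by (intro bexI[of _ y] exI[of _ 0]) auto
  next
    case False
    \<comment> \<open>The sum of M and the line of y properly contains M, so it contains x by
      maximality. The coefficient of y in x is nonzero because x is not in M, and the equation can
      be solved for y.\<close>
    define S where "S = {s \<oplus> c \<odot> y | s c. s \<in> M}"
    have "(s \<oplus> c \<odot> y) \<oplus> (t \<oplus> d \<odot> y) = (s \<oplus> t) \<oplus> (c + d) \<odot> y" if "s \<in> M" "t \<in> M" for s t c d
      using that y MW by (simp add: scale_add_left a_ac)
    moreover have "d \<odot> (s \<oplus> c \<odot> y) = d \<odot> s \<oplus> (d * c) \<odot> y" if "s \<in> M" for s c d
      using that y MW by (simp add: scale_add_right scale_scale)
    moreover have "\<zero> = \<zero> \<oplus> 0 \<odot> y" using y by simp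
    ultimately have S: "S \<in> subspaces"
      using M0 Madd Mscale MW y unfolding subspaces_def S_def by (auto; blast)
    have "s \<in> S" if "s \<in> M" for s
    proof -
      have "s = s \<oplus> 0 \<odot> y" using that MW y by simp
      then show ?thesis using that unfolding S_def by blast
    qed
    moreover have "y \<in> S"
    proof -
      have "y = \<zero> \<oplus> 1 \<odot> y" using y by simp
      then show ?thesis using M0 unfolding S_def by blast
    qed
    ultimately have "x \<in> S" using max[OF S] False by blast
    then obtain s c where s: "s \<in> M" "x = s \<oplus> c \<odot> y" unfolding S_def by blast
    have "c \<noteq> 0" using s M(2) MW y by auto
    then have "(1 / c) \<odot> x = (1 / c) \<odot> s \<oplus> y"
      using s MW y by (simp add: scale_add_right flip: scale_scale)
    moreover have "(- 1 / c) \<odot> s \<oplus> (1 / c) \<odot> s = \<zero>"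
      using s MW by (simp flip: scale_add_left)
    ultimately have "y = (- 1 / c) \<odot> s \<oplus> (1 / c) \<odot> x"
      using s MW y by (simp flip: a_assoc)
    then show ?thesis using s Mscale by blast
  qed
  \<comment> \<open>Two different coefficients would put a nonzero multiple of x into M.\<close>
  have unique: "c = d" if "s \<in> M" "t \<in> M" "s \<oplus> c \<odot> x = t \<oplus> d \<odot> x" for s t c d
  proof (rule ccontr)
    assume "c \<noteq> d"
    have "(c - d) \<odot> x = (- 1) \<odot> s \<oplus> t"
    proof -
      have s0: "(- 1) \<odot> s \<oplus> s = \<zero>"
        using that MW scale_add_left[of s "- 1" 1] by simp
      have d0: "d \<odot> x \<oplus> (- d) \<odot> x = \<zero>"
        using x scale_add_left[of x d "- d"] by simp
      have "(c - d) \<odot> x = c \<odot> x \<oplus> (- d) \<odot> x"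
        using x scale_add_left[of x c "- d"] by simp
      also have "\<dots> = ((- 1) \<odot> s \<oplus> s) \<oplus> (c \<odot> x \<oplus> (- d) \<odot> x)"
        using s0 x by simp
      also have "\<dots> = (- 1) \<odot> s \<oplus> ((s \<oplus> c \<odot> x) \<oplus> (- d) \<odot> x)"
        using that(1,2) MW x by (simp add: a_assoc)
      also have "\<dots> = (- 1) \<odot> s \<oplus> ((t \<oplus> d \<odot> x) \<oplus> (- d) \<odot> x)"
        by (simp only: that(3))
      also have "\<dots> = ((- 1) \<odot> s \<oplus> t) \<oplus> (d \<odot> x \<oplus> (- d) \<odot> x)"
        using that(1,2) MW x by (simp add: a_assoc)
      finally show ?thesis using d0 that MW by simp
    qed
    then have "(c - d) \<odot> x \<in> M" using that Madd Mscale by simp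
    then have "(1 / (c - d)) \<odot> ((c - d) \<odot> x) \<in> M" by (rule Mscale)
    then show False using \<open>c \<noteq> d\<close> x M(2) by (simp flip: scale_scale)
  qed
  define h where "h y = (THE c. \<exists>s\<in>M. y = s \<oplus> c \<odot> x)" for y
  have h: "h y = c" if "s \<in> M" "y = s \<oplus> c \<odot> x" for y s c
    unfolding h_def using that unique by (intro the_equality) blast+
  have "h \<in> functionals"
    unfolding functionals_def
  proof (intro CollectI conjI ballI allI)
    fix y z assume "y \<in> carrier W" "z \<in> carrier W"
    then obtain s c t d where st: "s \<in> M" "y = s \<oplus> c \<odot> x" "t \<in> M" "z = t \<oplus> d \<odot> x"
      using decomp by metis
    then have "y \<oplus> z = (s \<oplus> t) \<oplus> (c + d) \<odot> x"
      using x MW by (simp add: scale_add_left a_ac)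
    then show "h (y \<oplus> z) = h y + h z" using st h Madd by metis
  next
    fix c y assume "y \<in> carrier W"
    then obtain s d where s: "s \<in> M" "y = s \<oplus> d \<odot> x"
      using decomp by metis
    then have "c \<odot> y = c \<odot> s \<oplus> (c * d) \<odot> x"
      using x MW by (simp add: scale_add_right scale_scale)
    then show "h (c \<odot> y) = c * h y" using s h Mscale by metis
  qed
  moreover have "h x = 1" using h[of \<zero> x 1] M0 x by simp
  ultimately show ?thesis by (intro bexI[of _ h]) auto
qed

lemma functional_eqI:
  assumes "u \<in> carrier W" "v \<in> carrier W" "\<And>h. h \<in> functionals \<Longrightarrow> h u = h v"
  shows "u = v"
proof (rule ccontr)
  assume "u \<noteq> v"
  have "v \<oplus> (- 1) \<odot> v = \<zero>"
    using assms(2) scale_add_left[of v 1 "- 1"] by simp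
  then have v: "\<ominus> v = (- 1) \<odot> v"
    using assms(2) by (intro minus_equality) (auto simp: a_comm)
  have "u \<oplus> (- 1) \<odot> v \<noteq> \<zero>"
  proof
    assume "u \<oplus> (- 1) \<odot> v = \<zero>"
    then have "\<ominus> (\<ominus> v) = u" using assms v by (intro minus_equality) auto
    then show False using \<open>u \<noteq> v\<close> assms by simp
  qed
  then obtain h where "h \<in> functionals" "h (u \<oplus> (- 1) \<odot> v) \<noteq> 0"
    using functionals_separate[of "u \<oplus> (- 1) \<odot> v"] assms by auto
  then show False using assms by (simp add: functional_add functional_scale)
qed

lemma functional_finsum:
  assumes "h \<in> functionals" "finite I" "g \<in> I \<rightarrow> carrier W"
  shows "h (finsum W g I) = (\<Sum>i\<in>I. h (g i))"
  using assms(2,3)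
proof (induction I rule: finite_induct)
  case (insert i I)
  then have "h (g i \<oplus> finsum W g I) = h (g i) + h (finsum W g I)"
    using assms(1) by (intro functional_add finsum_closed) auto
  with insert show ?case by simp
qed (simp add: functional_zero assms(1))

lemma support_sum_closed:
  assumes "\<And>i. g i \<in> carrier W"
  shows "support_sum W g \<in> carrier W"
  unfolding support_sum_def using assms by (intro finsum_closed) auto

text \<open>\<open>h\<close> may kill terms, so the support of the image can be smaller than that of
  \<open>g\<close>. Summing over any finite set that contains the support sidesteps this.\<close>

lemma functional_support_sum:
  assumes h: "h \<in> functionals" and g: "\<And>i. g i \<in> carrier W"
    and I: "finite I" "\<And>i. i \<notin> I \<Longrightarrow> g i = \<zero>"
  shows "h (support_sum W g) = (\<Sum>i\<in>I. h (g i))"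
proof -
  have sub: "{i. g i \<noteq> \<zero>} \<subseteq> I" using I(2) by auto
  then have "h (support_sum W g) = (\<Sum>i | g i \<noteq> \<zero>. h (g i))"
    unfolding support_sum_def using g I(1) finite_subset by (intro functional_finsum h) auto
  also have "\<dots> = (\<Sum>i\<in>I. h (g i))"
    using sub I(1) by (intro sum.mono_neutral_left) (auto simp: functional_zero h)
  finally show ?thesis .
qed

section \<open>Laurent series a(x) with coefficients in W and their twists a(f(x))\<close>

definition vanishes_below :: "int \<Rightarrow> (int \<Rightarrow> 'a) \<Rightarrow> bool" where
  "vanishes_below N a \<longleftrightarrow> range a \<subseteq> carrier W \<and> (\<forall>n<N. a n = \<zero>)"

lemma laurent_iff: "a \<in> laurent W \<longleftrightarrow> (\<exists>N. vanishes_below N a)"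
  by (auto simp: laurent_def vanishes_below_def)

definition series_of :: "('a \<Rightarrow> complex) \<Rightarrow> (int \<Rightarrow> 'a) \<Rightarrow> complex fls" where
  "series_of h a = Abs_fls (\<lambda>n. h (a n))"

lemma series_of_nth:
  assumes "h \<in> functionals" "a \<in> laurent W"
  shows "series_of h a $$ n = h (a n)"
proof -
  obtain N where "vanishes_below N a" using assms(2) by (auto simp: laurent_iff)
  then have "\<forall>n<N. h (a n) = 0" by (simp add: vanishes_below_def functional_zero assms(1))
  then show ?thesis unfolding series_of_def by (rule nth_Abs_fls_lower_bound)
qed

definition twist :: "complex fps \<Rightarrow> (int \<Rightarrow> 'a) \<Rightarrow> int \<Rightarrow> 'a" where
  "twist f a n = support_sum W (\<lambda>i. (fps_to_fls f powi i) $$ n \<odot> a i)"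

context
  fixes f :: "complex fps"
  assumes f: "subdegree f = 1"
begin

lemma functional_twist_sum:
  assumes h: "h \<in> functionals" and a: "vanishes_below N a"
  shows "h (twist f a n) = (\<Sum>i=N..n. h (a i) * (fps_to_fls f powi i) $$ n)"
proof -
  have aW: "a i \<in> carrier W" for i using a by (auto simp: vanishes_below_def)
  have "h (twist f a n) = (\<Sum>i=N..n. h ((fps_to_fls f powi i) $$ n \<odot> a i))"
    unfolding twist_def
  proof (rule functional_support_sum[OF h])
    fix i assume "i \<notin> {N..n}"
    then have "a i = \<zero> \<or> (fps_to_fls f powi i) $$ n = 0"
      using a fps_to_fls_power_int_nth_below[OF f] by (auto simp: vanishes_below_def)
    then show "(fps_to_fls f powi i) $$ n \<odot> a i = \<zero>" using aW by auto
  qed (use aW in auto)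
  then show ?thesis using aW h by (simp add: functional_scale mult.commute)
qed

text \<open>Under a functional the twist becomes composition of complex Laurent series, whose
  algebra thereby carries over to W.\<close>

lemma functional_twist:
  assumes h: "h \<in> functionals" and a: "a \<in> laurent W"
  shows "h (twist f a n) = fls_compose_fps (series_of h a) f $$ n"
proof -
  obtain N where N: "vanishes_below N a" using a by (auto simp: laurent_iff)
  then have "series_of h a $$ n = 0" if "n < N" for n
    using that by (simp add: series_of_nth h a vanishes_below_def functional_zero)
  then show ?thesis
    using functional_twist_sum[OF h N] fls_compose_fps_nth[OF f, of N "series_of h a" n]
    by (simp add: series_of_nth h a)
qed

lemma vanishes_below_twist:
  assumes a: "vanishes_below N a"
  shows "vanishes_below N (twist f a)"
proof -
  have aW: "a i \<in> carrier W" for i using a by (auto simp: vanishes_below_def)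
  have tW: "twist f a n \<in> carrier W" for n
    unfolding twist_def by (rule support_sum_closed) (use aW in auto)
  moreover have "twist f a n = \<zero>" if "n < N" for n
    using that tW by (intro functional_eqI) (auto simp: functional_zero functional_twist_sum[OF _ a])
  ultimately show ?thesis by (auto simp: vanishes_below_def)
qed

lemma twist_laurent: "a \<in> laurent W \<Longrightarrow> twist f a \<in> laurent W"
  using vanishes_below_twist by (auto simp: laurent_iff)

lemma twist_closed: "a \<in> laurent W \<Longrightarrow> twist f a n \<in> carrier W"
  using twist_laurent[of a] by (auto simp: laurent_def)

lemma series_of_twist:
  assumes "h \<in> functionals" "a \<in> laurent W"
  shows "series_of h (twist f a) = fls_compose_fps (series_of h a) f"
  by (intro fls_eqI) (simp add: series_of_nth assms twist_laurent functional_twist)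

lemma twist_add:
  assumes "a \<in> laurent W" "b \<in> laurent W" "(\<lambda>n. a n \<oplus> b n) \<in> laurent W"
  shows "twist f (\<lambda>n. a n \<oplus> b n) n = twist f a n \<oplus> twist f b n"
proof (rule functional_eqI)
  have ab: "a i \<in> carrier W" "b i \<in> carrier W" for i using assms by (auto simp: laurent_def)
  fix h assume h: "h \<in> functionals"
  have "series_of h (\<lambda>n. a n \<oplus> b n) = series_of h a + series_of h b"
    by (intro fls_eqI) (simp add: series_of_nth h assms functional_add ab)
  then show "h (twist f (\<lambda>n. a n \<oplus> b n) n) = h (twist f a n \<oplus> twist f b n)"
    by (simp add: functional_twist functional_add h assms twist_closed fls_compose_fps_add subdegree_eq_1D[OF f])
qed (use assms in \<open>auto intro!: twist_closed\<close>)

lemma twist_scale: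
  assumes "a \<in> laurent W" "(\<lambda>n. c \<odot> a n) \<in> laurent W"
  shows "twist f (\<lambda>n. c \<odot> a n) n = c \<odot> twist f a n"
proof (rule functional_eqI)
  have a: "a i \<in> carrier W" for i using assms by (auto simp: laurent_def)
  fix h assume h: "h \<in> functionals"
  have "series_of h (\<lambda>n. c \<odot> a n) = fls_const c * series_of h a"
    by (intro fls_eqI) (simp add: series_of_nth h assms functional_scale a)
  then show "h (twist f (\<lambda>n. c \<odot> a n) n) = h (c \<odot> twist f a n)"
    by (simp add: functional_twist functional_scale h assms twist_closed fls_compose_fps_mult subdegree_eq_1D[OF f])
qed (use assms in \<open>auto intro!: twist_closed\<close>)

lemma twist_const:
  assumes "w \<in> carrier W"
  shows "twist f (\<lambda>n. if n = 0 then w else \<zero>) n = (if n = 0 then w else \<zero>)"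
proof (rule functional_eqI)
  have l: "(\<lambda>n. if n = 0 then w else \<zero>) \<in> laurent W"
    using assms by (auto simp: laurent_def)
  show "twist f (\<lambda>n. if n = 0 then w else \<zero>) n \<in> carrier W" by (rule twist_closed[OF l])
  fix h assume h: "h \<in> functionals"
  have "series_of h (\<lambda>n. if n = 0 then w else \<zero>) = fls_const (h w)"
    by (intro fls_eqI) (simp add: series_of_nth h l functional_zero)
  then show "h (twist f (\<lambda>n. if n = 0 then w else \<zero>) n) = h (if n = 0 then w else \<zero>)"
    by (simp add: functional_twist h l functional_zero)
qed (use assms in auto)

end

lemma twist_twist:
  assumes f: "subdegree f = 1" and g: "subdegree g = 1" and fg: "f oo g = fps_X" and a: "a \<in> laurent W"
  shows "twist g (twist f a) = a"
proof (intro ext functional_eqI)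
  fix n h assume h: "h \<in> functionals"
  show "h (twist g (twist f a) n) = h (a n)"
    using fls_compose_fps_assoc[of f g "series_of h a"] subdegree_eq_1D(1,2)[OF f] subdegree_eq_1D(1,2)[OF g]
    by (simp add: functional_twist[OF g] twist_laurent[OF f] series_of_twist[OF f] h a fg
        fls_compose_fps_fps_X series_of_nth)
next
  show "twist g (twist f a) n \<in> carrier W" for n by (intro twist_closed[OF g] twist_laurent[OF f] a)
  show "a n \<in> carrier W" for n using a by (auto simp: laurent_def)
qed

end

section \<open>Products of operators\<close>

lemma x1_minus_x2_power_mult_nth:
  "(x1_minus_x2 ^ k * A) $$ j $$ i =
    (\<Sum>l\<le>k. (- 1) ^ l * of_nat (k choose l) * A $$ (j - int l) $$ (i - int (k - l)))"
proof -
  have "x1_minus_x2 ^ k = (- fls_X + fls_const fls_X) ^ k"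
    by (simp add: x1_minus_x2_def)
  also have "\<dots> = (\<Sum>l\<le>k. of_nat (k choose l) * (- fls_X) ^ l * fls_const fls_X ^ (k - l))"
    by (rule binomial_ring)
  finally have "x1_minus_x2 ^ k * A =
      (\<Sum>l\<le>k. of_nat (k choose l) * (- fls_X) ^ l * fls_const fls_X ^ (k - l) * A)"
    by (simp add: sum_distrib_right)
  moreover have "(of_nat (k choose l) * (- fls_X) ^ l * fls_const fls_X ^ (k - l) * A) =
      fls_const (fls_const ((- 1) ^ l * of_nat (k choose l))) * (fls_X ^ l * (fls_const (fls_X ^ (k - l)) * A))" for l
    by (simp add: fls_of_nat fls_const_power power_minus[of fls_X] mult_ac flip: fls_const_mult_const)
  ultimately show ?thesis
    by (simp add: fls_sum_nth fls_X_power_times_conv_shift) (simp add: algebra_simps)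
qed

context complex_module
begin

text \<open>Membership in W((x1))((x2)), the home of a product of two operators before (x1 - x2)^k
  is applied.\<close>

definition iterated_laurent :: "(int \<times> int \<Rightarrow> 'a) \<Rightarrow> bool" where
  "iterated_laurent c \<longleftrightarrow> range c \<subseteq> carrier W \<and> (\<exists>N. \<forall>j<N. \<forall>i. c (i, j) = \<zero>) \<and>
     (\<forall>j. \<exists>M. \<forall>i<M. c (i, j) = \<zero>)"

definition array_of :: "('a \<Rightarrow> complex) \<Rightarrow> (int \<times> int \<Rightarrow> 'a) \<Rightarrow> complex fls fls" where
  "array_of h c = Abs_fls (\<lambda>j. series_of h (\<lambda>i. c (i, j)))"

lemma iterated_laurent_slice:
  "iterated_laurent c \<Longrightarrow> (\<lambda>i. c (i, j)) \<in> laurent W"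
  by (auto simp: iterated_laurent_def laurent_def)

lemma array_of_nth:
  assumes h: "h \<in> functionals" and c: "iterated_laurent c"
  shows "array_of h c $$ j $$ i = h (c (i, j))"
proof -
  obtain N where N: "\<forall>j<N. \<forall>i. c (i, j) = \<zero>" using c by (auto simp: iterated_laurent_def)
  have "array_of h c $$ j = series_of h (\<lambda>i. c (i, j))"
    unfolding array_of_def
  proof (rule nth_Abs_fls_lower_bound, intro allI impI)
    fix j assume "j < N"
    then show "series_of h (\<lambda>i. c (i, j)) = 0"
      unfolding fls_eq_iff series_of_nth[OF h iterated_laurent_slice[OF c]]
      using N by (simp add: functional_zero h)
  qed
  then show ?thesis by (simp add: series_of_nth[OF h iterated_laurent_slice[OF c]])
qed

lemma laurent2_iterated: "c \<in> laurent2 W \<Longrightarrow> iterated_laurent c"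
  unfolding laurent2_def iterated_laurent_def by blast

lemma series_mult_closed: "range c \<subseteq> carrier W \<Longrightarrow> series_mult W d c n \<in> carrier W"
  unfolding series_mult_def by (intro support_sum_closed) auto

lemma functional_clear:
  assumes h: "h \<in> functionals" and c: "iterated_laurent c"
  shows "h (series_mult W (\<lambda>(i, j). diff_pow (int k) i j) c (i, j)) = (x1_minus_x2 ^ k * array_of h c) $$ j $$ i"
proof -
  have cW: "c p \<in> carrier W" for p using c by (auto simp: iterated_laurent_def)
  let ?d = "\<lambda>(i, j). diff_pow (int k) i j"
  \<comment> \<open>The body of \<open>diff_pow\<close> allows every nonnegative power of x2, but
    for the exponent k \<ge> 0 the binomial coefficients vanish beyond k, which leaves k + 1
    points.\<close>
  let ?I = "(\<lambda>l. (int (k - l), int l)) ` {..k}"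
  have out: "?d p = 0" if "p \<notin> ?I" for p
  proof (rule ccontr)
    assume nz: "?d p \<noteq> 0"
    obtain a b where p: "p = (a, b)" by fastforce
    then have ab: "0 \<le> b" "a + b = int k" using nz by (auto simp: diff_pow_def split: if_splits)
    have "(of_nat k :: complex) gchoose nat b \<noteq> 0" using nz p ab by (simp add: diff_pow_def)
    then have "k choose nat b \<noteq> 0" by (simp flip: binomial_gbinomial)
    then have "nat b \<le> k" by (metis binomial_eq_0 not_le)
    then have "p = (\<lambda>l. (int (k - l), int l)) (nat b)" using ab p by auto
    with \<open>nat b \<le> k\<close> have "p \<in> ?I" by blast
    with that show False by contradiction
  qed
  have "h (series_mult W ?d c (i, j)) = (\<Sum>p\<in>?I. h (?d p \<odot> c ((i, j) - p)))"
    unfolding series_mult_def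
    by (rule functional_support_sum[OF h]) (use out cW in auto)
  also have "\<dots> = (\<Sum>p\<in>?I. ?d p * h (c ((i, j) - p)))"
    using cW by (simp add: functional_scale[OF h])
  also have "\<dots> = (\<Sum>l\<le>k. ?d (int (k - l), int l) * h (c ((i, j) - (int (k - l), int l))))"
    by (subst sum.reindex) (auto simp: inj_on_def)
  also have "\<dots> = (\<Sum>l\<le>k. (- 1) ^ l * of_nat (k choose l) * array_of h c $$ (j - int l) $$ (i - int (k - l)))"
    by (intro sum.cong) (simp_all add: diff_pow_def array_of_nth[OF h c] binomial_gbinomial)
  finally show ?thesis by (simp add: x1_minus_x2_power_mult_nth)
qed

lemma bounded2_array_of:
  assumes "h \<in> functionals" "range c \<subseteq> carrier W" "\<forall>i j. i < N \<or> j < N \<longrightarrow> c (i, j) = \<zero>"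
  shows "bounded2 N (array_of h c)"
proof -
  have "c \<in> laurent2 W" unfolding laurent2_def using assms(2,3) by blast
  then have "iterated_laurent c" by (rule laurent2_iterated)
  then show ?thesis using assms(1,3) by (simp add: bounded2_def array_of_nth functional_zero)
qed

lemma subst_first_closed: "range c \<subseteq> carrier W \<Longrightarrow> subst_first W P c p \<in> carrier W"
  unfolding subst_first_def by (cases p) (auto intro!: support_sum_closed split: prod.split)

lemma functional_subst_first:
  assumes h: "h \<in> functionals" and c: "c \<in> laurent2 W" and P: "positive_order P"
  shows "h (subst_first W P c (n, m)) = (if m < 0 then 0 else subst2 P (array_of h c) $ nat m $$ n)"
proof -
  obtain N where N: "\<forall>i j. i < N \<or> j < N \<longrightarrow> c (i, j) = \<zero>" and "range c \<subseteq> carrier W"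
    using c by (auto simp: laurent2_def)
  then have cW: "c p \<in> carrier W" for p by auto
  note b = bounded2_array_of[OF h \<open>range c \<subseteq> carrier W\<close> N]
  obtain C where C: "\<forall>i\<ge>N. \<forall>j. mono2 P (i, j) \<in> small (nat m) (i + j - C)"
    using mono2_small[OF P] by blast
  let ?I = "{N..n + C - N} \<times> {N..n + C - N}"
  have coeff: "coeff2 (P powi i) (n - j, m) = (if m < 0 then 0 else mono2 P (i, j) $ nat m $$ n)" for i j
    by (simp add: coeff2_def mono2_def fls_X_intpow_times_conv_shift(2))
  have out: "c (i, j) = \<zero> \<or> mono2 P (i, j) $ nat m $$ n = 0" if "(i, j) \<notin> ?I" for i j
  proof (cases "i < N \<or> j < N")
    case False
    then show ?thesis using that C smallD[of "mono2 P (i, j)" "nat m" "i + j - C" "nat m" n] by auto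
  qed (use N in auto)
  have "h (subst_first W P c (n, m)) = (\<Sum>(i, j)\<in>?I. h (coeff2 (P powi i) (n - j, m) \<odot> c (i, j)))"
    unfolding subst_first_def prod.case
  proof (subst functional_support_sum[OF h, of _ ?I])
    fix p assume "p \<notin> ?I"
    then show "(\<lambda>(i, j). coeff2 (P powi i) (n - j, m) \<odot> c (i, j)) p = \<zero>"
      using out[of "fst p" "snd p"] cW[of p] by (cases p) (auto simp: coeff)
  next
    show "(\<lambda>(i, j). coeff2 (P powi i) (n - j, m) \<odot> c (i, j)) p \<in> carrier W" for p
      using cW[of p] by (cases p) simp
  qed (simp_all add: split_def)
  also have "\<dots> = (if m < 0 then 0 else \<Sum>(i, j)\<in>?I. h (c (i, j)) * mono2 P (i, j) $ nat m $$ n)"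
    using cW by (simp add: functional_scale[OF h] coeff mult.commute)
  also have "(\<Sum>(i, j)\<in>?I. h (c (i, j)) * mono2 P (i, j) $ nat m $$ n) =
      (\<Sum>p\<in>?I. (const2 (coeff_at (array_of h c) p) * mono2 P p) $ nat m $$ n)"
    unfolding const2_nth by (simp add: coeff_at_def split_def array_of_nth[OF h laurent2_iterated[OF c]])
  also have "\<dots> = subst2 P (array_of h c) $ nat m $$ n"
    unfolding fsums_nth[OF subst2_fsums[OF P b]] const2_nth
  proof (rule Sum_any.expand_superset[symmetric])
    show "{p. coeff_at (array_of h c) p * mono2 P p $ nat m $$ n \<noteq> 0} \<subseteq> ?I"
    proof (intro subsetI, rule ccontr)
      fix p assume "p \<in> {p. coeff_at (array_of h c) p * mono2 P p $ nat m $$ n \<noteq> 0}" "p \<notin> ?I"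
      then show False
        using out[of "fst p" "snd p"]
        by (auto simp: coeff_at_def split_def array_of_nth[OF h laurent2_iterated[OF c]] functional_zero[OF h])
    qed
  qed simp
  finally show ?thesis .
qed

text \<open>The image under \<open>h\<close> of \<open>z\<^sup>s b(x, z)\<close>.\<close>

definition shifted_series_of :: "nat \<Rightarrow> ('a \<Rightarrow> complex) \<Rightarrow> (int \<times> int \<Rightarrow> 'a) \<Rightarrow> complex fls fps" where
  "shifted_series_of s h b = Abs_fps (\<lambda>m. series_of h (\<lambda>n. b (n, int m - int s)))"

lemma functional_series_mult:
  assumes h: "h \<in> functionals" and b: "\<And>m. (\<lambda>n. b (n, m)) \<in> laurent W"
    and s: "\<And>n m. m < - int s \<Longrightarrow> b (n, m) = \<zero>"
  shows "h (series_mult W (coeff2 Q) b (n, m)) =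
    (if m + int s < 0 then 0 else (Q * shifted_series_of s h b) $ nat (m + int s) $$ n)"
proof -
  have bW: "b p \<in> carrier W" for p using b[of "snd p"] by (cases p) (auto simp: laurent_def)
  let ?B = "shifted_series_of s h b"
  \<comment> \<open>\<open>M\<close> is the exponent of z after the shift by z^s; only the
    coefficients of \<open>Q\<close> and of the shifted series up to z^M enter.\<close>
  define M where "M = nat (m + int s)"
  obtain q where q: "Q \<in> small M q" using small_ex by blast
  obtain r where r: "?B \<in> small M r" using small_ex by blast
  \<comment> \<open>The lower bound in x of \<open>b\<close> may vary with the power of z;
    \<open>t\<close> is common to the finitely many powers in question.\<close>
  obtain t where t: "\<And>k i. k \<le> M \<Longrightarrow> i < t \<Longrightarrow> b (i, int k - int s) = \<zero>"
  proof -
    have "\<exists>N. \<forall>i<N. b (i, int k - int s) = \<zero>" for k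
      using b[of "int k - int s"] by (auto simp: laurent_def)
    then have "\<exists>N. \<forall>k. \<forall>i<N k. b (i, int k - int s) = \<zero>" by (intro choice allI)
    then obtain N where N: "\<And>k i. i < N k \<Longrightarrow> b (i, int k - int s) = \<zero>" by blast
    have "b (i, int k - int s) = \<zero>" if "k \<le> M" "i < (MIN k\<in>{..M}. N k)" for k i
    proof -
      have "(MIN k\<in>{..M}. N k) \<le> N k" using that(1) by (intro Min_le) auto
      with that(2) have "i < N k" by linarith
      then show ?thesis by (rule N)
    qed
    then show thesis by (rule that)
  qed
  \<comment> \<open>The bound \<open>t\<close> makes the sum in W finite and \<open>r\<close> bounds
    the product of complex series; the minimum gives one interval for both.\<close>
  let ?J = "{q..n - min r t}"
  let ?I = "?J \<times> {0..m + int s}"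
  have out: "coeff2 Q p = 0 \<or> b ((n, m) - p) = \<zero>" if p_notin: "p \<notin> ?I" for p
  proof -
    obtain i j where p: "p = (i, j)" by fastforce
    consider "j < 0" | "m + int s < j" | "0 \<le> j" "j \<le> m + int s" "i < q"
      | "0 \<le> j" "j \<le> m + int s" "n - min r t < i"
      using p_notin unfolding p mem_Sigma_iff atLeastAtMost_iff by linarith
    then show ?thesis
    proof cases
      case 3
      then have "Q $ nat j $$ i = 0" by (intro smallD[OF q]) (auto simp: M_def)
      then show ?thesis by (simp add: p coeff2_def)
    next
      case 4
      then have "b (n - i, int (nat (m + int s - j)) - int s) = \<zero>"
        by (intro t) (auto simp: M_def)
      then show ?thesis using 4 p by simp
    qed (use s p in \<open>auto simp: coeff2_def\<close>)
  qed
  have "h (series_mult W (coeff2 Q) b (n, m)) = (\<Sum>p\<in>?I. h (coeff2 Q p \<odot> b ((n, m) - p)))"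
    unfolding series_mult_def
  proof (rule functional_support_sum[OF h])
    show "coeff2 Q p \<odot> b ((n, m) - p) = \<zero>" if "p \<notin> ?I" for p
      using out[OF that] bW[of "(n, m) - p"] by (auto)
  qed (use bW in auto)
  also have "\<dots> = (\<Sum>p\<in>?I. coeff2 Q p * h (b ((n, m) - p)))"
    using bW by (simp add: functional_scale[OF h])
  also have "\<dots> = (\<Sum>(i, j)\<in>?I. coeff2 Q (i, j) * h (b (n - i, m - j)))"
    by (rule sum.cong) auto
  also have "\<dots> = (\<Sum>j=0..m + int s. \<Sum>i\<in>?J. coeff2 Q (i, j) * h (b (n - i, m - j)))"
    by (subst sum.swap) (simp only: sum.cartesian_product)
  finally have eq: "h (series_mult W (coeff2 Q) b (n, m)) = \<dots>" .
  show ?thesis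
  proof (cases "m + int s < 0")
    case False
    then have M: "m + int s = int M" by (simp add: M_def)
    have "(\<Sum>j=0..m + int s. \<Sum>i\<in>?J. coeff2 Q (i, j) * h (b (n - i, m - j))) =
        (\<Sum>j=0..M. \<Sum>i\<in>?J. Q $ j $$ i * h (b (n - i, m - int j)))"
      unfolding M by (rule sum.reindex_bij_witness[of _ int nat]) (auto simp: coeff2_def)
    also have "\<dots> = (\<Sum>j=0..M. (Q $ j * ?B $ (M - j)) $$ n)"
    proof (rule sum.cong[OF refl])
      fix j assume j: "j \<in> {0..M}"
      have "(Q $ j * ?B $ (M - j)) $$ n = (\<Sum>i\<in>?J. Q $ j $$ i * ?B $ (M - j) $$ (n - i))"
        by (rule fls_times_nth_interval[of _ _ r]) (use smallD[OF q] smallD[OF r] j in auto)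
      moreover have "int (M - j) - int s = m - int j" using j M by auto
      then have "?B $ (M - j) $$ (n - i) = h (b (n - i, m - int j))" for i
        by (simp add: shifted_series_of_def series_of_nth[OF h b])
      ultimately show "(\<Sum>i\<in>?J. Q $ j $$ i * h (b (n - i, m - int j))) = (Q $ j * ?B $ (M - j)) $$ n" by simp
    qed
    finally show ?thesis using False eq by (simp add: fps_mult_nth fls_sum_nth M_def)
  qed (simp add: eq)
qed

text \<open>The bridge between W and complex series, crossed in both directions: the axiom of the
  given module is turned into scalar identities, and the twisted identities are reassembled in
  W.\<close>

lemma subst_first_eq_series_mult_iff:
  assumes c: "c \<in> laurent2 W" and P: "positive_order P" and b: "\<And>m. (\<lambda>n. b (n, m)) \<in> laurent W"
    and s: "\<And>n m. m < - int s \<Longrightarrow> b (n, m) = \<zero>"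
  shows "subst_first W P c = series_mult W (coeff2 Q) b \<longleftrightarrow>
    (\<forall>h\<in>functionals. fps_X ^ s * subst2 P (array_of h c) = Q * shifted_series_of s h b)"
proof -
  have "b (n, m) \<in> carrier W" for n m using b[of m] by (auto simp: laurent_def)
  then have bW: "range b \<subseteq> carrier W" by auto
  have cW: "range c \<subseteq> carrier W" using c by (auto simp: laurent2_def)
  \<comment> \<open>Multiplication by z^s fills the exponents from -s to -1 with zeros, in
    accordance with a substitution that has no negative powers of z.\<close>
  have shift: "(if m < 0 then 0 else S $ nat m $$ n) =
      (if m + int s < 0 then 0 else (fps_X ^ s * S) $ nat (m + int s) $$ n)" for S :: "complex fls fps" and m n
  proof -
    consider "m < - int s" | "- int s \<le> m" "m < 0" | "0 \<le> m" by linarith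
    then show ?thesis
      by cases (auto simp: fps_X_power_mult_nth nat_add_distrib)
  qed
  define L where "L h = fps_X ^ s * subst2 P (array_of h c)" for h
  define R where "R h = Q * shifted_series_of s h b" for h
  have hL: "h (subst_first W P c (n, m)) = (if m + int s < 0 then 0 else L h $ nat (m + int s) $$ n)"
    if "h \<in> functionals" for h n m
    unfolding L_def functional_subst_first[OF that c P] by (rule shift)
  have hR: "h (series_mult W (coeff2 Q) b (n, m)) = (if m + int s < 0 then 0 else R h $ nat (m + int s) $$ n)"
    if "h \<in> functionals" for h n m
    unfolding R_def by (rule functional_series_mult[OF that b s])
  have "subst_first W P c = series_mult W (coeff2 Q) b \<longleftrightarrow> (\<forall>h\<in>functionals. L h = R h)"
  proof (intro iffI ballI)
    fix h assume eq: "subst_first W P c = series_mult W (coeff2 Q) b" and h: "h \<in> functionals"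
    show "L h = R h"
    proof (intro fps_ext fls_eqI)
      fix m n
      show "L h $ m $$ n = R h $ m $$ n"
        using hL[OF h, of n "int m - int s"] hR[OF h, of n "int m - int s"] unfolding eq by simp
    qed
  next
    assume eq: "\<forall>h\<in>functionals. L h = R h"
    show "subst_first W P c = series_mult W (coeff2 Q) b"
    proof (intro ext, rule functional_eqI)
      fix p :: "int \<times> int" and h assume h: "h \<in> functionals"
      obtain n m where p: "p = (n, m)" by fastforce
      show "h (subst_first W P c p) = h (series_mult W (coeff2 Q) b p)"
        unfolding p hL[OF h] hR[OF h] using eq h by simp
    next
      show "subst_first W P c p \<in> carrier W" "series_mult W (coeff2 Q) b p \<in> carrier W" for p :: "int \<times> int"
        by (rule subst_first_closed[OF cW], rule series_mult_closed[OF bW])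
    qed
  qed
  then show ?thesis by (simp only: L_def R_def)
qed

section \<open>Twisting operators and their products\<close>

lemma linear_mapsD:
  assumes "P \<in> linear_maps W W"
  shows "x \<in> carrier W \<Longrightarrow> P x \<in> carrier W"
    and "x \<in> carrier W \<Longrightarrow> y \<in> carrier W \<Longrightarrow> P (x \<oplus> y) = P x \<oplus> P y"
    and "x \<in> carrier W \<Longrightarrow> P (c \<odot> x) = c \<odot> P x"
    and "P \<zero> = \<zero>"
proof -
  show lin: "x \<in> carrier W \<Longrightarrow> P x \<in> carrier W"
    "x \<in> carrier W \<Longrightarrow> y \<in> carrier W \<Longrightarrow> P (x \<oplus> y) = P x \<oplus> P y"
    "x \<in> carrier W \<Longrightarrow> P (c \<odot> x) = c \<odot> P x" for x y c
    using assms by (auto simp: linear_maps_def)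
  show "P \<zero> = \<zero>" using lin(1)[of \<zero>] lin(3)[of \<zero> 0] by simp
qed

lemma functional_comp_linear:
  assumes "h \<in> functionals" "P \<in> linear_maps W W"
  shows "(\<lambda>x. h (P x)) \<in> functionals"
  unfolding functionals_def
  using linear_mapsD[OF assms(2)] assms(1) by (simp add: functional_add functional_scale)

definition laurent_operator :: "(int \<Rightarrow> 'a \<Rightarrow> 'a) \<Rightarrow> bool" where
  "laurent_operator P \<longleftrightarrow> (\<forall>n. P n \<in> linear_maps W W) \<and> (\<forall>w\<in>carrier W. (\<lambda>n. P n w) \<in> laurent W)"

lemma laurent_operatorD:
  "laurent_operator P \<Longrightarrow> P n \<in> linear_maps W W"
  "laurent_operator P \<Longrightarrow> w \<in> carrier W \<Longrightarrow> (\<lambda>n. P n w) \<in> laurent W"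
  by (auto simp: laurent_operator_def)

text \<open>The restriction makes each coefficient extensional, as \<open>linear_maps W W\<close>
  demands.\<close>

definition twist_operator :: "complex fps \<Rightarrow> (int \<Rightarrow> 'a \<Rightarrow> 'a) \<Rightarrow> int \<Rightarrow> 'a \<Rightarrow> 'a" where
  "twist_operator f P n = (\<lambda>w\<in>carrier W. twist f (\<lambda>i. P i w) n)"

lemma iterated_laurent_product:
  assumes P: "laurent_operator P" and Q: "laurent_operator Q" and w: "w \<in> carrier W"
  shows "iterated_laurent (\<lambda>(i, j). P i (Q j w))"
proof -
  have Qw: "Q j w \<in> carrier W" for j by (rule linear_mapsD(1)[OF laurent_operatorD(1)[OF Q] w])
  have "P i (Q j w) \<in> carrier W" for i j
    by (rule linear_mapsD(1)[OF laurent_operatorD(1)[OF P] Qw])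
  moreover obtain N where "\<forall>j<N. Q j w = \<zero>"
    using laurent_operatorD(2)[OF Q w] by (auto simp: laurent_def)
  then have "\<forall>j<N. \<forall>i. P i (Q j w) = \<zero>"
    using linear_mapsD(4)[OF laurent_operatorD(1)[OF P]] by simp
  moreover have "\<exists>M. \<forall>i<M. P i (Q j w) = \<zero>" for j
    using laurent_operatorD(2)[OF P Qw, of j] by (auto simp: laurent_def)
  ultimately show ?thesis unfolding iterated_laurent_def by auto
qed

context
  fixes f :: "complex fps"
  assumes f: "subdegree f = 1"
begin

lemma laurent_operator_twist:
  assumes P: "laurent_operator P"
  shows "laurent_operator (twist_operator f P)"
proof -
  note lin = linear_mapsD[OF laurent_operatorD(1)[OF P]]
  note laur = laurent_operatorD(2)[OF P]
  have "twist f (\<lambda>i. P i (x \<oplus> y)) n = twist f (\<lambda>i. P i x) n \<oplus> twist f (\<lambda>i. P i y) n"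
    if "x \<in> carrier W" "y \<in> carrier W" for x y n
    using twist_add[OF f laur[OF that(1)] laur[OF that(2)]] laur[of "x \<oplus> y"] that by (simp add: lin)
  moreover have "twist f (\<lambda>i. P i (c \<odot> x)) n = c \<odot> twist f (\<lambda>i. P i x) n"
    if "x \<in> carrier W" for x c n
    using twist_scale[OF f laur[OF that]] laur[of "c \<odot> x"] that by (simp add: lin)
  moreover have "twist f (\<lambda>i. P i x) n \<in> carrier W" if "x \<in> carrier W" for x n
    by (rule twist_closed[OF f laur[OF that]])
  ultimately have "twist_operator f P n \<in> linear_maps W W" for n
    unfolding linear_maps_def twist_operator_def by auto
  moreover have "(\<lambda>n. twist_operator f P n w) \<in> laurent W" if "w \<in> carrier W" for w
    using twist_laurent[OF f laur[OF that]] that by (simp add: twist_operator_def)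
  ultimately show ?thesis by (simp add: laurent_operator_def)
qed

text \<open>For fixed i, the composite of \<open>h\<close> with \<open>P i\<close> is again a
  functional, so the finite expansion of the inner twist can be pulled out of \<open>P i\<close>.
  Expanding the outer twist and exchanging two finite sums gives the coefficient of
  \<open>twist2\<close>.\<close>

lemma array_of_twist_operators:
  assumes P: "laurent_operator P" and Q: "laurent_operator Q" and w: "w \<in> carrier W"
    and h: "h \<in> functionals"
  shows "array_of h (\<lambda>(i, j). twist_operator f P i (twist_operator f Q j w)) =
    twist2 f (array_of h (\<lambda>(i, j). P i (Q j w)))" (is "array_of h ?c' = twist2 f (array_of h ?c)")
proof (intro fls_eqI)
  fix n k
  note linP = laurent_operatorD(1)[OF P]
  have c: "iterated_laurent ?c" by (rule iterated_laurent_product[OF P Q w])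
  have c': "iterated_laurent ?c'"
    by (rule iterated_laurent_product[OF laurent_operator_twist[OF P] laurent_operator_twist[OF Q] w])
  have Qw: "(\<lambda>j. Q j w) \<in> laurent W" by (rule laurent_operatorD(2)[OF Q w])
  then obtain N where N: "vanishes_below N (\<lambda>j. Q j w)" by (auto simp: laurent_iff)
  define x where "x = twist f (\<lambda>j. Q j w) n"
  have x: "x \<in> carrier W" unfolding x_def by (rule twist_closed[OF f Qw])
  have gP: "g (P i x) = (\<Sum>j=N..n. g (P i (Q j w)) * (fps_to_fls f powi j) $$ n)" if "g \<in> functionals" for g i
    unfolding x_def by (rule functional_twist_sum[OF f functional_comp_linear[OF that linP] N])
  have "\<exists>M. \<forall>i<M. P i (Q j w) = \<zero>" for j
    using c by (auto simp: iterated_laurent_def)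
  then have "\<exists>M. \<forall>j. \<forall>i<M j. P i (Q j w) = \<zero>" by (intro choice allI)
  then obtain M' where M': "\<And>j i. i < M' j \<Longrightarrow> P i (Q j w) = \<zero>" by blast
  \<comment> \<open>Only the j between N and n enter into \<open>x\<close>, so their bounds have a
    minimum; inserting 0 covers an empty range.\<close>
  define M where "M = Min (insert 0 (M' ` {N..n}))"
  have M: "P i (Q j w) = \<zero>" if "j \<le> n" "i < M" for i j
  proof (cases "j < N")
    case True
    then show ?thesis using N linear_mapsD(4)[OF linP] by (simp add: vanishes_below_def)
  next
    case False
    then have "M \<le> M' j" unfolding M_def using that(1) by (intro Min_le) auto
    with that(2) show ?thesis by (intro M') simp
  qed
  have Px: "P i x \<in> carrier W" for i by (rule linear_mapsD(1)[OF linP x])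
  have "P i x = \<zero>" if "i < M" for i
  proof (rule functional_eqI[OF Px zero_closed])
    fix g assume g: "g \<in> functionals"
    show "g (P i x) = g \<zero>" using that by (simp add: gP[OF g] M functional_zero[OF g])
  qed
  then have van: "vanishes_below M (\<lambda>i. P i x)" using Px by (auto simp: vanishes_below_def)
  have "array_of h ?c' $$ n $$ k = h (twist f (\<lambda>i. P i x) k)"
    unfolding array_of_nth[OF h c'] using w x by (simp add: twist_operator_def x_def)
  also have "\<dots> = (\<Sum>i=M..k. h (P i x) * (fps_to_fls f powi i) $$ k)"
    by (rule functional_twist_sum[OF f h van])
  also have "\<dots> = (\<Sum>i=M..k. \<Sum>j=N..n. h (P i (Q j w)) * (fps_to_fls f powi i) $$ k * (fps_to_fls f powi j) $$ n)"
    unfolding gP[OF h] sum_distrib_right by (intro sum.cong refl) (simp add: mult_ac)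
  also have "\<dots> = (\<Sum>j=N..n. \<Sum>i=M..k. array_of h ?c $$ j $$ i * (fps_to_fls f powi i) $$ k * (fps_to_fls f powi j) $$ n)"
    by (subst sum.swap) (simp add: array_of_nth[OF h c])
  also have "\<dots> = twist2 f (array_of h ?c) $$ n $$ k"
  proof (rule twist2_nth[OF f, symmetric])
    show "array_of h ?c $$ j $$ i = 0" if "j < N" for i j
      using N that linear_mapsD(4)[OF linP] by (simp add: array_of_nth[OF h c] vanishes_below_def functional_zero[OF h])
    show "array_of h ?c $$ j $$ i = 0" if "j \<le> n" "i < M" for i j
      using M[OF that] by (simp add: array_of_nth[OF h c] functional_zero[OF h])
  qed
  finally show "array_of h ?c' $$ n $$ k = twist2 f (array_of h ?c) $$ n $$ k" .
qed

text \<open>\<open>b\<close> stands for the coefficients of Y_W(Y(u, z)v, x)w, with \<open>s\<close>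
  bounding the order of its pole in z. The twist acts on x alone and leaves \<open>s\<close>
  unchanged.\<close>

lemma twisted_product:
  fixes g :: "complex fps" and k :: nat
  assumes g: "subdegree g = 1" and fg: "f oo g = fps_X" and gf: "g oo f = fps_X"
    and P: "laurent_operator P" and Q: "laurent_operator Q" and w: "w \<in> carrier W"
    and \<phi>: "positive_order \<phi>"
    and b: "\<And>m. (\<lambda>n. b (n, m)) \<in> laurent W" and s: "\<And>n m. m < - int s \<Longrightarrow> b (n, m) = \<zero>"
  defines "d \<equiv> \<lambda>(i, j). diff_pow (int k) i j"
    and "\<psi> \<equiv> fls_subst (fps_to_fls g) (compose_coeffs f \<phi>)"
  assumes c: "series_mult W d (\<lambda>(i, j). P i (Q j w)) \<in> laurent2 W"
    and eq: "subst_first W \<phi> (series_mult W d (\<lambda>(i, j). P i (Q j w))) =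
      series_mult W (coeff2 ((\<phi> - fps_const fls_X) ^ k)) b"
  shows "series_mult W d (\<lambda>(i, j). twist_operator f P i (twist_operator f Q j w)) \<in> laurent2 W" (is ?L)
    and "subst_first W \<psi> (series_mult W d (\<lambda>(i, j). twist_operator f P i (twist_operator f Q j w))) =
      series_mult W (coeff2 ((\<psi> - fps_const fls_X) ^ k)) (\<lambda>(n, m). twist f (\<lambda>i. b (i, m)) n)" (is ?E)
proof -
  let ?p = "\<lambda>(i, j). P i (Q j w)"
  let ?p' = "\<lambda>(i, j). twist_operator f P i (twist_operator f Q j w)"
  let ?c = "series_mult W d ?p" and ?c' = "series_mult W d ?p'"
  let ?b' = "\<lambda>(n, m). twist f (\<lambda>i. b (i, m)) n"
  have p: "iterated_laurent ?p" by (rule iterated_laurent_product[OF P Q w])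
  have p': "iterated_laurent ?p'"
    by (rule iterated_laurent_product[OF laurent_operator_twist[OF P] laurent_operator_twist[OF Q] w])
  \<comment> \<open>\<open>N\<close> comes from the series with values in W, so it is uniform in the
    functional; this uniformity puts the twisted product into \<open>laurent2 W\<close>.\<close>
  obtain N where cW: "range ?c \<subseteq> carrier W" and N: "\<forall>i j. i < N \<or> j < N \<longrightarrow> ?c (i, j) = \<zero>"
    using c unfolding laurent2_def by blast
  have arr: "array_of h ?c = x1_minus_x2 ^ k * array_of h ?p" if h: "h \<in> functionals" for h
  proof (intro fls_eqI)
    show "array_of h ?c $$ j $$ i = (x1_minus_x2 ^ k * array_of h ?p) $$ j $$ i" for i j
      unfolding array_of_nth[OF h laurent2_iterated[OF c]] unfolding d_def by (rule functional_clear[OF h p])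
  qed
  have bnd: "bounded2 N (x1_minus_x2 ^ k * array_of h ?p)" if h: "h \<in> functionals" for h
    using bounded2_array_of[OF h cW N] by (simp only: arr[OF h])
  have hc': "h (?c' (i, j)) = (x1_minus_x2 ^ k * twist2 f (array_of h ?p)) $$ j $$ i" if h: "h \<in> functionals" for h i j
    unfolding d_def functional_clear[OF h p'] array_of_twist_operators[OF P Q w h] ..
  have c'W: "?c' q \<in> carrier W" for q
    by (rule series_mult_closed) (use p' in \<open>simp add: iterated_laurent_def\<close>)
  have "?c' (i, j) = \<zero>" if "i < N \<or> j < N" for i j
  proof (rule functional_eqI[OF c'W zero_closed])
    fix h assume h: "h \<in> functionals"
    show "h (?c' (i, j)) = h \<zero>"
      unfolding hc'[OF h] functional_zero[OF h]
      using bounded2_twisted[OF f g fg gf bnd[OF h]] that unfolding bounded2_def by blast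
  qed
  then show c': ?L unfolding laurent2_def using c'W by blast
  have arr': "array_of h ?c' = x1_minus_x2 ^ k * twist2 f (array_of h ?p)" if h: "h \<in> functionals" for h
    by (intro fls_eqI) (simp only: array_of_nth[OF h laurent2_iterated[OF c']] hc'[OF h])
  have \<psi>: "positive_order \<psi>"
    unfolding \<psi>_def by (intro positive_order_fls_subst g positive_order_compose_coeffs f \<phi>)
  have b': "(\<lambda>n. ?b' (n, m)) \<in> laurent W" for m
    using twist_laurent[OF f b] by simp
  have s': "?b' (n, m) = \<zero>" if "m < - int s" for n m
    using s[OF that] twist_const[OF f zero_closed, of n] by (simp cong: if_cong)
  have ser: "shifted_series_of s h ?b' = compose_coeffs f (shifted_series_of s h b)" if h: "h \<in> functionals" for h
    by (intro fps_ext) (simp add: shifted_series_of_def compose_coeffs_def series_of_twist[OF f h b])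
  have "\<forall>h\<in>functionals. fps_X ^ s * subst2 \<phi> (array_of h ?c) = (\<phi> - fps_const fls_X) ^ k * shifted_series_of s h b"
    using eq subst_first_eq_series_mult_iff[OF c \<phi> b s] by simp
  then have "\<forall>h\<in>functionals. fps_X ^ s * subst2 \<psi> (array_of h ?c') = (\<psi> - fps_const fls_X) ^ k * shifted_series_of s h ?b'"
    using subst2_twisted[OF f g fg gf \<phi> bnd] by (simp add: arr arr' ser \<psi>_def)
  then show ?E
    using subst_first_eq_series_mult_iff[OF c' \<psi> b' s'] by blast
qed

end

end

section \<open>The twisted module\<close>

lemma complex_module_iff: "complex_module W \<longleftrightarrow> complex_space W"
  by (simp add: complex_module_def)

context
  fixes W :: "('v, 'w) coordinated_structure" and Y :: "'v \<Rightarrow> int \<Rightarrow> 'w \<Rightarrow> 'w"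
begin

text \<open>A twist changes only the field \<open>mop\<close>, which the vector space structure,
  sums and linear maps do not read.\<close>

lemma complex_space_mop_update: "complex_space (W\<lparr>mop := Y\<rparr>) \<longleftrightarrow> complex_space W"
  by (simp add: Module.module_def abelian_group_def abelian_monoid_def abelian_group_axioms_def module_axioms_def)

lemma support_sum_mop_update: "support_sum (W\<lparr>mop := Y\<rparr>) = support_sum W"
  by (intro ext) (simp add: support_sum_def finsum_def)

lemma series_mult_mop_update: "series_mult (W\<lparr>mop := Y\<rparr>) = series_mult W"
  by (intro ext) (simp add: series_mult_def support_sum_mop_update)

lemma subst_first_mop_update: "subst_first (W\<lparr>mop := Y\<rparr>) = subst_first W"
  by (intro ext) (simp add: subst_first_def support_sum_mop_update)

lemma linear_maps_mop_update:
  "linear_maps (W\<lparr>mop := Y\<rparr>) U = linear_maps W U" "linear_maps U (W\<lparr>mop := Y\<rparr>) = linear_maps U W"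
  by (simp_all add: linear_maps_def)

end

lemma operator_mapD:
  assumes "operator_map V W Y"
  shows "Y \<in> extensional (carrier V)"
    and "v \<in> carrier V \<Longrightarrow> Y v n \<in> linear_maps W W"
    and "u \<in> carrier V \<Longrightarrow> v \<in> carrier V \<Longrightarrow> w \<in> carrier W \<Longrightarrow> Y (u \<oplus>\<^bsub>V\<^esub> v) n w = Y u n w \<oplus>\<^bsub>W\<^esub> Y v n w"
    and "v \<in> carrier V \<Longrightarrow> w \<in> carrier W \<Longrightarrow> Y (c \<odot>\<^bsub>V\<^esub> v) n w = c \<odot>\<^bsub>W\<^esub> Y v n w"
  using assms by (auto simp: operator_map_def)

context
  fixes V :: "('v, 'm) vertex_structure_scheme" and f g :: "complex fps"
  assumes V: "weak_quantum_vertex_algebra V"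
    and f: "subdegree f = 1" and g: "subdegree g = 1" and fg: "f oo g = fps_X" and gf: "g oo f = fps_X"
begin

lemma twisted_module_eq:
  fixes W :: "('v, 'w) coordinated_structure"
  assumes "complex_space W"
  shows "twisted_module V f W = W\<lparr>mop := (\<lambda>v\<in>carrier V. complex_module.twist_operator W f (mop W v))\<rparr>"
proof -
  interpret complex_module W using assms by (simp add: complex_module_iff)
  show ?thesis
    unfolding twisted_module_def twist_operator_def[abs_def] twist_def ..
qed

lemma coordinated_module_twisted:
  fixes W :: "('v, 'w) coordinated_structure"
  assumes W: "coordinated_module V \<phi> W" and \<phi>: "positive_order \<phi>"
  shows "coordinated_module V (fls_subst (fps_to_fls g) (compose_coeffs f \<phi>)) (twisted_module V f W)"
proof -
  have WC: "complex_space W" using W by (simp add: coordinated_module_def)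
  interpret complex_module W using WC by (simp add: complex_module_iff)
  interpret VC: complex_module V
    using V by (simp add: complex_module_iff weak_quantum_vertex_algebra_def)
  have opV: "operator_map V V (vop V)" and vac: "vac V \<in> carrier V"
    and laurV: "\<And>u v. u \<in> carrier V \<Longrightarrow> v \<in> carrier V \<Longrightarrow> (\<lambda>n. vop V u n v) \<in> laurent V"
    using V by (simp_all add: weak_quantum_vertex_algebra_def)
  have op: "operator_map V W (mop W)"
    and laur: "\<And>v w. v \<in> carrier V \<Longrightarrow> w \<in> carrier W \<Longrightarrow> (\<lambda>n. mop W v n w) \<in> laurent W"
    and unit: "\<And>w n. w \<in> carrier W \<Longrightarrow> mop W (vac V) n w = (if n = 0 then w else \<zero>\<^bsub>W\<^esub>)"
    using W by (simp_all add: coordinated_module_def)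
  note opD = operator_mapD[OF op]
  define Y where "Y = (\<lambda>v\<in>carrier V. twist_operator f (mop W v))"
  have tw: "twisted_module V f W = W\<lparr>mop := Y\<rparr>"
    unfolding Y_def by (rule twisted_module_eq[OF WC])
  have lop: "laurent_operator (mop W v)" if "v \<in> carrier V" for v
    using opD(2)[OF that] laur[OF that] by (simp add: laurent_operator_def)
  have lopY: "laurent_operator (Y v)" if "v \<in> carrier V" for v
    using laurent_operator_twist[OF f lop[OF that]] that by (simp add: Y_def)
  have Y: "Y v n w = twist f (\<lambda>i. mop W v i w) n" if "v \<in> carrier V" "w \<in> carrier W" for v n w
    using that by (simp add: Y_def twist_operator_def)
  have closedV: "vop V u n v \<in> carrier V" if "u \<in> carrier V" "v \<in> carrier V" for u n v
    using VC.linear_mapsD(1)[OF operator_mapD(2)[OF opV that(1)] that(2)] .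
  have add: "Y (u \<oplus>\<^bsub>V\<^esub> v) n w = Y u n w \<oplus>\<^bsub>W\<^esub> Y v n w"
    if "u \<in> carrier V" "v \<in> carrier V" "w \<in> carrier W" for u v n w
    using that twist_add[OF f laur laur, of u w v w n] laur[of "u \<oplus>\<^bsub>V\<^esub> v" w]
    by (simp add: Y opD(3))
  have scale: "Y (c \<odot>\<^bsub>V\<^esub> v) n w = c \<odot>\<^bsub>W\<^esub> Y v n w"
    if "v \<in> carrier V" "w \<in> carrier W" for c v n w
    using that twist_scale[OF f laur, of v w c n] laur[of "c \<odot>\<^bsub>V\<^esub> v" w]
    by (simp add: Y opD(4))
  have opY: "operator_map V W Y"
    unfolding operator_map_def using add scale lopY by (auto simp: laurent_operator_def Y_def)
  let ?\<psi> = "fls_subst (fps_to_fls g) (compose_coeffs f \<phi>)"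
  let ?d = "\<lambda>k (i, j). diff_pow (int k) i j"
  have product: "\<exists>k. (\<forall>w\<in>carrier W. series_mult W (?d k) (\<lambda>(i, j). Y u i (Y v j w)) \<in> laurent2 W) \<and>
      (\<forall>w\<in>carrier W. subst_first W ?\<psi> (series_mult W (?d k) (\<lambda>(i, j). Y u i (Y v j w))) =
        series_mult W (coeff2 ((?\<psi> - fps_const fls_X) ^ k)) (\<lambda>(n, m). Y (vop V u m v) n w))"
    if u: "u \<in> carrier V" and v: "v \<in> carrier V" for u v
  proof -
    obtain k where k:
      "\<And>w. w \<in> carrier W \<Longrightarrow> series_mult W (?d k) (\<lambda>(i, j). mop W u i (mop W v j w)) \<in> laurent2 W"
      "\<And>w. w \<in> carrier W \<Longrightarrow> subst_first W \<phi> (series_mult W (?d k) (\<lambda>(i, j). mop W u i (mop W v j w))) =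
        series_mult W (coeff2 ((\<phi> - fps_const fls_X) ^ k)) (\<lambda>(n, m). mop W (vop V u m v) n w)"
      using W u v unfolding coordinated_module_def cleared_product_def by blast
    obtain N where N: "\<forall>m<N. vop V u m v = \<zero>\<^bsub>V\<^esub>"
      using laurV[OF u v] by (auto simp: laurent_def)
    \<comment> \<open>\<open>s\<close> bounds the pole of Y(u, z)v at z = 0; \<open>nat\<close>
      gives 0 when there is no pole, and m < -s still implies m < N.\<close>
    define s where "s = nat (- N)"
    show ?thesis
    proof (intro exI[of _ k] conjI ballI)
      fix w assume w: "w \<in> carrier W"
      let ?b = "\<lambda>(n, m). mop W (vop V u m v) n w"
      have b: "(\<lambda>n. ?b (n, m)) \<in> laurent W" for m
        using laur[OF closedV[OF u v] w] by simp
      have s: "?b (n, m) = \<zero>\<^bsub>W\<^esub>" if "m < - int s" for n m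
      proof -
        \<comment> \<open>Zero is written as a scalar multiple so that homogeneity in the first
          argument makes its operators vanish.\<close>
        have "vop V u m v = 0 \<odot>\<^bsub>V\<^esub> \<zero>\<^bsub>V\<^esub>" using N that by (simp add: s_def split: if_splits)
        then show ?thesis
          using opD(4)[OF VC.zero_closed w, of 0 n] linear_mapsD(1)[OF opD(2)[OF VC.zero_closed] w] by simp
      qed
      note main = twisted_product[OF f g fg gf lop[OF u] lop[OF v] w \<phi> b s k(1)[OF w] k(2)[OF w]]
      have p: "(\<lambda>(i, j). Y u i (Y v j w)) =
          (\<lambda>(i, j). twist_operator f (mop W u) i (twist_operator f (mop W v) j w))"
        using u v by (simp add: Y_def)
      show "series_mult W (?d k) (\<lambda>(i, j). Y u i (Y v j w)) \<in> laurent2 W"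
        unfolding p by (rule main(1))
      have q: "(\<lambda>(n, m). Y (vop V u m v) n w) = (\<lambda>(n, m). twist f (\<lambda>i. ?b (i, m)) n)"
        using closedV[OF u v] w by (simp add: Y)
      show "subst_first W ?\<psi> (series_mult W (?d k) (\<lambda>(i, j). Y u i (Y v j w))) =
          series_mult W (coeff2 ((?\<psi> - fps_const fls_X) ^ k)) (\<lambda>(n, m). Y (vop V u m v) n w)"
        unfolding p q by (rule main(2))
    qed
  qed
  have "Y (vac V) n w = (if n = 0 then w else \<zero>\<^bsub>W\<^esub>)" if "w \<in> carrier W" for n w
    using twist_const[OF f that] that by (simp add: Y vac unit cong: if_cong)
  moreover have "(\<lambda>n. Y v n w) \<in> laurent W" if "v \<in> carrier V" "w \<in> carrier W" for v w
    using laurent_operatorD(2)[OF lopY[OF that(1)] that(2)] .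
  ultimately show ?thesis
    unfolding tw coordinated_module_def cleared_product_def complex_space_mop_update
      series_mult_mop_update subst_first_mop_update
    using WC opY product
    by (simp add: operator_map_def linear_maps_mop_update laurent_def laurent2_def)
qed

text \<open>This is equality of records, as an isomorphism of categories demands. Off the carriers
  both sides are \<open>undefined\<close>: in v since \<open>operator_map\<close> is extensional, in
  w since \<open>linear_maps\<close> is.\<close>

lemma twisted_module_twisted_module:
  fixes W :: "('v, 'w) coordinated_structure"
  assumes W: "coordinated_module V \<phi> W"
  shows "twisted_module V g (twisted_module V f W) = W"
proof -
  have WC: "complex_space W" using W by (simp add: coordinated_module_def)
  interpret complex_module W using WC by (simp add: complex_module_iff)
  have op: "operator_map V W (mop W)"
    and laur: "\<And>v w. v \<in> carrier V \<Longrightarrow> w \<in> carrier W \<Longrightarrow> (\<lambda>n. mop W v n w) \<in> laurent W"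
    using W by (simp_all add: coordinated_module_def)
  define Y where "Y = (\<lambda>v\<in>carrier V. twist_operator f (mop W v))"
  have tw: "twisted_module V f W = W\<lparr>mop := Y\<rparr>"
    unfolding Y_def by (rule twisted_module_eq[OF WC])
  have "(\<lambda>v\<in>carrier V. \<lambda>n. \<lambda>w\<in>carrier W. support_sum W (\<lambda>i. (fps_to_fls g powi i) $$ n \<odot>\<^bsub>W\<^esub> Y v i w)) = mop W"
  proof
    fix v
    show "(\<lambda>v\<in>carrier V. \<lambda>n. \<lambda>w\<in>carrier W. support_sum W (\<lambda>i. (fps_to_fls g powi i) $$ n \<odot>\<^bsub>W\<^esub> Y v i w)) v = mop W v"
    proof (cases "v \<in> carrier V")
      case True
      have "(\<lambda>w\<in>carrier W. support_sum W (\<lambda>i. (fps_to_fls g powi i) $$ n \<odot>\<^bsub>W\<^esub> Y v i w)) w = mop W v n w" for n w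
      proof (cases "w \<in> carrier W")
        case w: True
        have "twist g (twist f (\<lambda>i. mop W v i w)) n = mop W v n w"
          by (simp only: twist_twist[OF f g fg laur[OF True w]])
        then show ?thesis using True w by (simp add: Y_def twist_operator_def twist_def[of g])
      next
        case False
        then show ?thesis
          using operator_mapD(2)[OF op True, of n] by (auto simp: linear_maps_def PiE_def extensional_def)
      qed
      then have "(\<lambda>w\<in>carrier W. support_sum W (\<lambda>i. (fps_to_fls g powi i) $$ n \<odot>\<^bsub>W\<^esub> Y v i w)) = mop W v n" for n
        by (rule ext)
      then show ?thesis using True by (simp only: restrict_apply if_True)
    next
      case False
      then show ?thesis using operator_mapD(1)[OF op] by (auto simp: extensional_def)
    qed
  qed
  then show ?thesis
    unfolding tw twisted_module_def[of V g] support_sum_mop_update by simp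
qed

text \<open>For a functional \<open>h\<close> on W2, the composite of \<open>h\<close> with \<theta>
  is one on W1, and by the intertwining property both give the same complex series; their
  compositions with f then agree too.\<close>

lemma module_homs_twisted:
  fixes W1 W2 :: "('v, 'w) coordinated_structure"
  assumes W1: "coordinated_module V \<phi> W1" and W2: "coordinated_module V \<phi>' W2"
    and \<theta>: "\<theta> \<in> module_homs V W1 W2"
  shows "\<theta> \<in> module_homs V (twisted_module V f W1) (twisted_module V f W2)"
proof -
  have WC1: "complex_space W1" and WC2: "complex_space W2"
    using W1 W2 by (simp_all add: coordinated_module_def)
  interpret M1: complex_module W1 using WC1 by (simp add: complex_module_iff)
  interpret M2: complex_module W2 using WC2 by (simp add: complex_module_iff)
  have laur1: "\<And>v w. v \<in> carrier V \<Longrightarrow> w \<in> carrier W1 \<Longrightarrow> (\<lambda>n. mop W1 v n w) \<in> laurent W1"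
    and laur2: "\<And>v w. v \<in> carrier V \<Longrightarrow> w \<in> carrier W2 \<Longrightarrow> (\<lambda>n. mop W2 v n w) \<in> laurent W2"
    using W1 W2 by (simp_all add: coordinated_module_def)
  have lin: "\<theta> \<in> linear_maps W1 W2"
    and hom: "\<And>v n w. v \<in> carrier V \<Longrightarrow> w \<in> carrier W1 \<Longrightarrow> \<theta> (mop W1 v n w) = mop W2 v n (\<theta> w)"
    using \<theta> by (auto simp: module_homs_def)
  have \<theta>W: "\<theta> w \<in> carrier W2" if "w \<in> carrier W1" for w
    using lin that by (auto simp: linear_maps_def)
  have "\<theta> (M1.twist f (\<lambda>i. mop W1 v i w) n) = M2.twist f (\<lambda>i. mop W2 v i (\<theta> w)) n"
    if v: "v \<in> carrier V" and w: "w \<in> carrier W1" for v n w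
  proof (rule M2.functional_eqI)
    show "\<theta> (M1.twist f (\<lambda>i. mop W1 v i w) n) \<in> carrier W2"
      by (intro \<theta>W M1.twist_closed[OF f] laur1 v w)
    show "M2.twist f (\<lambda>i. mop W2 v i (\<theta> w)) n \<in> carrier W2"
      by (intro M2.twist_closed[OF f] laur2 v \<theta>W w)
    fix h assume h: "h \<in> M2.functionals"
    have h\<theta>: "(\<lambda>x. h (\<theta> x)) \<in> M1.functionals"
      unfolding M1.functionals_def using lin \<theta>W
      by (auto simp: linear_maps_def M2.functional_add[OF h] M2.functional_scale[OF h])
    have "h (\<theta> (M1.twist f (\<lambda>i. mop W1 v i w) n)) =
        fls_compose_fps (M1.series_of (\<lambda>x. h (\<theta> x)) (\<lambda>i. mop W1 v i w)) f $$ n"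
      by (rule M1.functional_twist[OF f h\<theta> laur1[OF v w]])
    also have "M1.series_of (\<lambda>x. h (\<theta> x)) (\<lambda>i. mop W1 v i w) = M2.series_of h (\<lambda>i. mop W2 v i (\<theta> w))"
      by (simp add: M1.series_of_def M2.series_of_def hom v w)
    also have "fls_compose_fps \<dots> f $$ n = h (M2.twist f (\<lambda>i. mop W2 v i (\<theta> w)) n)"
      by (rule M2.functional_twist[OF f h laur2[OF v \<theta>W[OF w]], symmetric])
    finally show "h (\<theta> (M1.twist f (\<lambda>i. mop W1 v i w) n)) = h (M2.twist f (\<lambda>i. mop W2 v i (\<theta> w)) n)" .
  qed
  then show ?thesis
    unfolding module_homs_def twisted_module_eq[OF WC1] twisted_module_eq[OF WC2] linear_maps_mop_update
    using lin \<theta>W by (simp add: M1.twist_operator_def M2.twist_operator_def)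
qed

end

section \<open>The categories and the twist functor\<close>

lemma linear_maps_compose:
  assumes "h \<in> linear_maps U W" "g \<in> linear_maps W Z" "complex_space U"
  shows "compose (carrier U) g h \<in> linear_maps U Z"
proof -
  interpret complex_module U using assms by (simp add: complex_module_iff)
  show ?thesis using assms(1,2)
    by (auto simp: linear_maps_def compose_def PiE_iff Pi_iff)
qed

lemma category_coordinated_modules:
  "category (coordinated_modules V \<phi> :: (('v, 'w) coordinated_structure, 'w \<Rightarrow> 'w) category_structure)"
proof -
  have ext: "h \<in> extensional (carrier A)" "x \<in> carrier A \<Longrightarrow> h x \<in> carrier B"
    if "h \<in> module_homs V A B" for A B :: "('v, 'w) coordinated_structure" and h x
    using that by (auto simp: module_homs_def linear_maps_def PiE_def)
  show ?thesis
    unfolding category_def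
  proof (intro conjI ballI)
    fix A assume "A \<in> Obj (coordinated_modules V \<phi> :: (('v, 'w) coordinated_structure, 'w \<Rightarrow> 'w) category_structure)"
    then have A: "coordinated_module V \<phi> A" by (simp add: coordinated_modules_def)
    then interpret complex_module A by (simp add: complex_module_iff coordinated_module_def)
    have "mop A v n w \<in> carrier A" if "v \<in> carrier V" "w \<in> carrier A" for v n w
      using A that by (auto simp: coordinated_module_def operator_map_def intro: linear_mapsD)
    then show "Ident (coordinated_modules V \<phi>) A \<in> Hom (coordinated_modules V \<phi>) A A"
      by (auto simp: coordinated_modules_def module_homs_def linear_maps_def)
  next
    fix A B D :: "('v, 'w) coordinated_structure" and h g
    assume "A \<in> Obj (coordinated_modules V \<phi>)" "h \<in> Hom (coordinated_modules V \<phi>) A B"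
      "g \<in> Hom (coordinated_modules V \<phi>) B D"
    then have A: "coordinated_module V \<phi> A" and h: "h \<in> module_homs V A B" and g: "g \<in> module_homs V B D"
      by (simp_all add: coordinated_modules_def)
    then have AC: "complex_space A" by (simp add: coordinated_module_def)
    then interpret complex_module A by (simp add: complex_module_iff)
    have "mop A v n w \<in> carrier A" if "v \<in> carrier V" "w \<in> carrier A" for v n w
      using A that by (auto simp: coordinated_module_def operator_map_def intro: linear_mapsD)
    moreover have "compose (carrier A) g h \<in> linear_maps A D"
      using h g AC by (intro linear_maps_compose[of _ _ B]) (auto simp: module_homs_def)
    ultimately have "compose (carrier A) g h \<in> module_homs V A D"
      using h g ext(2)[OF h] by (auto simp: module_homs_def compose_eq)
    then show "Comp (coordinated_modules V \<phi>) A B D g h \<in> Hom (coordinated_modules V \<phi>) A D"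
      by (simp add: coordinated_modules_def)
  next
    fix A B :: "('v, 'w) coordinated_structure" and h
    assume "h \<in> Hom (coordinated_modules V \<phi>) A B"
    then have h: "h \<in> module_homs V A B" by (simp add: coordinated_modules_def)
    show "Comp (coordinated_modules V \<phi>) A A B h (Ident (coordinated_modules V \<phi>) A) = h"
      "Comp (coordinated_modules V \<phi>) A B B (Ident (coordinated_modules V \<phi>) B) h = h"
      using ext[OF h] by (auto simp: coordinated_modules_def compose_def extensional_def)
  next
    fix A B D E :: "('v, 'w) coordinated_structure" and h g k
    assume "h \<in> Hom (coordinated_modules V \<phi>) A B"
    then have h: "h \<in> module_homs V A B" by (simp add: coordinated_modules_def)
    show "Comp (coordinated_modules V \<phi>) A D E k (Comp (coordinated_modules V \<phi>) A B D g h) =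
        Comp (coordinated_modules V \<phi>) A B E (Comp (coordinated_modules V \<phi>) B D E k g) h"
      using ext(2)[OF h] by (auto simp: coordinated_modules_def compose_def fun_eq_iff)
  qed
qed

text \<open>The hypotheses are symmetric in \<open>f\<close> and \<open>g\<close>, so the same lemma
  also yields the functor in the opposite direction.\<close>

lemma twisted_module_functor:
  fixes V :: "('v, 'm) vertex_structure_scheme"
  assumes V: "weak_quantum_vertex_algebra V"
    and f: "subdegree f = 1" and g: "subdegree g = 1" and fg: "f oo g = fps_X" and gf: "g oo f = fps_X"
    and \<phi>: "positive_order \<phi>"
  shows "is_functor (coordinated_modules V \<phi> :: (('v, 'w) coordinated_structure, 'w \<Rightarrow> 'w) category_structure)
     (coordinated_modules V (fls_subst (fps_to_fls g) (compose_coeffs f \<phi>))) (twisted_module V f) (\<lambda>W1 W2 \<theta>. \<theta>)"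
  unfolding is_functor_def
  using category_coordinated_modules coordinated_module_twisted[OF V f g fg gf _ \<phi>]
    module_homs_twisted[OF V f g fg gf]
  by (auto simp: coordinated_modules_def twisted_module_def)

theorem theorem2p15:
  fixes V :: "'v vertex_structure"
    and \<phi> :: "complex fls fps"
    and f :: "complex fps"
  assumes "weak_quantum_vertex_algebra V"
    and "associate \<phi>"
    and "f $ 0 = 0"
    and "fps_deriv f $ 0 \<noteq> 0"
  shows "category_isomorphism
     (coordinated_modules V \<phi> :: (('v, 'w) coordinated_structure, 'w \<Rightarrow> 'w) category_structure)
     (coordinated_modules V (twisted_associate f \<phi>))
     (twisted_module V f)
     (\<lambda>W1 W2 \<theta>. \<theta>)"
proof -
  define g where "g = fps_inv f"
  have f: "subdegree f = 1"
    using assms(3,4) by (intro subdegreeI) auto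
  have g: "subdegree g = 1" and fg: "f oo g = fps_X" and gf: "g oo f = fps_X" and inv: "fps_inv g = f"
    unfolding g_def using subdegree_fps_inv[OF f] by auto
  have \<phi>: "positive_order \<phi>" by (rule associate_positive_order[OF assms(2)])
  define \<psi> where "\<psi> = twisted_associate f \<phi>"
  have \<psi>_eq: "\<psi> = fls_subst (fps_to_fls g) (compose_coeffs f \<phi>)"
    by (simp add: \<psi>_def twisted_associate_eq g_def)
  have \<psi>: "positive_order \<psi>"
    unfolding \<psi>_eq by (intro positive_order_fls_subst g positive_order_compose_coeffs f \<phi>)
  have \<phi>_eq: "fls_subst (fps_to_fls f) (compose_coeffs g \<psi>) = \<phi>"
    unfolding \<psi>_eq by (rule fls_subst_twisted_twisted[OF f g fg gf \<phi>])
  have F: "is_functor (coordinated_modules V \<phi> :: (('v, 'w) coordinated_structure, 'w \<Rightarrow> 'w) category_structure)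
     (coordinated_modules V \<psi>) (twisted_module V f) (\<lambda>W1 W2 \<theta>. \<theta>)"
    using twisted_module_functor[OF assms(1) f g fg gf \<phi>] by (simp only: \<psi>_eq)
  have G: "is_functor (coordinated_modules V \<psi> :: (('v, 'w) coordinated_structure, 'w \<Rightarrow> 'w) category_structure)
     (coordinated_modules V \<phi>) (twisted_module V g) (\<lambda>W1 W2 \<theta>. \<theta>)"
    using twisted_module_functor[OF assms(1) g f gf fg \<psi>] by (simp only: \<phi>_eq)
  have GF: "twisted_module V g (twisted_module V f W) = W"
    if "W \<in> Obj (coordinated_modules V \<phi>)" for W :: "('v, 'w) coordinated_structure"
    using that twisted_module_twisted_module[OF assms(1) f g fg gf] by (simp add: coordinated_modules_def)
  have FG: "twisted_module V f (twisted_module V g W) = W"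
    if "W \<in> Obj (coordinated_modules V \<psi>)" for W :: "('v, 'w) coordinated_structure"
    using that twisted_module_twisted_module[OF assms(1) g f gf fg] by (simp add: coordinated_modules_def)
  show ?thesis
    unfolding category_isomorphism_def \<psi>_def[symmetric]
    using F G GF FG by blast
qed

end
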